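(* Let $n\ge 2$ be an integer. The Dirichlet eigenvalues of the hemisphere $\mathbb{S}^n_+$ satisfy, for all $k\ge 1$, $$\lambda_k(\mathbb{S}^n_+)\ \ge\ C_{W,n}(\mathbb{S}^n_+)\,k^{2/n}-\frac{(n-1)(n-2)}{6}.$$ This is asymptotically sharp for the eigenvalue with the highest order on each chain, in the sense that along the subsequence $k=k_+(K)$, $K\to\infty$, $$\lambda_k(\mathbb{S}^n_+)-C_{W,n}(\mathbb{S}^n_+)\,k^{2/n}\ \longrightarrow\ -\frac{(n-1)(n-2)}{6},$$ and for $n=2$ the sequence $\lambda_k(\mathbb{S}^2_+)-C_{W,2}(\mathbb{S}^2_+)\,k$ is identically zero along this subsequence.
   Context: $\mathbb{S}^n_+=\{x\in\mathbb{R}^{n+1}:\|x\|=1,\ x_{n+1}>0\}$ is the unit hemisphere with the round metric. Its Dirichlet eigenvalues ($\Delta u+\lambda u=0$ in $\mathbb{S}^n_+$, $u=0$ on the boundary), repeated according to multiplicity, are $0<\lambda_1\le\lambda_2\le\dots$. The Weyl constant of an $n$-dimensional manifold $M$ is $C_{W,n}(M)=4\pi^2/(\omega_n|M|)^{2/n}$, where $\omega_n$ is the volume of the unit ball in $\mathbb{R}^n$ and $|M|$ the volume of $M$; for the hemisphere $C_{W,n}(\mathbb{S}^n_+)=(n!)^{2/n}$. Known facts and notation: the distinct Dirichlet eigenvalues of $\mathbb{S}^n_+$ in increasing order are $\overline{\lambda}_K=K(K+n-1)$, $K=1,2,\dots$, with multiplicity $m(K)=\binom{n+K-2}{n-1}$.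 The $K$-chain is the set of eigenvalues $\lambda_k$ with $k_-(K)\le k\le k_+(K)$, all equal to $\overline{\lambda}_K$, where $k_-(K)=1+\sum_{i=1}^{K-1}m(i)$ and $k_+(K)=\sum_{i=1}^{K}m(i)$. The eigenvalues $\lambda_{k_-(K)}$ and $\lambda_{k_+(K)}$ are called the eigenvalues of lowest and highest order of the $K$-chain. *)

theory Defs
  imports "HOL-Analysis.Analysis" "HOL-Library.Function_Algebras"
begin

(* The real vector space of all functions 'a => real, in which eigenspaces live. *)
global_interpretation fun_space: vector_space "\<lambda>(c::real) (f::'a \<Rightarrow> real) x. c * f x"
  by unfold_locales (auto simp: fun_eq_iff plus_fun_def algebra_simps)

(* g is the gradient of f and H x the Hessian at x, as a linear map. In finite dimension,
   continuity of x |-> H x h for every h is continuity of H in operator norm. *)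
definition C2_on :: "'a::euclidean_space set \<Rightarrow> ('a \<Rightarrow> real) \<Rightarrow> bool" where
  "C2_on S f \<longleftrightarrow> (\<exists>g H. (\<forall>x\<in>S. (GDERIV f x :> g x) \<and> (g has_derivative H x) (at x)) \<and>
                       (\<forall>h. continuous_on S (\<lambda>x. H x h)))"

definition laplacian :: "('a::euclidean_space \<Rightarrow> real) \<Rightarrow> 'a \<Rightarrow> real" where
  "laplacian f x = (\<Sum>b\<in>Basis. (deriv ^^ 2) (\<lambda>t. f (x + t *\<^sub>R b)) 0)"

(* For u on the unit sphere, u o sgn is its extension that is constant along rays
   (sgn y = y / norm y). At points of the unit sphere its Euclidean Laplacian is the
   Laplace-Beltrami operator of the round metric applied to u. *)
definition sphere_laplacian :: "('a::euclidean_space \<Rightarrow> real) \<Rightarrow> 'a \<Rightarrow> real" where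
  "sphere_laplacian u = laplacian (u \<circ> sgn)"

(* M is a relatively open subset of the unit sphere, so sgn -` M is the open cone over M.
   Functions are set to 0 off M, both so that they are determined by their values on M and
   to express the boundary condition: u is continuous up to the boundary and vanishes there. *)
definition dirichlet_eigenspace :: "'a::euclidean_space set \<Rightarrow> real \<Rightarrow> ('a \<Rightarrow> real) set" where
  "dirichlet_eigenspace M \<mu> =
     {u. (\<forall>x. x \<notin> M \<longrightarrow> u x = 0) \<and> continuous_on (closure M) u \<and>
         C2_on (sgn -` M) (u \<circ> sgn) \<and> (\<forall>x\<in>M. sphere_laplacian u x + \<mu> * u x = 0)}"

(* lam 1 <= lam 2 <= ... lists the Dirichlet eigenvalues, each repeated according to its
   multiplicity; lam 0 is irrelevant. Numbers that are not eigenvalues have eigenspace {0}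
   and do not occur. Finite dimensionality is required separately, because dim is only
   meaningful then. *)
definition dirichlet_spectrum :: "'a::euclidean_space set \<Rightarrow> (nat \<Rightarrow> real) \<Rightarrow> bool" where
  "dirichlet_spectrum M lam \<longleftrightarrow>
     (\<forall>j k. 1 \<le> j \<and> j \<le> k \<longrightarrow> lam j \<le> lam k) \<and>
     (\<forall>\<mu>. (\<exists>B. finite B \<and> dirichlet_eigenspace M \<mu> \<subseteq> fun_space.span B) \<and>
          finite {k. 1 \<le> k \<and> lam k = \<mu>} \<and>
          card {k. 1 \<le> k \<and> lam k = \<mu>} = fun_space.dim (dirichlet_eigenspace M \<mu>))"

(* The conditions determine lam on {1..}, so the choice affects only the value at 0. *)
definition dirichlet_eigenvalue :: "'a::euclidean_space set \<Rightarrow> nat \<Rightarrow> real" where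
  "dirichlet_eigenvalue M = (SOME lam. dirichlet_spectrum M lam)"

(* Surface measure on the unit sphere of an N-dimensional space, as defined by integration in
   polar coordinates: N times the Lebesgue measure of the part of the cone in the unit ball. *)
definition sphere_volume :: "'a::euclidean_space set \<Rightarrow> real" where
  "sphere_volume M =
     real DIM('a) * measure lebesgue {t *\<^sub>R x |t x. 0 \<le> t \<and> t \<le> 1 \<and> x \<in> M}"

(* V is the volume of an n-dimensional manifold. *)
definition weyl_constant :: "nat \<Rightarrow> real \<Rightarrow> real" where
  "weyl_constant n V = 4 * pi\<^sup>2 / (unit_ball_vol (real n) * V) powr (2 / real n)"

(* Euclidean (n+1)-space is (real^'n) * real with n = CARD('n); snd is the last coordinate. *)
definition hemisphere :: "((real^'n) \<times> real) set" where
  "hemisphere = {x. norm x = 1 \<and> snd x > 0}"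

definition chain_mult :: "nat \<Rightarrow> nat \<Rightarrow> nat" where
  "chain_mult n K = (n + K - 2) choose (n - 1)"

definition k_plus :: "nat \<Rightarrow> nat \<Rightarrow> nat" where
  "k_plus n K = (\<Sum>i=1..K. chain_mult n i)"

end

theory Submission
  imports Defs
begin

text \<open>The content is the Dirichlet spectrum of the hemisphere. Let \<open>u\<close> be an eigenfunction for \<open>\<mu>\<close>,
  \<open>U y = u (y / \<bar>y\<bar>)\<close> on the half-space \<open>t > 0\<close>, and \<open>N = n + 1\<close>. Testing \<open>\<Delta>U + \<mu> U / \<bar>y\<bar>\<^sup>2 = 0\<close> against
  \<open>q(y) \<bar>y\<bar>\<^sup>2 (1 - \<bar>y\<bar>\<^sup>2)\<^sup>3\<close>, where \<open>q\<close> is a homogeneous polynomial of degree \<open>d\<close>, odd in \<open>t\<close>, gives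
  \<open>(\<mu> - d (d + N - 2)) \<langle>U, q\<rangle> + \<langle>U, \<Delta>q\<rangle> = 0\<close>, where the two moments have different
  radial weights. Inductively all odd moments are determined by those against \<open>t x\<^sup>\<beta>\<close> with \<open>1 + \<bar>\<beta>\<bar> = K\<close>, where \<open>\<mu> = K (K + N - 2)\<close>, and by
  Stone-Weierstrass the odd moments determine \<open>u\<close>. So the multiplicity is at most the number of such
  \<open>\<beta>\<close>. Equality holds because each \<open>t x\<^sup>\<beta>\<close> is the part linear in \<open>t\<close> of an odd harmonic polynomial.

  The inequality is then the arithmetic-geometric mean inequality for the numbers
  \<open>(K + j) (K + n - 1 - j) = K (K + n - 1) + j (n - 1 - j)\<close>, whose geometric mean is
  \<open>(n! k\<^sub>+(K))\<^bsup>2/n\<^esup>\<close>.\<close>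

section \<open>Directional derivatives\<close>

text \<open>Eigenfunctions are only known to be C2 inside the hemisphere and continuous up to the
  equator. Test functions t * p avoid it: they vanish on the hyperplane to first order, and a cutoff
  there costs only a term controlled by the smallness of U. The second obstacle is the origin, where
  U, being constant along rays, is discontinuous; the factor |y|^2 absorbs this and the singular
  potential. The cube is the smallest integer power of 1 - |y|^2, cut off at 0, that is C2 across
  the unit sphere. The eigenvalues are defined by a choice among sequences with the right
  multiplicities, so every real \<mu> must be treated, eigenvalue or not; the moments do this
  uniformly, without spectral theory. The constant (n - 1) (n - 2) / 6 is the mean of j (n - 1 - j)
  over j < n. These shifts do not depend on K, so the gap between the two means tends to 0 as K
  grows; for n = 2 all shifts vanish, whence equality.\<close>

definition has_pd :: "'a::euclidean_space \<Rightarrow> 'a set \<Rightarrow> ('a \<Rightarrow> real) \<Rightarrow> ('a \<Rightarrow> real) \<Rightarrow> bool" where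
  "has_pd b S f f' \<longleftrightarrow> (\<forall>y\<in>S. ((\<lambda>t. f (y + t *\<^sub>R b)) has_real_derivative f' y) (at 0))"

lemma has_pd_const: "has_pd b S (\<lambda>y. c) (\<lambda>y. 0)"
  by (simp add: has_pd_def)

lemma has_pd_add:
  "has_pd b S f f' \<Longrightarrow> has_pd b S g g' \<Longrightarrow> has_pd b S (\<lambda>y. f y + g y) (\<lambda>y. f' y + g' y)"
  by (auto simp: has_pd_def intro!: derivative_intros)

lemma has_pd_diff:
  "has_pd b S f f' \<Longrightarrow> has_pd b S g g' \<Longrightarrow> has_pd b S (\<lambda>y. f y - g y) (\<lambda>y. f' y - g' y)"
  by (auto simp: has_pd_def intro!: derivative_intros)

lemma has_pd_mult:
  "has_pd b S f f' \<Longrightarrow> has_pd b S g g' \<Longrightarrow> has_pd b S (\<lambda>y. f y * g y) (\<lambda>y. f' y * g y + f y * g' y)"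
  unfolding has_pd_def
  by (auto intro!: derivative_eq_intros)

lemma has_pd_sum:
  assumes "\<And>i. i \<in> I \<Longrightarrow> has_pd b S (f i) (f' i)"
  shows "has_pd b S (\<lambda>y. \<Sum>i\<in>I. f i y) (\<lambda>y. \<Sum>i\<in>I. f' i y)"
  using assms by (auto simp: has_pd_def intro!: DERIV_sum)

lemma has_pd_inner: "has_pd b S (\<lambda>y. y \<bullet> c) (\<lambda>y. b \<bullet> c)"
  by (auto simp: has_pd_def inner_add_left intro!: derivative_eq_intros)

lemma has_pd_compose:
  assumes "has_pd b S g g'" "\<And>y. y \<in> S \<Longrightarrow> (f has_real_derivative f' (g y)) (at (g y))"
  shows "has_pd b S (\<lambda>y. f (g y)) (\<lambda>y. f' (g y) * g' y)"
  using assms by (auto simp: has_pd_def intro!: DERIV_chain2[where f=f])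

lemma has_pd_subset: "has_pd b T f f' \<Longrightarrow> S \<subseteq> T \<Longrightarrow> has_pd b S f f'"
  by (auto simp: has_pd_def)

lemma has_pd_Un: "has_pd b S f f' \<Longrightarrow> has_pd b T f f' \<Longrightarrow> has_pd b (S \<union> T) f f'"
  by (auto simp: has_pd_def)

lemma has_pd_unique: "has_pd b S f f' \<Longrightarrow> has_pd b S f f'' \<Longrightarrow> y \<in> S \<Longrightarrow> f' y = f'' y"
  by (auto simp: has_pd_def intro: DERIV_unique)

text \<open>Openness makes f and g agree for all small parameters on the line through y, not only at
  y. Taken with the zero function, the lemma also shows that derivatives vanish off a closed
  support.\<close>

lemma has_pd_cong:
  assumes "has_pd b S f f'" "open S" "\<And>y. y \<in> S \<Longrightarrow> f y = g y" "\<And>y. y \<in> S \<Longrightarrow> f' y = g' y"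
  shows "has_pd b S g g'"
  unfolding has_pd_def
proof
  fix y assume y: "y \<in> S"
  have "eventually (\<lambda>t. y + t *\<^sub>R b \<in> S) (nhds (0::real))"
    by (rule eventually_nhds_in_open[of "(\<lambda>t. y + t *\<^sub>R b) -` S", simplified])
      (use y assms(2) in \<open>auto intro!: continuous_intros open_vimage\<close>)
  then have "eventually (\<lambda>t. f (y + t *\<^sub>R b) = g (y + t *\<^sub>R b)) (nhds (0::real))"
    by eventually_elim (use assms in auto)
  moreover have "((\<lambda>t. f (y + t *\<^sub>R b)) has_real_derivative f' y) (at 0)"
    using assms(1) y by (auto simp: has_pd_def)
  ultimately show "((\<lambda>t. g (y + t *\<^sub>R b)) has_real_derivative g' y) (at 0)"
    using assms(4)[OF y] by (metis DERIV_cong_ev)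
qed

text \<open>\<open>has_pd\<close> differentiates at parameter 0 only; moving the base point along
  the line gives every parameter, as the mean value theorem requires.\<close>

lemma has_pd_line:
  assumes "has_pd b S f f'" "y + t *\<^sub>R b \<in> S"
  shows "((\<lambda>t. f (y + t *\<^sub>R b)) has_real_derivative f' (y + t *\<^sub>R b)) (at t)"
proof -
  have "((\<lambda>r. f ((y + t *\<^sub>R b) + r *\<^sub>R b)) has_real_derivative f' (y + t *\<^sub>R b)) (at 0)"
    using assms by (auto simp: has_pd_def)
  then have "((\<lambda>r. f (y + (r + t) *\<^sub>R b)) has_real_derivative f' (y + t *\<^sub>R b)) (at 0)"
    by (simp add: scaleR_left_distrib add_ac)
  then show ?thesis
    using DERIV_shift[of "\<lambda>r. f (y + r *\<^sub>R b)" "f' (y + t *\<^sub>R b)" 0 t] by simp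
qed

text \<open>The outer \<open>deriv\<close> differentiates the inner one, so the latter must be
  identified on a whole neighbourhood of 0, which the openness of S provides.\<close>

lemma deriv2_eq_pd:
  assumes "has_pd b S f f1" "has_pd b S f1 f2" "open S" "x \<in> S"
  shows "(deriv ^^ 2) (\<lambda>t. f (x + t *\<^sub>R b)) 0 = f2 x"
proof -
  have "eventually (\<lambda>t. x + t *\<^sub>R b \<in> S) (nhds (0::real))"
    by (rule eventually_nhds_in_open[of "(\<lambda>t. x + t *\<^sub>R b) -` S", simplified])
      (use assms in \<open>auto intro!: continuous_intros open_vimage\<close>)
  then have "eventually (\<lambda>t. deriv (\<lambda>t. f (x + t *\<^sub>R b)) t = f1 (x + t *\<^sub>R b)) (nhds (0::real))"
    by eventually_elim (use assms has_pd_line DERIV_imp_deriv in blast)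
  then have "deriv (deriv (\<lambda>t. f (x + t *\<^sub>R b))) 0 = deriv (\<lambda>t. f1 (x + t *\<^sub>R b)) 0"
    by (intro deriv_cong_ev) auto
  also have "\<dots> = f2 x"
    using assms by (auto simp: has_pd_def intro!: DERIV_imp_deriv)
  finally show ?thesis by (simp add: numeral_2_eq_2)
qed

lemma laplacian_eq_pd:
  assumes "\<And>b. b \<in> Basis \<Longrightarrow> has_pd b S f (f1 b)" "\<And>b. b \<in> Basis \<Longrightarrow> has_pd b S (f1 b) (f2 b)"
    "open S" "x \<in> S"
  shows "laplacian f x = (\<Sum>b\<in>Basis. f2 b x)"
  unfolding laplacian_def using deriv2_eq_pd[OF assms(1,2,3,4)] by (intro sum.cong) auto

section \<open>Lebesgue integrals under affine maps, and integrals of derivatives\<close>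

lemma integrable_lborel_affine:
  fixes F :: "'a::euclidean_space \<Rightarrow> real"
  assumes "integrable lborel F" "c \<noteq> 0"
  shows "integrable lborel (\<lambda>y. F (t + c *\<^sub>R y))"
    and "integral\<^sup>L lborel F = \<bar>c\<bar> ^ DIM('a) * (\<integral>y. F (t + c *\<^sub>R y) \<partial>lborel)"
proof -
  let ?D = "density (distr lborel borel (\<lambda>y. t + c *\<^sub>R y)) (\<lambda>_::'a. ennreal (\<bar>c\<bar> ^ DIM('a)))"
  have F: "F \<in> borel_measurable borel" using borel_measurable_integrable[OF assms(1)] by simp
  have eq: "lborel = ?D"
    using lborel_affine[OF assms(2), of t] by (simp add: ennreal_power)
  have "integrable ?D F" using assms(1) eq by simp
  then have "integrable lborel (\<lambda>y. \<bar>c\<bar> ^ DIM('a) *\<^sub>R F (t + c *\<^sub>R y))"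
    using F by (simp add: integrable_density integrable_distr_eq)
  then show "integrable lborel (\<lambda>y. F (t + c *\<^sub>R y))" using assms(2) by simp
  have "integral\<^sup>L lborel F = integral\<^sup>L ?D F" using eq by simp
  also have "\<dots> = \<bar>c\<bar> ^ DIM('a) * (\<integral>y. F (t + c *\<^sub>R y) \<partial>lborel)"
    using F by (simp add: integral_density integral_distr)
  finally show "integral\<^sup>L lborel F = \<bar>c\<bar> ^ DIM('a) * (\<integral>y. F (t + c *\<^sub>R y) \<partial>lborel)" .
qed

lemma integrable_compact_support:
  fixes F :: "'a::euclidean_space \<Rightarrow> real"
  assumes "F \<in> borel_measurable borel" "compact K" "\<And>y. y \<notin> K \<Longrightarrow> F y = 0" "\<And>y. \<bar>F y\<bar> \<le> C"
  shows "integrable lborel F"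
proof (rule Bochner_Integration.integrable_bound[where f="\<lambda>y. C * indicat_real K y"])
  show "integrable lborel (\<lambda>y. C * indicat_real K y)"
    using assms(2) by (auto intro!: integrable_real_indicator emeasure_compact_finite borel_compact)
  show "AE x in lborel. norm (F x) \<le> norm (C * indicat_real K x)"
    using assms(3,4) by (auto simp: indicator_def intro: order_trans[OF _ abs_ge_self])
qed (use assms in auto)

lemma continuous_compact_support_bounded:
  fixes F :: "'a::euclidean_space \<Rightarrow> real"
  assumes "continuous_on UNIV F" "compact K" "\<And>y. y \<notin> K \<Longrightarrow> F y = 0"
  obtains C where "C \<ge> 0" "\<And>y. \<bar>F y\<bar> \<le> C"
proof -
  have "compact (F ` K)" using assms compact_continuous_image continuous_on_subset by blast
  then obtain C where "\<And>y. y \<in> K \<Longrightarrow> \<bar>F y\<bar> \<le> C" using compact_imp_bounded by (force simp: bounded_iff)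
  then have "\<bar>F y\<bar> \<le> max 0 C" for y using assms(3) by (cases "y \<in> K") force+
  then show ?thesis using that[of "max 0 C"] by simp
qed

lemma integrable_continuous_compact_support:
  fixes F :: "'a::euclidean_space \<Rightarrow> real"
  assumes "continuous_on UNIV F" "compact K" "\<And>y. y \<notin> K \<Longrightarrow> F y = 0"
  shows "integrable lborel F"
proof -
  obtain C where "\<And>y. \<bar>F y\<bar> \<le> C" using continuous_compact_support_bounded[OF assms] by metis
  then show ?thesis using assms
    by (intro integrable_compact_support[of F K C]) (auto intro: borel_measurable_continuous_onI)
qed

text \<open>By translation invariance the difference quotients of \<open>F\<close> have integral zero.\<close>

lemma integral_pd_eq_0:
  fixes F :: "'a::euclidean_space \<Rightarrow> real"
  assumes pd: "has_pd b UNIV F F'" and cont: "continuous_on UNIV F" "continuous_on UNIV F'"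
    and K: "compact K" "\<And>y. y \<notin> K \<Longrightarrow> F y = 0" "\<And>y. y \<notin> K \<Longrightarrow> F' y = 0"
  shows "integral\<^sup>L lborel F' = 0"
proof -
  obtain R where R: "\<And>y. y \<in> K \<Longrightarrow> norm y \<le> R"
    using compact_imp_bounded[OF K(1)] by (auto simp: bounded_iff)
  obtain C where C: "\<And>y. \<bar>F' y\<bar> \<le> C"
    using continuous_compact_support_bounded[OF cont(2) K(1,3)] by metis
  define h where "h k = inverse (real (Suc k))" for k
  have h: "h k > 0" "h k \<le> 1" for k by (auto simp: h_def field_simps)
  define q where "q k y = (F (y + h k *\<^sub>R b) - F y) / h k" for k y
  have mF: "F \<in> borel_measurable borel" "F' \<in> borel_measurable borel"
    using cont by (auto intro: borel_measurable_continuous_onI)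
  have iF: "integrable lborel F" by (rule integrable_continuous_compact_support[OF cont(1) K(1,2)])
  have iF2: "integrable lborel (\<lambda>y. F (y + c))" "(\<integral>y. F (y + c) \<partial>lborel) = integral\<^sup>L lborel F" for c
    using integrable_lborel_affine[OF iF, of 1 c] by (simp_all add: add.commute)
  have zero: "integral\<^sup>L lborel (q k) = 0" for k
    unfolding q_def using iF iF2 by simp
  \<comment> \<open>Since \<open>h k\<close> \<le> 1, a difference quotient can be nonzero only
    within distance |b| of K; one ball serves for all k, as dominated convergence requires.\<close>
  let ?K = "cball (0::'a) (R + norm b)"
  have bound: "norm (q k y) \<le> C * indicat_real ?K y" for k y
  proof (cases "y \<in> ?K")
    case True
    have "\<exists>z>0. z < h k \<and> F (y + h k *\<^sub>R b) - F (y + 0 *\<^sub>R b) = (h k - 0) * F' (y + z *\<^sub>R b)"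
      by (rule MVT2[OF h(1)]) (auto intro: has_pd_line[OF pd])
    then obtain z where "F (y + h k *\<^sub>R b) - F y = h k * F' (y + z *\<^sub>R b)" by auto
    then have "q k y = F' (y + z *\<^sub>R b)" using h(1)[of k] by (simp add: q_def)
    then show ?thesis using C True by simp
  next
    case False
    have "norm y \<le> norm (y + h k *\<^sub>R b) + h k * norm b"
      using norm_triangle_ineq4[of "y + h k *\<^sub>R b" "h k *\<^sub>R b"] h(1)[of k] by (simp add: abs_of_pos)
    also have "h k * norm b \<le> norm b" using h(1,2)[of k] by (simp add: mult_left_le_one_le)
    finally have "y + h k *\<^sub>R b \<notin> K" "y \<notin> K" using False R[of "y + h k *\<^sub>R b"] R[of y] norm_ge_zero[of b] by (auto simp del: norm_ge_zero)
    then show ?thesis using False K(2) by (simp add: q_def)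
  qed
  have lim: "(\<lambda>k. q k y) \<longlonglongrightarrow> F' y" for y
  proof -
    have "((\<lambda>t. (F (y + (0 + t) *\<^sub>R b) - F (y + 0 *\<^sub>R b)) / t) \<longlongrightarrow> F' y) (at 0)"
      using pd unfolding has_pd_def DERIV_def by simp
    moreover have "h \<longlonglongrightarrow> 0" unfolding h_def by (rule LIMSEQ_inverse_real_of_nat)
    then have "filterlim h (at 0) sequentially"
      unfolding filterlim_at using h(1) by (auto intro!: always_eventually simp: less_imp_neq[THEN not_sym])
    ultimately show ?thesis unfolding q_def using filterlim_compose by fastforce
  qed
  have "(\<lambda>k. integral\<^sup>L lborel (q k)) \<longlonglongrightarrow> integral\<^sup>L lborel F'"
  proof (rule integral_dominated_convergence[where w="\<lambda>y. C * indicat_real ?K y"])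
    show "integrable lborel (\<lambda>y. C * indicat_real ?K y)"
      by (auto intro!: integrable_real_indicator emeasure_compact_finite)
    show "q k \<in> borel_measurable lborel" for k unfolding q_def using mF(1) by measurable
  qed (use mF lim bound in auto)
  then show ?thesis using zero by (simp add: LIMSEQ_const_iff)
qed

section \<open>Eigenfunctions on the half-space\<close>

lemma has_derivative_imp_pd:
  assumes "(f has_derivative D) (at y)"
  shows "((\<lambda>t. f (y + t *\<^sub>R b)) has_real_derivative D b) (at 0)"
proof -
  have lin: "bounded_linear D" using assms has_derivative_bounded_linear by blast
  have "((\<lambda>t. y + t *\<^sub>R b) has_derivative (\<lambda>t. t *\<^sub>R b)) (at 0)"
    by (auto intro!: derivative_eq_intros)
  then have "((\<lambda>t. f (y + t *\<^sub>R b)) has_derivative (\<lambda>t. D (t *\<^sub>R b))) (at 0)"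
    using has_derivative_compose[of "\<lambda>t. y + t *\<^sub>R b" "\<lambda>t. t *\<^sub>R b" 0 UNIV f D] assms by simp
  then show ?thesis
    by (rule has_derivative_imp_has_field_derivative)
      (simp add: linear_simps(5)[OF lin] mult.commute)
qed

text \<open>The derivatives along b are \<open>g x \<bullet> b\<close> and
  \<open>H x b \<bullet> b\<close>. \<open>laplacian\<close> sees only derivatives along single
  lines, and their continuity is what the integrations use.\<close>

lemma C2_on_imp_pd:
  assumes "C2_on S f"
  obtains f1 f2 where "continuous_on S f" "\<And>b. has_pd b S f (f1 b)" "\<And>b. has_pd b S (f1 b) (f2 b)"
    "\<And>b. continuous_on S (f1 b)" "\<And>b. continuous_on S (f2 b)"
proof -
  obtain g H where gH: "\<And>x. x \<in> S \<Longrightarrow> GDERIV f x :> g x" "\<And>x. x \<in> S \<Longrightarrow> (g has_derivative H x) (at x)"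
      and Hc: "\<And>h. continuous_on S (\<lambda>x. H x h)"
    using assms unfolding C2_on_def by blast
  show ?thesis
  proof (rule that[of "\<lambda>b x. g x \<bullet> b" "\<lambda>b x. H x b \<bullet> b"])
    show "continuous_on S f"
      using gH(1) unfolding gderiv_def
      by (blast intro: has_derivative_continuous_on[of S f "\<lambda>x h. h \<bullet> g x"] dest: has_derivative_at_withinI)
    have gc: "continuous_on S g"
      using gH(2) by (blast intro: has_derivative_continuous_on[of S g H] dest: has_derivative_at_withinI)
    then show "continuous_on S (\<lambda>x. g x \<bullet> b)" for b by (intro continuous_intros)
    show "continuous_on S (\<lambda>x. H x b \<bullet> b)" for b by (intro continuous_intros Hc)
    show "has_pd b S f (\<lambda>x. g x \<bullet> b)" for b
      using has_derivative_imp_pd[OF gH(1)[unfolded gderiv_def]]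
      by (auto simp: has_pd_def inner_commute)
    show "has_pd b S (\<lambda>x. g x \<bullet> b) (\<lambda>x. H x b \<bullet> b)" for b
      unfolding has_pd_def
    proof
      fix y assume "y \<in> S"
      then have "((\<lambda>x. g x \<bullet> b) has_derivative (\<lambda>h. H y h \<bullet> b)) (at y)"
        using gH(2) by (auto intro!: derivative_intros)
      from has_derivative_imp_pd[OF this]
      show "((\<lambda>t. g (y + t *\<^sub>R b) \<bullet> b) has_real_derivative H y b \<bullet> b) (at 0)" .
    qed
  qed
qed

text \<open>The vertical direction is an arbitrary basis vector; the product type of
  \<open>hemisphere\<close> enters only in the final theorem.\<close>

locale half_space =
  fixes e :: "'a::euclidean_space"
  assumes e: "e \<in> Basis"
begin

definition H :: "'a set" where "H = {y. y \<bullet> e > 0}"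
definition M :: "'a set" where "M = {y. norm y = 1 \<and> y \<bullet> e > 0}"

lemma open_H: "open H"
  unfolding H_def by (intro open_Collect_less continuous_intros)

lemma vimage_M: "sgn -` M = H"
proof -
  have "y \<noteq> 0" if "y \<bullet> e > 0" for y using that by auto
  then show ?thesis
    by (auto simp: M_def H_def sgn_div_norm zero_less_mult_iff zero_less_divide_iff left_inverse)
qed

lemma M_subset_H: "M \<subseteq> H" by (auto simp: M_def H_def)

lemma sgn_M: "y \<in> M \<Longrightarrow> sgn y = y" by (simp add: M_def sgn_div_norm)

lemma H_scale: "r > 0 \<Longrightarrow> r *\<^sub>R y \<in> H \<longleftrightarrow> y \<in> H"
  by (simp add: H_def zero_less_mult_iff)

lemma H_nz: "y \<in> H \<Longrightarrow> norm y > 0"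
  by (auto simp: H_def)

text \<open>Continuity of an eigenfunction up to the boundary is expressed on
  \<open>closure M\<close>, so the equator has to be located there: a boundary point is lifted
  slightly towards e and normalised.\<close>

lemma in_closure_M:
  assumes "norm y = 1" "y \<bullet> e \<ge> 0"
  shows "y \<in> closure M"
proof (cases "y \<bullet> e > 0")
  case True
  then show ?thesis using assms closure_subset[of M] by (auto simp: M_def)
next
  case False
  then have ye: "y \<bullet> e = 0" using assms by simp
  have nz: "y \<noteq> 0" using assms by auto
  have pos: "(y + inverse (real (Suc k)) *\<^sub>R e) \<bullet> e > 0" for k
    using e ye by (simp add: inner_add_left)
  then have "sgn (y + inverse (real (Suc k)) *\<^sub>R e) \<in> M" for k
    using vimage_M unfolding H_def by blast
  moreover have "(\<lambda>k. y + inverse (real (Suc k)) *\<^sub>R e) \<longlonglongrightarrow> y + 0 *\<^sub>R e"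
    by (intro tendsto_intros LIMSEQ_inverse_real_of_nat)
  then have "(\<lambda>k. sgn (y + inverse (real (Suc k)) *\<^sub>R e)) \<longlonglongrightarrow> sgn y"
    using nz by (intro tendsto_sgn) auto
  ultimately have "sgn y \<in> closure M"
    unfolding closure_sequential by (intro exI[of _ "\<lambda>k. sgn (y + inverse (real (Suc k)) *\<^sub>R e)"]) simp
  then show ?thesis using assms by (simp add: sgn_div_norm)
qed

end

locale half_space_eigen = half_space +
  fixes u :: "'a \<Rightarrow> real" and \<mu> :: real
  assumes eig: "u \<in> dirichlet_eigenspace M \<mu>"
begin

definition U :: "'a \<Rightarrow> real" where "U y = u (sgn y)"

lemma U_eq_0: "y \<notin> H \<Longrightarrow> U y = 0"
  using eig vimage_M by (auto simp: dirichlet_eigenspace_def U_def)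

lemma U_scale: "r > 0 \<Longrightarrow> U (r *\<^sub>R y) = U y"
  by (simp add: U_def sgn_scaleR)

lemma U_M: "y \<in> M \<Longrightarrow> U y = u y" by (simp add: U_def sgn_M)

lemma U_bounded: obtains C where "C \<ge> 0" "\<And>y. \<bar>U y\<bar> \<le> C"
proof -
  have "bounded M" by (auto simp: bounded_iff M_def)
  then have "compact (closure M)" by (simp add: compact_closure)
  moreover have "continuous_on (closure M) u" using eig by (simp add: dirichlet_eigenspace_def)
  ultimately have "bounded (u ` closure M)" using compact_continuous_image compact_imp_bounded by blast
  then obtain C where C: "\<And>y. y \<in> closure M \<Longrightarrow> \<bar>u y\<bar> \<le> C" by (auto simp: bounded_iff)
  have "\<bar>U y\<bar> \<le> max 0 C" for y
    using C[of "sgn y"] closure_subset[of M] vimage_M U_eq_0[of y] unfolding U_def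
    by (cases "y \<in> H") force+
  then show ?thesis using that[of "max 0 C"] by simp
qed

lemma U_pd:
  obtains U1 U2 where "continuous_on H U" "\<And>b. has_pd b H U (U1 b)" "\<And>b. has_pd b H (U1 b) (U2 b)"
    "\<And>b. continuous_on H (U1 b)" "\<And>b. continuous_on H (U2 b)"
    "\<And>y. y \<in> H \<Longrightarrow> (\<Sum>b\<in>Basis. U2 b y) = - \<mu> * U y / (norm y)\<^sup>2"
proof -
  have "C2_on H U" using eig by (simp add: dirichlet_eigenspace_def U_def[abs_def] vimage_M comp_def)
  then obtain U1 U2 where c: "continuous_on H U" and 1: "\<And>b. has_pd b H U (U1 b)"
      and 2: "\<And>b. has_pd b H (U1 b) (U2 b)"
      and c1: "\<And>b. continuous_on H (U1 b)" and c2: "\<And>b. continuous_on H (U2 b)"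
    by (rule C2_on_imp_pd) blast
  \<comment> \<open>U is homogeneous of degree 0, so its first derivatives are homogeneous of degree
    -1 and its second derivatives of degree -2.\<close>
  have s1: "r * U1 b (r *\<^sub>R y) = U1 b y" if "r > 0" "y \<in> H" for r b y
  proof -
    have "((\<lambda>t. U (r *\<^sub>R y + t *\<^sub>R b)) has_real_derivative U1 b (r *\<^sub>R y)) (at (r * 0))"
      using 1 that H_scale by (auto simp: has_pd_def)
    then have "((\<lambda>t. U (r *\<^sub>R y + (r * t) *\<^sub>R b)) has_real_derivative U1 b (r *\<^sub>R y) * r) (at 0)"
      by (rule DERIV_chain2) (auto intro!: derivative_eq_intros)
    moreover have "U (r *\<^sub>R y + (r * t) *\<^sub>R b) = U (y + t *\<^sub>R b)" for t
      using U_scale[OF that(1), of "y + t *\<^sub>R b"] by (simp add: scaleR_add_right)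
    ultimately have "((\<lambda>t. U (y + t *\<^sub>R b)) has_real_derivative U1 b (r *\<^sub>R y) * r) (at 0)" by simp
    then show ?thesis using 1 that by (auto simp: has_pd_def mult.commute intro: DERIV_unique)
  qed
  have s2: "r^2 * U2 b (r *\<^sub>R y) = U2 b y" if "r > 0" "y \<in> H" for r b y
  proof -
    have "has_pd b H (\<lambda>y. r * U1 b (r *\<^sub>R y)) (\<lambda>y. r * (U2 b (r *\<^sub>R y) * r))"
      unfolding has_pd_def
    proof
      fix y assume "y \<in> H"
      then have "((\<lambda>t. U1 b (r *\<^sub>R y + t *\<^sub>R b)) has_real_derivative U2 b (r *\<^sub>R y)) (at (r * 0))"
        using 2 that H_scale by (auto simp: has_pd_def)
      then have "((\<lambda>t. U1 b (r *\<^sub>R y + (r * t) *\<^sub>R b)) has_real_derivative U2 b (r *\<^sub>R y) * r) (at 0)"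
        by (rule DERIV_chain2) (auto intro!: derivative_eq_intros)
      then have "((\<lambda>t. r * U1 b (r *\<^sub>R y + (r * t) *\<^sub>R b)) has_real_derivative r * (U2 b (r *\<^sub>R y) * r)) (at 0)"
        by (rule DERIV_cmult)
      then show "((\<lambda>t. r * U1 b (r *\<^sub>R (y + t *\<^sub>R b))) has_real_derivative r * (U2 b (r *\<^sub>R y) * r)) (at 0)"
        by (simp add: scaleR_add_right)
    qed
    then have "has_pd b H (U1 b) (\<lambda>y. r * (U2 b (r *\<^sub>R y) * r))"
      by (rule has_pd_cong) (use s1 that open_H in auto)
    from has_pd_unique[OF this 2 that(2)] show ?thesis by (simp add: power2_eq_square mult_ac)
  qed
  \<comment> \<open>The eigenvalue equation is given on the unit sphere only; the homogeneity of the
    second derivatives carries it to all of H and produces the factor |y|^-2.\<close>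
  have "(\<Sum>b\<in>Basis. U2 b y) = - \<mu> * U y / (norm y)\<^sup>2" if y: "y \<in> H" for y
  proof -
    let ?r = "inverse (norm y)"
    have r: "?r > 0" using H_nz[OF y] by simp
    have yM: "sgn y \<in> M" using y vimage_M by blast
    have "sphere_laplacian u (sgn y) + \<mu> * u (sgn y) = 0"
      using eig yM by (auto simp: dirichlet_eigenspace_def)
    moreover have "sphere_laplacian u (sgn y) = laplacian U (sgn y)"
      by (simp add: sphere_laplacian_def U_def[abs_def] comp_def)
    moreover have "laplacian U (sgn y) = (\<Sum>b\<in>Basis. U2 b (sgn y))"
      using yM M_subset_H by (intro laplacian_eq_pd[OF 1 2 open_H]) auto
    moreover have "U2 b y = ?r^2 * U2 b (sgn y)" for b
      using s2[OF r y, of b] by (simp add: sgn_div_norm)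
    ultimately have "(\<Sum>b\<in>Basis. U2 b (sgn y)) = - \<mu> * u (sgn y)"
      and "\<And>b. U2 b y = ?r^2 * U2 b (sgn y)" by simp_all
    then show ?thesis
      by (simp add: sum_distrib_left[symmetric] U_def divide_inverse power_inverse)
  qed
  from that[OF c 1 2 c1 c2 this] show ?thesis .
qed

lemma U_continuous: "continuous_on H U"
  by (rule U_pd)

lemma U_borel [measurable]: "U \<in> borel_measurable borel"
proof -
  have "(\<lambda>y. indicator H y *\<^sub>R U y) \<in> borel_measurable borel"
    by (rule borel_measurable_continuous_on_indicator) (use open_H U_continuous in auto)
  also have "(\<lambda>y. indicator H y *\<^sub>R U y) = U" using U_eq_0 by (auto simp: indicator_def fun_eq_iff)
  finally show ?thesis .
qed

lemma integrable_U_mult: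
  assumes "continuous_on UNIV F" "compact K" "\<And>y. y \<notin> K \<Longrightarrow> F y = 0"
  shows "integrable lborel (\<lambda>y. U y * F y)"
proof -
  obtain C where C: "C \<ge> 0" "\<And>y. \<bar>U y\<bar> \<le> C" using U_bounded by metis
  have [measurable]: "F \<in> borel_measurable borel" using assms(1) by (rule borel_measurable_continuous_onI)
  show ?thesis
  proof (rule Bochner_Integration.integrable_bound[where f="\<lambda>y. C * F y"])
    show "integrable lborel (\<lambda>y. C * F y)"
      using integrable_continuous_compact_support[OF assms] by simp
    show "AE y in lborel. norm (U y * F y) \<le> norm (C * F y)"
      using C by (auto simp: abs_mult intro!: mult_right_mono)
  qed auto
qed

text \<open>The field \<open>\<phi> \<nabla>U - U \<nabla>\<phi>\<close> extends by zero to the whole space, so its divergence has integral zero.\<close>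

lemma weak_equation_compact:
  assumes 1: "\<And>b. b \<in> Basis \<Longrightarrow> has_pd b UNIV \<phi> (\<phi>1 b)"
    and 2: "\<And>b. b \<in> Basis \<Longrightarrow> has_pd b UNIV (\<phi>1 b) (\<phi>2 b)"
    and c: "continuous_on UNIV \<phi>" "\<And>b. b \<in> Basis \<Longrightarrow> continuous_on UNIV (\<phi>1 b)"
      "\<And>b. b \<in> Basis \<Longrightarrow> continuous_on UNIV (\<phi>2 b)"
    and K: "compact K" "K \<subseteq> H" "\<And>y. y \<notin> K \<Longrightarrow> \<phi> y = 0"
  shows "(\<integral>y. U y * ((\<Sum>b\<in>Basis. \<phi>2 b y) + \<mu> * \<phi> y / (norm y)\<^sup>2) \<partial>lborel) = 0"
proof -
  obtain U1 U2 where cU: "continuous_on H U" and U1: "\<And>b. has_pd b H U (U1 b)"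
    and U2: "\<And>b. has_pd b H (U1 b) (U2 b)"
    and cU1: "\<And>b. continuous_on H (U1 b)" and cU2: "\<And>b. continuous_on H (U2 b)"
    and eq: "\<And>y. y \<in> H \<Longrightarrow> (\<Sum>b\<in>Basis. U2 b y) = - \<mu> * U y / (norm y)\<^sup>2"
    by (rule U_pd) blast
  have oK: "open (- K)" using compact_imp_closed[OF K(1)] by (simp add: open_Compl)
  have z1: "\<phi>1 b y = 0" if "b \<in> Basis" "y \<notin> K" for b y
  proof -
    have "has_pd b (- K) \<phi> (\<lambda>y. 0)"
      by (rule has_pd_cong[OF has_pd_const[of _ _ 0]]) (use K oK in auto)
    then show ?thesis using has_pd_unique[OF has_pd_subset[OF 1[OF that(1)]], of "- K"] that by auto
  qed
  have z2: "\<phi>2 b y = 0" if "b \<in> Basis" "y \<notin> K" for b y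
  proof -
    have "has_pd b (- K) (\<phi>1 b) (\<lambda>y. 0)"
      by (rule has_pd_cong[OF has_pd_const[of _ _ 0]]) (use z1 that oK in auto)
    then show ?thesis using has_pd_unique[OF has_pd_subset[OF 2[OF that(1)]], of "- K"] that by auto
  qed
  have UN: "UNIV = H \<union> - K" using K(2) by auto
  \<comment> \<open>This is the derivative along b of the component
    \<open>\<phi> y * U1 b y - U y * \<phi>1 b y\<close>; the products of two first derivatives
    cancel.\<close>
  define F' where "F' b y = \<phi> y * U2 b y - U y * \<phi>2 b y" for b y
  have cont_ext: "continuous_on UNIV f" if "continuous_on H f" "\<And>y. y \<notin> K \<Longrightarrow> f y = 0" for f :: "'a \<Rightarrow> real"
  proof -
    have "continuous_on (- K) f"
      using that(2) by (subst continuous_on_cong[OF refl, of _ _ "\<lambda>_. 0"]) auto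
    then show ?thesis using that(1) continuous_on_open_Un[OF open_H oK] UN by simp
  qed
  have on: "continuous_on H f" if "continuous_on UNIV f" for f :: "'a \<Rightarrow> real"
    using that continuous_on_subset by blast
  have cF': "continuous_on UNIV (F' b)" if b: "b \<in> Basis" for b
  proof (rule cont_ext)
    show "continuous_on H (F' b)"
      unfolding F'_def[abs_def] by (intro continuous_intros on c cU cU2 b)
  qed (use K z2 b in \<open>auto simp: F'_def\<close>)
  have F'0: "F' b y = 0" if "b \<in> Basis" "y \<notin> K" for b y
    using K z2 that by (simp add: F'_def)
  have int0: "integral\<^sup>L lborel (F' b) = 0" if b: "b \<in> Basis" for b
  proof (rule integral_pd_eq_0)
    let ?F = "\<lambda>y. \<phi> y * U1 b y - U y * \<phi>1 b y"
    have "has_pd b H ?F (\<lambda>y. (\<phi>1 b y * U1 b y + \<phi> y * U2 b y) - (U1 b y * \<phi>1 b y + U y * \<phi>2 b y))"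
      by (intro has_pd_diff has_pd_mult U1 U2 has_pd_subset[OF 1[OF b]] has_pd_subset[OF 2[OF b]]) auto
    then have "has_pd b H ?F (F' b)"
      by (rule has_pd_cong) (auto simp: open_H F'_def)
    moreover have "has_pd b (- K) ?F (F' b)"
      by (rule has_pd_cong[OF has_pd_const[of _ _ 0]]) (use z1 z2 K b oK F'0 in auto)
    ultimately show "has_pd b UNIV ?F (F' b)" using has_pd_Un UN by metis
    show "continuous_on UNIV ?F"
    proof (rule cont_ext)
      show "continuous_on H ?F" by (intro continuous_intros on c cU cU1 b)
    qed (use K z1 b in auto)
  qed (use cF' F'0 b K z1 in auto)
  have "(\<integral>y. (\<Sum>b\<in>Basis. F' b y) \<partial>lborel) = (\<Sum>b\<in>Basis. integral\<^sup>L lborel (F' b))"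
    by (rule Bochner_Integration.integral_sum) (use integrable_continuous_compact_support[OF cF' K(1) F'0] in auto)
  also have "\<dots> = 0" using int0 by simp
  finally have "0 = - (\<integral>y. (\<Sum>b\<in>Basis. F' b y) \<partial>lborel)" by simp
  also have "\<dots> = (\<integral>y. - (\<Sum>b\<in>Basis. F' b y) \<partial>lborel)" by simp
  also have "(\<lambda>y. - (\<Sum>b\<in>Basis. F' b y)) = (\<lambda>y. U y * ((\<Sum>b\<in>Basis. \<phi>2 b y) + \<mu> * \<phi> y / (norm y)\<^sup>2))"
  proof
    fix y show "- (\<Sum>b\<in>Basis. F' b y) = U y * ((\<Sum>b\<in>Basis. \<phi>2 b y) + \<mu> * \<phi> y / (norm y)\<^sup>2)"
    proof (cases "y \<in> K")
      case True
      then have "y \<in> H" using K by auto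
      have "(\<Sum>b\<in>Basis. F' b y) = \<phi> y * (\<Sum>b\<in>Basis. U2 b y) - U y * (\<Sum>b\<in>Basis. \<phi>2 b y)"
        by (simp add: F'_def sum_subtractf sum_distrib_left)
      then show ?thesis using eq[OF \<open>y \<in> H\<close>] by (simp add: algebra_simps)
    next
      case False
      then show ?thesis using z2 K F'0 by simp
    qed
  qed
  finally show ?thesis by simp
qed

text \<open>|y|^2 U is continuous on the closed half-ball, even at 0, and vanishes on the flat side;
  uniform continuity turns this into a bound that depends on the height alone. The continuity is
  returned too, because the polynomial approximation needs it.\<close>

lemma U_small_near_boundary:
  assumes "\<eta> > 0"
  obtains \<delta> where "\<delta> > 0" "\<And>y. norm y \<le> 1 \<Longrightarrow> y \<bullet> e < \<delta> \<Longrightarrow> (norm y)\<^sup>2 * \<bar>U y\<bar> < \<eta>"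
    "continuous_on {y. norm y \<le> 1 \<and> y \<bullet> e \<ge> 0} (\<lambda>y. (norm y)\<^sup>2 * U y)"
proof -
  let ?T = "{y. norm y \<le> 1 \<and> y \<bullet> e \<ge> 0}"
  let ?V = "\<lambda>y. (norm y)\<^sup>2 * U y"
  obtain C where C: "C \<ge> 0" "\<And>y. \<bar>U y\<bar> \<le> C" using U_bounded by metis
  have uc: "continuous_on (closure M) u" using eig by (simp add: dirichlet_eigenspace_def)
  have cl: "sgn y \<in> closure M" if "y \<noteq> 0" "y \<bullet> e \<ge> 0" for y
    using that by (intro in_closure_M) (auto simp: norm_sgn sgn_div_norm)
  have cV: "continuous_on ?T ?V"
    unfolding continuous_on_def
  proof
    fix y assume y: "y \<in> ?T"
    show "(?V \<longlongrightarrow> ?V y) (at y within ?T)"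
    proof (cases "y = 0")
      case True
      have "((\<lambda>y. (norm y)\<^sup>2 * C) \<longlongrightarrow> (norm (0::'a))\<^sup>2 * C) (at 0 within ?T)"
        by (intro tendsto_intros)
      then have "((\<lambda>y. (norm y)\<^sup>2 * C) \<longlongrightarrow> 0) (at 0 within ?T)" by simp
      then have "(?V \<longlongrightarrow> 0) (at 0 within ?T)"
        by (rule Lim_null_comparison[rotated])
          (auto simp: abs_mult intro!: always_eventually mult_left_mono C)
      then show ?thesis using True by simp
    next
      case False
      have "(sgn \<longlongrightarrow> sgn y) (at y within ?T)"
        using False by (intro tendsto_sgn tendsto_ident_at) auto
      moreover have "\<forall>\<^sub>F x in at y within ?T. sgn x \<in> closure M"
      proof -
        have "\<forall>\<^sub>F x in at y within ?T. x \<in> - {0}"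
          using False by (intro topological_tendstoD[OF tendsto_ident_at]) auto
        moreover have "\<forall>\<^sub>F x in at y within ?T. x \<in> ?T"
          by (simp add: eventually_at_filter)
        ultimately show ?thesis by eventually_elim (use cl in auto)
      qed
      ultimately have "((\<lambda>x. u (sgn x)) \<longlongrightarrow> u (sgn y)) (at y within ?T)"
        using continuous_on_tendsto_compose[OF uc] cl[OF False] y by auto
      then show ?thesis unfolding U_def by (intro tendsto_intros)
    qed
  qed
  have "compact ?T"
  proof -
    have "?T = cball 0 1 \<inter> {y. y \<bullet> e \<ge> 0}" by auto
    moreover have "closed {y. y \<bullet> e \<ge> 0}" by (intro closed_Collect_le continuous_intros)
    ultimately show ?thesis by (simp add: compact_Int_closed)
  qed
  then have "uniformly_continuous_on ?T ?V" using cV compact_uniformly_continuous by blast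
  then obtain \<delta> where \<delta>: "\<delta> > 0"
      "\<And>x y. x \<in> ?T \<Longrightarrow> y \<in> ?T \<Longrightarrow> dist x y < \<delta> \<Longrightarrow> dist (?V x) (?V y) < \<eta>"
    using assms by (rule uniformly_continuous_onE) (blast dest: dist_commute[THEN eq_refl, THEN le_less_trans])
  have "(norm y)\<^sup>2 * \<bar>U y\<bar> < \<eta>" if y: "norm y \<le> 1" "y \<bullet> e < \<delta>" for y
  proof (cases "y \<in> H")
    case True
    \<comment> \<open>The orthogonal projection to the hyperplane stays in the ball, is closer to y
      than \<delta>, and is a zero of U.\<close>
    let ?z = "y - (y \<bullet> e) *\<^sub>R e"
    have ze: "?z \<bullet> e = 0" using e by (simp add: inner_diff_left)
    have "(norm y)\<^sup>2 = (norm ?z)\<^sup>2 + (y \<bullet> e)\<^sup>2"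
      using e ze unfolding power2_norm_eq_inner by (simp add: inner_diff_left inner_diff_right power2_eq_square inner_commute)
    then have "(norm ?z)\<^sup>2 \<le> 1\<^sup>2"
      using y(1) by (smt (verit) norm_ge_zero one_power2 power_le_one zero_le_power2)
    then have "norm ?z \<le> 1" by (rule power2_le_imp_le) simp
    then have "?z \<in> ?T" "y \<in> ?T" using ze True y by (auto simp: H_def)
    moreover have "dist y ?z < \<delta>" using y True e by (simp add: dist_norm H_def)
    ultimately have "dist (?V y) (?V ?z) < \<eta>" using \<delta> by blast
    moreover have "?z \<notin> H" using ze by (simp add: H_def)
    ultimately show ?thesis using U_eq_0 by (simp add: dist_real_def abs_mult)
  next
    case False
    then show ?thesis using U_eq_0 assms by simp
  qed
  then show ?thesis using that \<delta>(1) cV by blast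
qed

end

section \<open>The weak equation\<close>

text \<open>At 0 the factorisation (max 0 z)^(n+1) = (max 0 z)^n * z exhibits the derivative as the
  value of a continuous function; elsewhere the function is locally a power or zero.\<close>

lemma DERIV_max_0_power:
  fixes x :: real
  assumes "n \<ge> 1"
  shows "((\<lambda>x. (max 0 x) ^ Suc n) has_real_derivative real (Suc n) * (max 0 x) ^ n) (at x)"
proof (cases "x = 0")
  case True
  have "continuous (at 0) (\<lambda>x::real. max 0 x ^ n)"
    by (intro continuous_intros)
  moreover have "max 0 z ^ Suc n - max 0 0 ^ Suc n = max 0 z ^ n * (z - 0)" for z :: real
    using assms by (auto simp: max_def power_0_left)
  ultimately have "((\<lambda>x::real. max 0 x ^ Suc n) has_real_derivative 0) (at 0)"
    unfolding CARAT_DERIV using assms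
    by (intro exI[of _ "\<lambda>z. max 0 z ^ n"]) (simp add: power_0_left del: power_Suc)
  then show ?thesis using True assms by (simp add: power_0_left)
next
  case False
  show ?thesis
  proof (cases "x > 0")
    case True
    have "((\<lambda>x. x ^ Suc n) has_real_derivative real (Suc n) * x ^ n) (at x)"
      using DERIV_pow[of "Suc n" x] by simp
    moreover have "eventually (\<lambda>x. x \<in> {0<..}) (nhds x)"
      using True by (intro eventually_nhds_in_open) auto
    then have "eventually (\<lambda>x. x ^ Suc n = max 0 x ^ Suc n) (nhds x)"
      by eventually_elim (simp add: max_def)
    ultimately have "((\<lambda>x. max 0 x ^ Suc n) has_real_derivative real (Suc n) * x ^ n) (at x)"
      using DERIV_cong_ev[OF refl] by fastforce
    then show ?thesis using True by simp
  next
    case nonpos: False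
    have "((\<lambda>x::real. 0) has_real_derivative 0) (at x)" by simp
    moreover have "eventually (\<lambda>x. x \<in> {..<0}) (nhds x)"
      using False nonpos by (intro eventually_nhds_in_open) auto
    then have "eventually (\<lambda>x. 0 = max 0 x ^ Suc n) (nhds x)"
      by eventually_elim simp
    ultimately have "((\<lambda>x. max 0 x ^ Suc n) has_real_derivative 0) (at x)"
      using DERIV_cong_ev[OF refl] by fastforce
    then show ?thesis using False nonpos assms by (simp add: power_0_left)
  qed
qed

text \<open>A \<open>C\<^sup>2\<close> function that vanishes up to 1, is affine of slope 1 from 3 on, and whose second
  derivative is a tent function.\<close>

definition ramp :: "real \<Rightarrow> real" where
  "ramp x = (max 0 (x - 1) ^ 3 - 2 * max 0 (x - 2) ^ 3 + max 0 (x - 3) ^ 3) / 6"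
definition ramp1 :: "real \<Rightarrow> real" where
  "ramp1 x = (max 0 (x - 1) ^ 2 - 2 * max 0 (x - 2) ^ 2 + max 0 (x - 3) ^ 2) / 2"
definition ramp2 :: "real \<Rightarrow> real" where
  "ramp2 x = max 0 (x - 1) - 2 * max 0 (x - 2) + max 0 (x - 3)"

lemma DERIV_ramp: "(ramp has_real_derivative ramp1 x) (at x)"
proof -
  have d: "((\<lambda>x. max 0 (x - c) ^ 3) has_real_derivative 3 * max 0 (x - c) ^ 2) (at x)" for c x :: real
  proof -
    have "((\<lambda>x. max 0 (x - c) ^ Suc 2) has_real_derivative (real (Suc 2) * max 0 (x - c) ^ 2) * 1) (at x)"
      by (rule DERIV_chain2[where f="\<lambda>x. max 0 x ^ Suc 2" and g="\<lambda>x. x - c"], rule DERIV_max_0_power)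
        (auto intro!: derivative_eq_intros)
    then show ?thesis by (simp add: numeral_eq_Suc)
  qed
  show ?thesis unfolding ramp_def[abs_def] ramp1_def
    by (rule DERIV_cong, rule DERIV_cdivide[OF DERIV_add[OF DERIV_diff[OF d DERIV_cmult[OF d]] d]]) simp
qed

lemma DERIV_ramp1: "(ramp1 has_real_derivative ramp2 x) (at x)"
proof -
  have d: "((\<lambda>x. max 0 (x - c) ^ 2) has_real_derivative 2 * max 0 (x - c)) (at x)" for c x :: real
  proof -
    have "((\<lambda>x. max 0 (x - c) ^ Suc 1) has_real_derivative (real (Suc 1) * max 0 (x - c) ^ 1) * 1) (at x)"
      by (rule DERIV_chain2[where f="\<lambda>x. max 0 x ^ Suc 1" and g="\<lambda>x. x - c"], rule DERIV_max_0_power)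
        (auto intro!: derivative_eq_intros)
    then show ?thesis by (simp add: numeral_eq_Suc)
  qed
  show ?thesis unfolding ramp1_def[abs_def] ramp2_def
    by (rule DERIV_cong, rule DERIV_cdivide[OF DERIV_add[OF DERIV_diff[OF d DERIV_cmult[OF d]] d]]) simp
qed

lemma ramp_cases:
  "x \<le> 1 \<Longrightarrow> ramp x = 0" "x \<le> 1 \<Longrightarrow> ramp1 x = 0" "x \<le> 1 \<Longrightarrow> ramp2 x = 0"
  "x \<ge> 3 \<Longrightarrow> ramp x = x - 2" "x \<ge> 3 \<Longrightarrow> ramp1 x = 1" "x \<ge> 3 \<Longrightarrow> ramp2 x = 0"
  by (auto simp: ramp_def ramp1_def ramp2_def max_def power2_eq_square power3_eq_cube field_simps)

lemma ramp2_bounds: "0 \<le> ramp2 x" "ramp2 x \<le> 1"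
  by (auto simp: ramp2_def max_def)

text \<open>\<open>ramp2\<close> is nonnegative, so \<open>ramp1\<close> increases from its constant
  value 0 on the left to its constant value 1 on the right.\<close>

lemma ramp1_bounds: "0 \<le> ramp1 x" "ramp1 x \<le> 1"
proof -
  have mono: "ramp1 x \<le> ramp1 y" if "x \<le> y" for x y
    by (rule DERIV_nonneg_imp_nondecreasing[OF that]) (use DERIV_ramp1 ramp2_bounds in blast)
  show "0 \<le> ramp1 x" using mono[of "min x 1" x] ramp_cases(2)[of "min x 1"] by simp
  show "ramp1 x \<le> 1" using mono[of x "max x 3"] ramp_cases(5)[of "max x 3"] by simp
qed

lemma ramp_bounds: "0 \<le> ramp x" "x \<ge> 0 \<Longrightarrow> ramp x \<le> x"
proof -
  have mono: "ramp x \<le> ramp y" if "x \<le> y" for x y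
    by (rule DERIV_nonneg_imp_nondecreasing[OF that]) (use DERIV_ramp ramp1_bounds in blast)
  show "0 \<le> ramp x" using mono[of "min x 1" x] ramp_cases(1)[of "min x 1"] by simp
  have "0 - ramp 0 \<le> x - ramp x" if "x \<ge> 0"
  proof (rule DERIV_nonneg_imp_nondecreasing[OF that])
    fix y
    have "((\<lambda>y. y - ramp y) has_real_derivative (1 - ramp1 y)) (at y)"
      by (intro derivative_intros DERIV_ramp)
    then show "\<exists>d. ((\<lambda>y. y - ramp y) has_real_derivative d) (at y) \<and> 0 \<le> d"
      using ramp1_bounds by fastforce
  qed
  then show "x \<ge> 0 \<Longrightarrow> ramp x \<le> x" using ramp_cases(1)[of 0] by simp
qed

lemma continuous_on_ramps:
  "continuous_on S ramp" "continuous_on S ramp1" "continuous_on S ramp2"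
  unfolding ramp_def[abs_def] ramp1_def[abs_def] ramp2_def[abs_def] by (intro continuous_intros; simp)+

context half_space
begin

text \<open>The strip lies in a box with side 2 \<epsilon> along e and side 2 along every other
  basis vector.\<close>

lemma measure_strip_le:
  assumes "\<epsilon> > 0"
  shows "measure lborel (cball 0 1 \<inter> {y. \<epsilon> \<le> y \<bullet> e \<and> y \<bullet> e \<le> 3 * \<epsilon>}) \<le> 2 ^ DIM('a) * \<epsilon>"
proof -
  let ?l = "\<Sum>b\<in>Basis. (if b = e then \<epsilon> else -1) *\<^sub>R b" and ?r = "\<Sum>b\<in>Basis. (if b = e then 3 * \<epsilon> else 1) *\<^sub>R b"
  have sub: "cball 0 1 \<inter> {y. \<epsilon> \<le> y \<bullet> e \<and> y \<bullet> e \<le> 3 * \<epsilon>} \<subseteq> cbox ?l ?r"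
  proof
    fix y assume y: "y \<in> cball 0 1 \<inter> {y. \<epsilon> \<le> y \<bullet> e \<and> y \<bullet> e \<le> 3 * \<epsilon>}"
    have "\<bar>y \<bullet> b\<bar> \<le> 1" if "b \<in> Basis" for b
      using y Basis_le_norm[OF that, of y] by simp
    then show "y \<in> cbox ?l ?r" using y by (force simp: mem_box abs_le_iff)
  qed
  have "measure lborel (cball 0 1 \<inter> {y. \<epsilon> \<le> y \<bullet> e \<and> y \<bullet> e \<le> 3 * \<epsilon>}) \<le> measure lborel (cbox ?l ?r)"
    by (rule measure_mono_fmeasurable[OF sub])
      (auto intro!: fmeasurable_cbox borel_closed closed_Int closed_Collect_conj closed_Collect_le continuous_intros)
  also have "\<dots> = (\<Prod>b\<in>Basis. (?r - ?l) \<bullet> b)"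
    using assms by (subst measure_lborel_cbox_eq) (auto simp: inner_diff_left)
  also have "\<dots> = (\<Prod>b\<in>Basis. if b = e then 2 * \<epsilon> else 2)"
    by (intro prod.cong) (auto simp: inner_diff_left)
  also have "\<dots> = 2 * \<epsilon> * 2 ^ (DIM('a) - 1)"
    using e by (subst prod.remove[of _ e]) auto
  also have "\<dots> = 2 ^ DIM('a) * \<epsilon>"
    using DIM_positive[where 'a='a] by (cases "DIM('a)") auto
  finally show ?thesis .
qed

end

context half_space_eigen
begin

text \<open>The weak equation is applied to \<open>\<epsilon> ramp(t/\<epsilon>) p\<close>, where \<open>t = y \<bullet> e\<close>. The second derivative of
  the ramp has size \<open>1/\<epsilon>\<close> on a strip of width \<open>2\<epsilon>\<close>, where \<open>U\<close> is small.\<close>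

lemma weak_equation:
  assumes 1: "\<And>b. b \<in> Basis \<Longrightarrow> has_pd b UNIV p (p1 b)"
    and 2: "\<And>b. b \<in> Basis \<Longrightarrow> has_pd b UNIV (p1 b) (p2 b)"
    and c: "continuous_on UNIV p" "\<And>b. b \<in> Basis \<Longrightarrow> continuous_on UNIV (p1 b)"
      "\<And>b. b \<in> Basis \<Longrightarrow> continuous_on UNIV (p2 b)"
    and supp: "\<And>y. norm y \<ge> 1 \<Longrightarrow> p y = 0"
    and small: "\<And>y. \<bar>p y\<bar> \<le> B * (norm y)\<^sup>2"
  shows "(\<integral>y. U y * ((y \<bullet> e) * (\<Sum>b\<in>Basis. p2 b y) + 2 * p1 e y + \<mu> * ((y \<bullet> e) * p y) / (norm y)\<^sup>2) \<partial>lborel) = 0"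
    (is "integral\<^sup>L lborel ?L = 0")
proof -
  let ?K = "cball (0::'a) 1"
  have oK: "open (- ?K)" by auto
  have z1: "p1 b y = 0" if "b \<in> Basis" "norm y > 1" for b y
  proof -
    have "has_pd b (- ?K) p (\<lambda>y. 0)"
      by (rule has_pd_cong[OF has_pd_const[of _ _ 0]]) (use supp oK in auto)
    then show ?thesis using has_pd_unique[OF has_pd_subset[OF 1[OF that(1)]], of "- ?K"] that by auto
  qed
  have z2: "p2 b y = 0" if "b \<in> Basis" "norm y > 1" for b y
  proof -
    have "has_pd b (- ?K) (p1 b) (\<lambda>y. 0)"
      by (rule has_pd_cong[OF has_pd_const[of _ _ 0]]) (use z1 that oK in auto)
    then show ?thesis using has_pd_unique[OF has_pd_subset[OF 2[OF that(1)]], of "- ?K"] that by auto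
  qed
  define L where "L y = (\<Sum>b\<in>Basis. p2 b y)" for y
  have cL: "continuous_on UNIV L" unfolding L_def[abs_def] by (intro continuous_intros c)
  have zL: "L y = 0" if "norm y > 1" for y using z2 that by (simp add: L_def)
  obtain CU where CU: "CU \<ge> 0" "\<And>y. \<bar>U y\<bar> \<le> CU" using U_bounded by metis
  obtain CL where CL: "CL \<ge> 0" "\<And>y. \<bar>L y\<bar> \<le> CL"
    using continuous_compact_support_bounded[OF cL, of ?K] zL by (auto simp: not_le)
  obtain C1 where C1: "C1 \<ge> 0" "\<And>y. \<bar>p1 e y\<bar> \<le> C1"
    using continuous_compact_support_bounded[OF c(2)[OF e], of ?K] z1[OF e] by (auto simp: not_le)
  have B: "B \<ge> 0" using order_trans[OF abs_ge_zero small[of e]] e by simp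
  have [measurable]: "p \<in> borel_measurable borel" "p1 e \<in> borel_measurable borel" "L \<in> borel_measurable borel"
    using c e cL by (auto intro: borel_measurable_continuous_onI)
  have [measurable]: "ramp \<in> borel_measurable borel" "ramp1 \<in> borel_measurable borel" "ramp2 \<in> borel_measurable borel"
    using continuous_on_ramps by (auto intro: borel_measurable_continuous_onI)
  define \<epsilon> where "\<epsilon> k = inverse (real (Suc k))" for k
  have \<epsilon>: "\<epsilon> k > 0" for k by (simp add: \<epsilon>_def)
  have \<epsilon>0: "\<epsilon> \<longlonglongrightarrow> 0" unfolding \<epsilon>_def by (rule LIMSEQ_inverse_real_of_nat)
  \<comment> \<open>A C2 substitute for t = \<open>y \<bullet> e\<close>: it is 0 for t \<le>
    \<epsilon> and t - 2 \<epsilon> for t \<ge> 3 \<epsilon>. The next two functions are its first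
    and second derivatives in t.\<close>
  define f where "f k y = \<epsilon> k * ramp (y \<bullet> e / \<epsilon> k)" for k y
  define f1 where "f1 k y = ramp1 (y \<bullet> e / \<epsilon> k)" for k y
  define f2 where "f2 k y = ramp2 (y \<bullet> e / \<epsilon> k) / \<epsilon> k" for k y
  \<comment> \<open>The integrand of the weak equation for f p splits into A, dominated uniformly in
    k, and D, which contains the second derivative of size 1/\<epsilon> and has to be shown
    negligible separately.\<close>
  define A where "A k y = U y * (f k y * L y + 2 * f1 k y * p1 e y + \<mu> * (f k y * p y) / (norm y)\<^sup>2)" for k y
  define D where "D k y = U y * (f2 k y * p y)" for k y
  have f_le: "\<bar>f k y\<bar> \<le> y \<bullet> e" if "y \<in> H" for k y
  proof -
    have "ramp (y \<bullet> e / \<epsilon> k) \<le> y \<bullet> e / \<epsilon> k" using that \<epsilon>[of k] by (intro ramp_bounds) (auto simp: H_def)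
    then have "f k y \<le> y \<bullet> e" using \<epsilon>[of k] by (simp add: f_def field_simps)
    moreover have "f k y \<ge> 0" using \<epsilon>[of k] ramp_bounds(1) by (simp add: f_def)
    ultimately show ?thesis by simp
  qed
  have mf [measurable]: "f k \<in> borel_measurable borel" "f1 k \<in> borel_measurable borel" "f2 k \<in> borel_measurable borel" for k
    unfolding f_def[abs_def] f1_def[abs_def] f2_def[abs_def] by measurable
  have zp: "p y = 0" "L y = 0" "p1 e y = 0" if "norm y > 1" for y
    using that supp zL z1[OF e] by auto
  have ye: "y \<bullet> e \<le> 1" if "norm y \<le> 1" for y
    using Basis_le_norm[OF e, of y] that by simp
  let ?CA = "CU * (CL + 2 * C1 + \<bar>\<mu>\<bar> * B)"
  have A_bound: "norm (A k y) \<le> ?CA * indicat_real ?K y" for k y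
  proof (cases "norm y \<le> 1 \<and> y \<in> H")
    case True
    then have f1': "\<bar>f k y\<bar> \<le> 1" using f_le[of y k] ye[of y] by auto
    have "\<bar>f k y * L y\<bar> \<le> 1 * CL" unfolding abs_mult using f1' CL by (intro mult_mono) auto
    moreover have "\<bar>2 * f1 k y * p1 e y\<bar> \<le> 2 * 1 * C1" unfolding abs_mult
      using ramp1_bounds[of "y \<bullet> e / \<epsilon> k"] C1 by (intro mult_mono) (auto simp: f1_def)
    moreover have "\<bar>\<mu> * (f k y * p y) / (norm y)\<^sup>2\<bar> \<le> \<bar>\<mu>\<bar> * B"
    proof -
      \<comment> \<open>The quadratic bound on p compensates the division by |y|^2 near the
        origin.\<close>
      have "\<bar>f k y * p y\<bar> \<le> 1 * (B * (norm y)\<^sup>2)" unfolding abs_mult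
        using f1' small by (intro mult_mono) auto
      then have "\<bar>f k y * p y\<bar> / (norm y)\<^sup>2 \<le> B"
        using True H_nz by (simp add: divide_simps)
      then have "\<bar>\<mu>\<bar> * (\<bar>f k y * p y\<bar> / (norm y)\<^sup>2) \<le> \<bar>\<mu>\<bar> * B" by (intro mult_left_mono) auto
      then show ?thesis by (simp add: abs_mult)
    qed
    ultimately have "\<bar>f k y * L y + 2 * f1 k y * p1 e y + \<mu> * (f k y * p y) / (norm y)\<^sup>2\<bar> \<le> CL + 2 * C1 + \<bar>\<mu>\<bar> * B"
      by linarith
    then have "\<bar>A k y\<bar> \<le> ?CA" unfolding A_def abs_mult using CU by (intro mult_mono) auto
    then show ?thesis using True by simp
  next
    case False
    then have "A k y = 0" using zp[of y] U_eq_0[of y] by (auto simp: A_def not_le)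
    then show ?thesis using CU CL C1 B by simp
  qed
  have lim_pt: "(\<lambda>k. A k y) \<longlonglongrightarrow> ?L y" for y
  proof (cases "y \<in> H")
    case True
    have "eventually (\<lambda>k. \<epsilon> k < (y \<bullet> e) / 3) sequentially"
      using \<epsilon>0 True by (intro order_tendstoD) (auto simp: H_def)
    then have ev: "eventually (\<lambda>k. y \<bullet> e / \<epsilon> k \<ge> 3) sequentially"
    proof eventually_elim
      case (elim k) then show ?case using \<epsilon>[of k] by (simp add: field_simps)
    qed
    then have "eventually (\<lambda>k. y \<bullet> e - 2 * \<epsilon> k = f k y) sequentially"
    proof eventually_elim
      case (elim k) then show ?case using \<epsilon>[of k] ramp_cases(4)[OF elim] by (simp add: f_def field_simps)
    qed
    moreover have "(\<lambda>k. y \<bullet> e - 2 * \<epsilon> k) \<longlonglongrightarrow> y \<bullet> e - 2 * 0" by (intro tendsto_intros \<epsilon>0)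
    ultimately have lf: "(\<lambda>k. f k y) \<longlonglongrightarrow> y \<bullet> e" using Lim_transform_eventually by fastforce
    have "eventually (\<lambda>k. 1 = f1 k y) sequentially"
      using ev by eventually_elim (simp add: f1_def ramp_cases(5))
    then have lf1: "(\<lambda>k. f1 k y) \<longlonglongrightarrow> 1" by (rule Lim_transform_eventually[OF tendsto_const])
    have "(\<lambda>k. A k y) \<longlonglongrightarrow> U y * ((y \<bullet> e) * L y + 2 * 1 * p1 e y + \<mu> * ((y \<bullet> e) * p y) / (norm y)\<^sup>2)"
      unfolding A_def using H_nz[OF True] by (intro tendsto_intros lf lf1) auto
    then show ?thesis by (simp add: L_def)
  next
    case False
    then show ?thesis using U_eq_0 by (simp add: A_def)
  qed
  have limA: "(\<lambda>k. integral\<^sup>L lborel (A k)) \<longlonglongrightarrow> integral\<^sup>L lborel ?L"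
  proof (rule integral_dominated_convergence[where w="\<lambda>y. ?CA * indicat_real ?K y"])
    show "integrable lborel (\<lambda>y. ?CA * indicat_real ?K y)"
      by (auto intro!: integrable_real_indicator emeasure_compact_finite)
    show "A k \<in> borel_measurable lborel" for k unfolding A_def by measurable
    have "?L = (\<lambda>y. U y * ((y \<bullet> e) * L y + 2 * p1 e y + \<mu> * ((y \<bullet> e) * p y) / (norm y)\<^sup>2))"
      by (simp add: L_def)
    also have "\<dots> \<in> borel_measurable lborel" by measurable
    finally show "?L \<in> borel_measurable lborel" .
  qed (use lim_pt A_bound in auto)
  have intA: "integrable lborel (A k)" for k
  proof (rule Bochner_Integration.integrable_bound[where f="\<lambda>y. ?CA * indicat_real ?K y"])
    show "integrable lborel (\<lambda>y. ?CA * indicat_real ?K y)"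
      by (auto intro!: integrable_real_indicator emeasure_compact_finite)
    show "A k \<in> borel_measurable lborel" unfolding A_def by measurable
    show "AE y in lborel. norm (A k y) \<le> norm (?CA * indicat_real ?K y)"
      by (rule AE_I2, rule order_trans[OF A_bound]) (simp only: real_norm_def abs_ge_self)
  qed
  have pdc: "has_pd b UNIV (f k) (\<lambda>y. (b \<bullet> e) * f1 k y)" "has_pd b UNIV (f1 k) (\<lambda>y. (b \<bullet> e) * f2 k y)" for b k
  proof -
    have d: "has_pd b UNIV (\<lambda>y. y \<bullet> e / \<epsilon> k) (\<lambda>y. b \<bullet> e / \<epsilon> k)"
      using has_pd_mult[OF has_pd_inner[of b UNIV e] has_pd_const[of b UNIV "inverse (\<epsilon> k)"]]
      by (simp add: divide_inverse)
    have "has_pd b UNIV (\<lambda>y. \<epsilon> k * ramp (y \<bullet> e / \<epsilon> k)) (\<lambda>y. 0 * ramp (y \<bullet> e / \<epsilon> k) + \<epsilon> k * (ramp1 (y \<bullet> e / \<epsilon> k) * (b \<bullet> e / \<epsilon> k)))"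
      by (intro has_pd_mult has_pd_const has_pd_compose[OF d] DERIV_ramp)
    then show "has_pd b UNIV (f k) (\<lambda>y. (b \<bullet> e) * f1 k y)"
      by (rule has_pd_cong) (use \<epsilon>[of k] in \<open>auto simp: f_def f1_def\<close>)
    have "has_pd b UNIV (\<lambda>y. ramp1 (y \<bullet> e / \<epsilon> k)) (\<lambda>y. ramp2 (y \<bullet> e / \<epsilon> k) * (b \<bullet> e / \<epsilon> k))"
      by (intro has_pd_compose[OF d] DERIV_ramp1)
    then show "has_pd b UNIV (f1 k) (\<lambda>y. (b \<bullet> e) * f2 k y)"
      by (rule has_pd_cong) (use \<epsilon>[of k] in \<open>auto simp: f1_def f2_def\<close>)
  qed
  have cf: "continuous_on UNIV (f k)" "continuous_on UNIV (f1 k)" "continuous_on UNIV (f2 k)" for k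
    unfolding f_def[abs_def] f1_def[abs_def] f2_def[abs_def] using \<epsilon>[of k]
    by (auto intro!: continuous_intros continuous_on_compose2[OF continuous_on_ramps(1)[of UNIV]]
      continuous_on_compose2[OF continuous_on_ramps(2)[of UNIV]] continuous_on_compose2[OF continuous_on_ramps(3)[of UNIV]])
  have intD: "integrable lborel (D k)" for k
    unfolding D_def[abs_def] by (rule integrable_U_mult[of _ ?K]) (use zp(1) in \<open>auto intro!: continuous_intros cf c simp: not_le\<close>)
  have eq: "integral\<^sup>L lborel (A k) = - integral\<^sup>L lborel (D k)" for k
  proof -
    let ?\<phi> = "\<lambda>y. f k y * p y"
    let ?\<phi>1 = "\<lambda>b y. ((b \<bullet> e) * f1 k y) * p y + f k y * p1 b y"
    let ?\<phi>2 = "\<lambda>b y. (((0 * f1 k y + (b \<bullet> e) * ((b \<bullet> e) * f2 k y)) * p y + ((b \<bullet> e) * f1 k y) * p1 b y) + (((b \<bullet> e) * f1 k y) * p1 b y + f k y * p2 b y))"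
    let ?KK = "?K \<inter> {y. \<epsilon> k \<le> y \<bullet> e}"
    have "(\<integral>y. U y * ((\<Sum>b\<in>Basis. ?\<phi>2 b y) + \<mu> * ?\<phi> y / (norm y)\<^sup>2) \<partial>lborel) = 0"
    proof (rule weak_equation_compact)
      show "has_pd b UNIV ?\<phi> (?\<phi>1 b)" if "b \<in> Basis" for b by (intro has_pd_mult pdc 1 that)
      show "has_pd b UNIV (?\<phi>1 b) (?\<phi>2 b)" if "b \<in> Basis" for b
        by (intro has_pd_add has_pd_mult pdc 1 2 that has_pd_const)
      show "continuous_on UNIV ?\<phi>" by (intro continuous_intros c cf)
      show "continuous_on UNIV (?\<phi>1 b)" if "b \<in> Basis" for b using that by (intro continuous_intros c cf)
      show "continuous_on UNIV (?\<phi>2 b)" if "b \<in> Basis" for b using that by (intro continuous_intros c cf)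
      have "closed {y. \<epsilon> k \<le> y \<bullet> e}" by (intro closed_Collect_le continuous_intros)
      then show "compact ?KK" by (simp add: compact_Int_closed)
      show "?KK \<subseteq> H" using \<epsilon>[of k] by (auto simp: H_def)
      show "?\<phi> y = 0" if "y \<notin> ?KK" for y
        using that zp(1)[of y] ramp_cases(1)[of "y \<bullet> e / \<epsilon> k"] \<epsilon>[of k]
        by (force simp: f_def not_le field_simps)
    qed
    moreover have "U y * ((\<Sum>b\<in>Basis. ?\<phi>2 b y) + \<mu> * ?\<phi> y / (norm y)\<^sup>2) = A k y + D k y" for y
    proof -
      have "(\<Sum>b\<in>Basis. ?\<phi>2 b y) = (\<Sum>b\<in>Basis. f k y * p2 b y) +
          (\<Sum>b\<in>Basis. if b = e then f2 k y * p y + 2 * f1 k y * p1 e y else 0)"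
        unfolding sum.distrib[symmetric] using e by (intro sum.cong) (auto simp: inner_Basis algebra_simps)
      also have "\<dots> = f k y * L y + f2 k y * p y + 2 * f1 k y * p1 e y"
        using e by (simp add: L_def sum_distrib_left)
      finally show ?thesis by (simp add: A_def D_def algebra_simps)
    qed
    ultimately have 0: "(\<integral>y. A k y + D k y \<partial>lborel) = 0" by simp
    show ?thesis using 0 intA[of k] intD[of k] by simp
  qed
  have "(\<lambda>k. integral\<^sup>L lborel (D k)) \<longlonglongrightarrow> 0"
  proof (rule tendstoI)
    fix r :: real assume r: "r > 0"
    \<comment> \<open>D is at most B \<eta> / \<epsilon> on a strip of measure at most 2^N
      \<epsilon>, so its integral is at most \<eta> c = r / 2. Adding 1 to B keeps c positive when B
      = 0.\<close>
    define c where "c = (B + 1) * 2 ^ DIM('a)"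
    have cpos: "c > 0" using B by (simp add: c_def)
    define \<eta> where "\<eta> = r / (2 * c)"
    have \<eta>: "\<eta> > 0" using r cpos unfolding \<eta>_def by simp
    obtain \<delta> where \<delta>: "\<delta> > 0" "\<And>y. norm y \<le> 1 \<Longrightarrow> y \<bullet> e < \<delta> \<Longrightarrow> (norm y)\<^sup>2 * \<bar>U y\<bar> < \<eta>"
      using U_small_near_boundary[OF \<eta>] by metis
    have "eventually (\<lambda>k. \<epsilon> k < \<delta> / 3) sequentially"
      using \<epsilon>0 \<delta>(1) by (intro order_tendstoD) auto
    then show "eventually (\<lambda>k. dist (integral\<^sup>L lborel (D k)) 0 < r) sequentially"
    proof eventually_elim
      case (elim k)
      let ?S = "?K \<inter> {y. \<epsilon> k \<le> y \<bullet> e \<and> y \<bullet> e \<le> 3 * \<epsilon> k}"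
      have cS: "closed {y. \<epsilon> k \<le> y \<bullet> e \<and> y \<bullet> e \<le> 3 * \<epsilon> k}"
        by (intro closed_Collect_conj closed_Collect_le continuous_intros)
      then have S: "compact ?S" by (simp add: compact_Int_closed)
      have bd: "norm (D k y) \<le> (B * \<eta> / \<epsilon> k) * indicat_real ?S y" for y
      proof (cases "y \<in> ?S")
        case True
        then have "y \<bullet> e < \<delta>" using elim by auto
        then have Us: "(norm y)\<^sup>2 * \<bar>U y\<bar> \<le> \<eta>" using \<delta>(2)[of y] True by auto
        have "\<bar>f2 k y\<bar> \<le> 1 / \<epsilon> k"
          using ramp2_bounds[of "y \<bullet> e / \<epsilon> k"] \<epsilon>[of k] by (simp add: f2_def divide_right_mono)
        \<comment> \<open>The factor |y|^2 from the bound on p is passed on to U: near the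
          hyperplane |y|^2 |U| is small, whereas U itself need not be small close to the
          origin.\<close>
        then have "\<bar>U y\<bar> * (\<bar>f2 k y\<bar> * \<bar>p y\<bar>) \<le> \<bar>U y\<bar> * (1 / \<epsilon> k * (B * (norm y)\<^sup>2))"
          using small[of y] \<epsilon>[of k] by (intro mult_mono mult_nonneg_nonneg) auto
        also have "\<dots> = (B / \<epsilon> k) * ((norm y)\<^sup>2 * \<bar>U y\<bar>)" by simp
        also have "\<dots> \<le> (B / \<epsilon> k) * \<eta>" using Us B \<epsilon>[of k] by (intro mult_left_mono) auto
        finally show ?thesis using True by (simp add: D_def abs_mult)
      next
        case False
        then have "norm y > 1 \<or> y \<bullet> e / \<epsilon> k \<le> 1 \<or> y \<bullet> e / \<epsilon> k \<ge> 3"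
          using \<epsilon>[of k] by (auto simp: field_simps not_le)
        then have "D k y = 0"
          using zp(1)[of y] ramp_cases(3,6)[of "y \<bullet> e / \<epsilon> k"] by (auto simp: D_def f2_def)
        then show ?thesis using False by simp
      qed
      have iS: "integrable lborel (\<lambda>y. (B * \<eta> / \<epsilon> k) * indicat_real ?S y)"
        by (intro integrable_mult_right integrable_real_indicator) (use emeasure_compact_finite[OF S] borel_compact[OF S] in auto)
      have "norm (integral\<^sup>L lborel (D k)) \<le> (\<integral>y. (B * \<eta> / \<epsilon> k) * indicat_real ?S y \<partial>lborel)"
        using bd by (intro Bochner_Integration.integral_norm_bound_integral[OF intD iS])
      also have "\<dots> = (B * \<eta> / \<epsilon> k) * measure lborel ?S" using S by (simp add: borel_compact)
      also have "\<dots> \<le> (B * \<eta> / \<epsilon> k) * (2 ^ DIM('a) * \<epsilon> k)"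
        using measure_strip_le[OF \<epsilon>[of k]] B \<eta> \<epsilon>[of k] by (intro mult_left_mono) auto
      also have "\<dots> = B * \<eta> * 2 ^ DIM('a)" using \<epsilon>[of k] by simp
      also have "\<dots> \<le> \<eta> * c" using \<eta> by (simp add: c_def algebra_simps)
      also have "\<dots> < r" using r cpos unfolding \<eta>_def by simp
      finally show ?case by simp
    qed
  qed
  then have "(\<lambda>k. integral\<^sup>L lborel (A k)) \<longlonglongrightarrow> 0" unfolding eq using tendsto_minus[of _ 0] by simp
  then show ?thesis using limA LIMSEQ_unique by blast
qed

end

section \<open>Radial moments\<close>

definition bump :: "'a::euclidean_space \<Rightarrow> real" where
  "bump y = max 0 (1 - (norm y)\<^sup>2)"

lemma bump_eq_0: "norm y \<ge> 1 \<Longrightarrow> bump y = 0"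
  by (simp add: bump_def one_le_power)

lemma bump_bounds: "0 \<le> bump y" "bump y \<le> 1"
  by (auto simp: bump_def)

lemma bump_pos: "norm y < 1 \<Longrightarrow> bump y > 0"
  using abs_square_less_1[of "norm y"] by (simp add: bump_def)

text \<open>Inside the ball |y|^2 = 1 - \<open>bump y\<close>, so multiplication by |y|^2 only
  changes the exponents of the weight. For m \<ge> 1 both sides vanish outside the ball.\<close>

lemma bump_mult_norm: "m \<ge> 1 \<Longrightarrow> (norm y)\<^sup>2 * bump y ^ m = bump y ^ m - bump y ^ Suc m"
  by (auto simp: bump_def max_def algebra_simps power_0_left)

lemma continuous_on_bump [continuous_intros]: "continuous_on S bump"
  unfolding bump_def[abs_def] by (intro continuous_intros)

lemma has_pd_bump_power:
  assumes "m \<ge> 1"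
  shows "has_pd b S (\<lambda>y. bump y ^ Suc m) (\<lambda>y. - 2 * real (Suc m) * (y \<bullet> b) * bump y ^ m)"
proof -
  have "has_pd b S (\<lambda>y. 1 - (norm y)\<^sup>2) (\<lambda>y. - 2 * (y \<bullet> b))"
    unfolding has_pd_def power2_norm_eq_inner
    by (auto simp: inner_add_left inner_add_right inner_commute intro!: derivative_eq_intros)
  from has_pd_compose[OF this, of "\<lambda>x. max 0 x ^ Suc m" "\<lambda>x. real (Suc m) * max 0 x ^ m"] DERIV_max_0_power[OF assms]
  have "has_pd b S (\<lambda>y. bump y ^ Suc m) (\<lambda>y. (real (Suc m) * bump y ^ m) * (- 2 * (y \<bullet> b)))"
    unfolding bump_def by blast
  moreover have "(real (Suc m) * bump y ^ m) * (- 2 * (y \<bullet> b)) = - 2 * real (Suc m) * (y \<bullet> b) * bump y ^ m" for y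
    by (simp add: algebra_simps)
  ultimately show ?thesis by simp
qed

context half_space_eigen
begin

text \<open>The exponent m stays variable because differentiating the weight lowers it;
  \<open>moment_Suc\<close> later relates neighbouring exponents. For m \<ge> 1 the weight is
  continuous with compact support, so moments of continuous q exist.\<close>

definition moment :: "nat \<Rightarrow> ('a \<Rightarrow> real) \<Rightarrow> real" where
  "moment m q = (\<integral>y. U y * (q y * bump y ^ m) \<partial>lborel)"

lemma integrable_moment:
  assumes "continuous_on UNIV q" "m \<ge> 1"
  shows "integrable lborel (\<lambda>y. U y * (q y * bump y ^ m))"
  by (rule integrable_U_mult[of _ "cball 0 1"])
    (use assms in \<open>auto intro!: continuous_intros simp: bump_eq_0\<close>)

lemma moment_add:
  assumes "continuous_on UNIV p" "continuous_on UNIV q" "m \<ge> 1"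
  shows "moment m (\<lambda>y. p y + q y) = moment m p + moment m q"
  using integrable_moment[OF assms(1,3)] integrable_moment[OF assms(2,3)]
  by (simp add: moment_def distrib_left distrib_right)

lemma moment_cmult: "moment m (\<lambda>y. c * q y) = c * moment m q"
  unfolding moment_def by (subst integral_mult_right_zero[symmetric]) (simp add: mult_ac)

lemma moment_sum:
  assumes "\<And>i. i \<in> I \<Longrightarrow> continuous_on UNIV (q i)" "m \<ge> 1"
  shows "moment m (\<lambda>y. \<Sum>i\<in>I. q i y) = (\<Sum>i\<in>I. moment m (q i))"
proof -
  have "moment m (\<lambda>y. \<Sum>i\<in>I. q i y) = (\<integral>y. (\<Sum>i\<in>I. U y * (q i y * bump y ^ m)) \<partial>lborel)"
    unfolding moment_def by (simp add: sum_distrib_left sum_distrib_right)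
  also have "\<dots> = (\<Sum>i\<in>I. moment m (q i))"
    unfolding moment_def by (rule Bochner_Integration.integral_sum) (use assms integrable_moment in auto)
  finally show ?thesis .
qed

text \<open>Euler's identity in integrated form, from differentiating \<open>r\<^sup>N \<integral> F(r y) dy\<close> at \<open>r = 1\<close>. It
  replaces polar coordinates.\<close>

lemma moment_Suc:
  assumes c: "continuous_on UNIV q" and hom: "\<And>r y. r > 0 \<Longrightarrow> q (r *\<^sub>R y) = r ^ d * q y" and m: "m \<ge> 1"
  shows "real (DIM('a) + d + 2 * Suc m) * moment (Suc m) q = 2 * real (Suc m) * moment m q"
proof -
  let ?K = "cball (0::'a) 1"
  let ?N = "DIM('a) + d"
  define F where "F y = U y * (q y * bump y ^ Suc m)" for y
  have iF: "integrable lborel F" unfolding F_def[abs_def] by (rule integrable_moment[OF c]) auto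
  define h where "h k = inverse (real (Suc k))" for k
  have h: "0 < h k" "h k \<le> 1" for k by (auto simp: h_def field_simps)
  \<comment> \<open>With s = |y|^2 this is the radial factor of a dilation: r^N F(r y) = U y * (q y
    * \<psi> s r), because U has degree 0 and q has degree d.\<close>
  define \<psi> where "\<psi> s r = r ^ ?N * max 0 (1 - r\<^sup>2 * s) ^ Suc m" for s r :: real
  define \<psi>' where "\<psi>' s r = real ?N * r ^ (?N - 1) * max 0 (1 - r\<^sup>2 * s) ^ Suc m
      - r ^ ?N * (real (Suc m) * max 0 (1 - r\<^sup>2 * s) ^ m * (2 * r * s))" for s r :: real
  have d\<psi>: "(\<psi> s has_real_derivative \<psi>' s r) (at r)" for s r
  proof -
    have "((\<lambda>r. max 0 (1 - r\<^sup>2 * s) ^ Suc m) has_real_derivative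
        (real (Suc m) * max 0 (1 - r\<^sup>2 * s) ^ m) * (- (2 * r * s))) (at r)"
      by (rule DERIV_chain2[where f="\<lambda>x. max 0 x ^ Suc m" and g="\<lambda>r. 1 - r\<^sup>2 * s"], rule DERIV_max_0_power[OF m])
        (auto intro!: derivative_eq_intros)
    from DERIV_mult[OF DERIV_pow[of ?N r] this] show ?thesis
      unfolding \<psi>_def[abs_def] \<psi>'_def by (simp add: algebra_simps)
  qed
  define q' where "q' k y = U y * (q y * ((\<psi> ((norm y)\<^sup>2) (1 + h k) - \<psi> ((norm y)\<^sup>2) 1) / h k))" for k y
  have F_scale: "(1 + h k) ^ DIM('a) * F ((1 + h k) *\<^sub>R y) = U y * (q y * \<psi> ((norm y)\<^sup>2) (1 + h k))" for k y
    using U_scale[of "1 + h k" y] hom[of "1 + h k" y] h(1)[of k]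
    by (simp add: F_def \<psi>_def bump_def power_add power_mult_distrib mult_ac)
  have F_1: "F y = U y * (q y * \<psi> ((norm y)\<^sup>2) 1)" for y
    by (simp add: F_def \<psi>_def bump_def)
  \<comment> \<open>By substitution the integral of r^N F(r y) does not depend on r.\<close>
  have int0: "integral\<^sup>L lborel (q' k) = 0" for k
  proof -
    have r: "1 + h k \<noteq> 0" "\<bar>1 + h k\<bar> = 1 + h k" using h(1)[of k] by auto
    note aff = integrable_lborel_affine[OF iF r(1), of 0, unfolded r(2) add_0]
    have "q' k = (\<lambda>y. ((1 + h k) ^ DIM('a) * F ((1 + h k) *\<^sub>R y) - F y) / h k)"
      unfolding F_scale unfolding F_1 q'_def by (auto simp: algebra_simps diff_divide_distrib)
    then have "integral\<^sup>L lborel (q' k) = ((1 + h k) ^ DIM('a) * (\<integral>y. F ((1 + h k) *\<^sub>R y) \<partial>lborel) - integral\<^sup>L lborel F) / h k"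
      using aff(1) iF by simp
    then show ?thesis using aff(2) by simp
  qed
  obtain CU where CU: "CU \<ge> 0" "\<And>y. \<bar>U y\<bar> \<le> CU" using U_bounded by metis
  have "compact (q ` ?K)" by (intro compact_continuous_image continuous_on_subset[OF c]) auto
  then obtain Cq where Cq: "\<And>y. y \<in> ?K \<Longrightarrow> \<bar>q y\<bar> \<le> Cq" using compact_imp_bounded by (force simp: bounded_iff)
  have Cq0: "Cq \<ge> 0" using Cq[of 0] by (auto intro: order_trans[OF abs_ge_zero])
  \<comment> \<open>A bound for \<psi>' on 0 \<le> s \<le> 1 and 1 \<le> r \<le> 2, the range that
    the mean value theorem can reach because \<open>h k\<close> \<le> 1.\<close>
  let ?C = "real ?N * 2 ^ ?N + 2 ^ ?N * (real (Suc m) * 1 * 4)"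
  have \<psi>'_bound: "\<bar>\<psi>' s r\<bar> \<le> ?C" if "0 \<le> s" "s \<le> 1" "1 \<le> r" "r \<le> 2" for s r
  proof -
    have pp: "max 0 (1 - r\<^sup>2 * s) ^ j \<le> 1" "0 \<le> max 0 (1 - r\<^sup>2 * s) ^ j" for j
      using that by (auto intro!: power_le_one)
    have r1: "r ^ (?N - 1) \<le> 2 ^ ?N"
      using that by (intro order_trans[OF power_mono[of r 2] power_increasing]) auto
    have r2: "r ^ ?N \<le> 2 ^ ?N" using that by (intro power_mono) auto
    have "real ?N * r ^ (?N - 1) * max 0 (1 - r\<^sup>2 * s) ^ Suc m \<le> real ?N * 2 ^ ?N * 1"
      using that r1 pp by (intro mult_mono) (auto simp del: power_Suc)
    moreover have "r ^ ?N * (real (Suc m) * max 0 (1 - r\<^sup>2 * s) ^ m * (2 * r * s)) \<le> 2 ^ ?N * (real (Suc m) * 1 * 4)"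
    proof -
      have "2 * r * s \<le> 2 * 2 * 1" using that by (intro mult_mono) auto
      then show ?thesis using that r2 pp by (intro mult_mono) auto
    qed
    moreover have "0 \<le> real ?N * r ^ (?N - 1) * max 0 (1 - r\<^sup>2 * s) ^ Suc m"
      "0 \<le> r ^ ?N * (real (Suc m) * max 0 (1 - r\<^sup>2 * s) ^ m * (2 * r * s))"
      using that pp by (auto intro!: mult_nonneg_nonneg)
    moreover have "0 \<le> real ?N * 2 ^ ?N" "(0::real) \<le> 2 ^ ?N * (real (Suc m) * 1 * 4)" by auto
    ultimately show ?thesis unfolding \<psi>'_def by linarith
  qed
  have bound: "norm (q' k y) \<le> (CU * (Cq * ?C)) * indicat_real ?K y" for k y
  proof (cases "y \<in> ?K")
    case True
    let ?s = "(norm y)\<^sup>2"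
    have s: "0 \<le> ?s" "?s \<le> 1" using True by (auto simp: power_le_one)
    have "\<exists>z>1. z < 1 + h k \<and> \<psi> ?s (1 + h k) - \<psi> ?s 1 = (1 + h k - 1) * \<psi>' ?s z"
      by (rule MVT2) (use h d\<psi> in auto)
    then obtain z where z: "1 < z" "z < 1 + h k" "\<psi> ?s (1 + h k) - \<psi> ?s 1 = (1 + h k - 1) * \<psi>' ?s z" by blast
    have "\<bar>\<psi>' ?s z\<bar> \<le> ?C" using z h(2)[of k] s by (intro \<psi>'_bound) auto
    then have "\<bar>(\<psi> ?s (1 + h k) - \<psi> ?s 1) / h k\<bar> \<le> ?C" using z h(1)[of k] by simp
    then have "\<bar>U y\<bar> * (\<bar>q y\<bar> * \<bar>(\<psi> ?s (1 + h k) - \<psi> ?s 1) / h k\<bar>) \<le> CU * (Cq * ?C)"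
      using CU Cq[OF True] Cq0 by (intro mult_mono mult_nonneg_nonneg) auto
    then show ?thesis using True by (simp add: q'_def abs_mult)
  next
    case False
    then have "1 - (norm y)\<^sup>2 \<le> 0" by (simp add: one_le_power)
    moreover have "1 - (1 + h k)\<^sup>2 * (norm y)\<^sup>2 \<le> 0"
    proof -
      have "1 * 1 \<le> (1 + h k)\<^sup>2 * (norm y)\<^sup>2"
        using False h(1)[of k] by (intro mult_mono one_le_power) auto
      then show ?thesis by simp
    qed
    ultimately have "\<psi> ((norm y)\<^sup>2) (1 + h k) = 0" "\<psi> ((norm y)\<^sup>2) 1 = 0"
      by (auto simp: \<psi>_def)
    then show ?thesis using False by (simp add: q'_def)
  qed
  have lim: "(\<lambda>k. q' k y) \<longlonglongrightarrow> U y * (q y * \<psi>' ((norm y)\<^sup>2) 1)" for y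
  proof -
    have "((\<lambda>t. (\<psi> ((norm y)\<^sup>2) (1 + t) - \<psi> ((norm y)\<^sup>2) 1) / t) \<longlongrightarrow> \<psi>' ((norm y)\<^sup>2) 1) (at 0)"
      using d\<psi> unfolding DERIV_def by simp
    moreover have "h \<longlonglongrightarrow> 0" unfolding h_def by (rule LIMSEQ_inverse_real_of_nat)
    then have "filterlim h (at 0) sequentially"
      unfolding filterlim_at using h(1) by (auto intro!: always_eventually simp: less_imp_neq[THEN not_sym])
    ultimately have "(\<lambda>k. (\<psi> ((norm y)\<^sup>2) (1 + h k) - \<psi> ((norm y)\<^sup>2) 1) / h k) \<longlonglongrightarrow> \<psi>' ((norm y)\<^sup>2) 1"
      using filterlim_compose by fastforce
    then show ?thesis unfolding q'_def by (intro tendsto_intros)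
  qed
  have [measurable]: "q \<in> borel_measurable borel" using c by (rule borel_measurable_continuous_onI)
  have "(\<lambda>k. integral\<^sup>L lborel (q' k)) \<longlonglongrightarrow> (\<integral>y. U y * (q y * \<psi>' ((norm y)\<^sup>2) 1) \<partial>lborel)"
  proof (rule integral_dominated_convergence[where w="\<lambda>y. (CU * (Cq * ?C)) * indicat_real ?K y"])
    show "integrable lborel (\<lambda>y. (CU * (Cq * ?C)) * indicat_real ?K y)"
      by (intro integrable_mult_right integrable_real_indicator emeasure_compact_finite) auto
    show "q' k \<in> borel_measurable lborel" for k unfolding q'_def \<psi>_def by measurable
    show "(\<lambda>y. U y * (q y * \<psi>' ((norm y)\<^sup>2) 1)) \<in> borel_measurable lborel" unfolding \<psi>'_def by measurable
  qed (use lim bound in auto)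
  then have "(\<integral>y. U y * (q y * \<psi>' ((norm y)\<^sup>2) 1) \<partial>lborel) = 0"
    using int0 by (simp add: LIMSEQ_const_iff)
  \<comment> \<open>Writing |y|^2 as 1 - \<open>bump y\<close> leaves pure powers of the weight, so
    the limit integral is a combination of two moments.\<close>
  moreover have \<psi>'_1: "\<psi>' ((norm y)\<^sup>2) 1 = real (?N + 2 * Suc m) * bump y ^ Suc m - 2 * real (Suc m) * bump y ^ m" for y :: 'a
  proof -
    have "\<psi>' ((norm y)\<^sup>2) 1 = real ?N * bump y ^ Suc m - 2 * real (Suc m) * ((norm y)\<^sup>2 * bump y ^ m)"
      by (simp add: \<psi>'_def bump_def)
    then show ?thesis unfolding bump_mult_norm[OF m] by (simp add: algebra_simps)
  qed
  then have "(\<lambda>y. U y * (q y * \<psi>' ((norm y)\<^sup>2) 1)) = (\<lambda>y. real (?N + 2 * Suc m) * (U y * (q y * bump y ^ Suc m))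
     - 2 * real (Suc m) * (U y * (q y * bump y ^ m)))"
    unfolding \<psi>'_1 by (simp add: algebra_simps del: power_Suc)
  ultimately have "(\<integral>y. real (?N + 2 * Suc m) * (U y * (q y * bump y ^ Suc m))
     - 2 * real (Suc m) * (U y * (q y * bump y ^ m)) \<partial>lborel) = 0" by simp
  then show ?thesis
    using integrable_moment[OF c, of "Suc m"] integrable_moment[OF c m]
    by (simp add: moment_def del: power_Suc)
qed

end

section \<open>The moment recursion\<close>

definition monomial :: "('a::euclidean_space \<Rightarrow> nat) \<Rightarrow> 'a \<Rightarrow> real" where
  "monomial \<beta> y = (\<Prod>b\<in>Basis. (y \<bullet> b) ^ \<beta> b)"

definition deg :: "('a::euclidean_space \<Rightarrow> nat) \<Rightarrow> nat" where
  "deg \<beta> = (\<Sum>b\<in>Basis. \<beta> b)"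

lemma continuous_on_mono [continuous_intros]: "continuous_on S (monomial \<beta>)"
  unfolding monomial_def[abs_def] by (intro continuous_intros)

lemma mono_scale: "monomial \<beta> (r *\<^sub>R y) = r ^ deg \<beta> * monomial \<beta> y"
  by (simp add: monomial_def deg_def power_mult_distrib prod.distrib power_sum)

lemma mono_mult: "monomial \<beta> y * monomial \<gamma> y = monomial (\<lambda>b. \<beta> b + \<gamma> b) y"
  by (simp add: monomial_def power_add prod.distrib)

lemma mono_upd:
  assumes "b \<in> Basis"
  shows "monomial (\<beta>(b := k)) y = (y \<bullet> b) ^ k * (\<Prod>b\<in>Basis - {b}. (y \<bullet> b) ^ \<beta> b)"
  unfolding monomial_def using assms
  by (subst prod.remove[of _ b]) (auto intro!: prod.cong)

lemma mono_split:
  assumes "b \<in> Basis"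
  shows "monomial \<beta> y = (y \<bullet> b) ^ \<beta> b * (\<Prod>b\<in>Basis - {b}. (y \<bullet> b) ^ \<beta> b)"
  using mono_upd[OF assms, of \<beta> "\<beta> b"] by simp

lemma mono_Suc: "b \<in> Basis \<Longrightarrow> (y \<bullet> b) * monomial \<beta> y = monomial (\<beta>(b := Suc (\<beta> b))) y"
  by (simp add: mono_upd mono_split[of b \<beta>])

lemma mono_dec: "b \<in> Basis \<Longrightarrow> \<beta> b \<ge> 1 \<Longrightarrow> (y \<bullet> b) * monomial (\<beta>(b := \<beta> b - 1)) y = monomial \<beta> y"
  using mono_Suc[of b y "\<beta>(b := \<beta> b - 1)"] by simp

lemma deg_upd: "b \<in> Basis \<Longrightarrow> deg (\<beta>(b := k)) + \<beta> b = deg \<beta> + k"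
  unfolding deg_def by (simp add: sum.remove[of Basis b])

lemma has_pd_mono:
  assumes b: "b \<in> Basis"
  shows "has_pd b S (monomial \<beta>) (\<lambda>y. real (\<beta> b) * monomial (\<beta>(b := \<beta> b - 1)) y)"
  unfolding has_pd_def
proof
  fix y
  define P where "P = (\<Prod>c\<in>Basis - {b}. (y \<bullet> c) ^ \<beta> c)"
  have "monomial \<beta> (y + t *\<^sub>R b) = (y \<bullet> b + t) ^ \<beta> b * P" for t
  proof -
    have "(\<Prod>c\<in>Basis - {b}. ((y + t *\<^sub>R b) \<bullet> c) ^ \<beta> c) = P"
      unfolding P_def using b by (intro prod.cong) (auto simp: inner_add_left inner_Basis)
    then show ?thesis using b by (simp add: mono_split[OF b] inner_add_left)
  qed
  moreover have "((\<lambda>t. (y \<bullet> b + t) ^ \<beta> b * P) has_real_derivative real (\<beta> b) * (y \<bullet> b) ^ (\<beta> b - 1) * P) (at 0)"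
    by (rule derivative_eq_intros refl)+ simp
  ultimately show "((\<lambda>t. monomial \<beta> (y + t *\<^sub>R b)) has_real_derivative real (\<beta> b) * monomial (\<beta>(b := \<beta> b - 1)) y) (at 0)"
    by (simp add: mono_upd[OF b] P_def mult_ac)
qed

text \<open>The truncated exponent \<open>\<beta> b - 2\<close> is harmless: for
  \<open>\<beta> b\<close> < 2 the factor \<open>real (\<beta> b) * real (\<beta> b - 1)\<close> is
  0.\<close>

lemma has_pd_mono2:
  assumes b: "b \<in> Basis"
  shows "has_pd b S (\<lambda>y. real (\<beta> b) * monomial (\<beta>(b := \<beta> b - 1)) y)
    (\<lambda>y. real (\<beta> b) * real (\<beta> b - 1) * monomial (\<beta>(b := \<beta> b - 2)) y)"
proof -
  have "\<beta> b - 1 - 1 = \<beta> b - 2" by linarith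
  then have "has_pd b S (monomial (\<beta>(b := \<beta> b - 1))) (\<lambda>y. real (\<beta> b - 1) * monomial (\<beta>(b := \<beta> b - 2)) y)"
    using has_pd_mono[OF b, of S "\<beta>(b := \<beta> b - 1)"] by (simp only: fun_upd_upd fun_upd_same)
  from has_pd_mult[OF has_pd_const this, of "real (\<beta> b)"] show ?thesis
    by (simp only: mult_zero_left add_0 mult.assoc)
qed

lemma euler_mono: "(\<Sum>b\<in>Basis. (y \<bullet> b) * (real (\<beta> b) * monomial (\<beta>(b := \<beta> b - 1)) y)) = real (deg \<beta>) * monomial \<beta> y"
proof -
  have "(\<Sum>b\<in>Basis. (y \<bullet> b) * (real (\<beta> b) * monomial (\<beta>(b := \<beta> b - 1)) y)) = (\<Sum>b\<in>Basis. real (\<beta> b) * monomial \<beta> y)"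
  proof (rule sum.cong[OF refl])
    fix b :: 'a assume b: "b \<in> Basis"
    show "(y \<bullet> b) * (real (\<beta> b) * monomial (\<beta>(b := \<beta> b - 1)) y) = real (\<beta> b) * monomial \<beta> y"
    proof (cases "\<beta> b = 0")
      case False
      then show ?thesis using mono_dec[OF b, of \<beta> y] by (simp add: mult_ac)
    qed simp
  qed
  then show ?thesis by (simp add: deg_def sum_distrib_right)
qed

lemma bounded_mono:
  obtains C where "C \<ge> 0" "\<And>y. norm y \<le> 1 \<Longrightarrow> \<bar>monomial \<beta> y\<bar> \<le> C"
proof
  show "(0::real) \<le> 1" by simp
  fix y :: 'a assume y: "norm y \<le> 1"
  have "\<bar>y \<bullet> b\<bar> ^ \<beta> b \<le> 1" if "b \<in> Basis" for b
    using Basis_le_norm[OF that, of y] y by (intro power_le_one) auto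
  then show "\<bar>monomial \<beta> y\<bar> \<le> 1"
    unfolding monomial_def abs_prod power_abs by (intro prod_le_1) auto
qed

context half_space_eigen
begin

text \<open>The weak equation for t * p, where t * p is \<open>monomial \<beta>\<close> times |y|^2
  bump^3. Derivatives of the weight bring in the exponents 1, 2 and 3, and \<open>moment_Suc\<close>
  reduces them all to 3. The Laplacian of the monomial keeps the whole weight, which is bump^3 -
  bump^4.\<close>

lemma moment_mono_recursion:
  assumes odd: "odd (\<beta> e)" and d: "d = deg \<beta>"
  shows "(\<mu> - real d * (real d + real DIM('a) - 2)) * moment 3 (monomial \<beta>) +
    (\<Sum>b\<in>Basis. real (\<beta> b) * real (\<beta> b - 1) *
       (moment 3 (monomial (\<beta>(b := \<beta> b - 2))) - moment 4 (monomial (\<beta>(b := \<beta> b - 2))))) = 0"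
proof -
  define \<beta>' where "\<beta>' = \<beta>(e := \<beta> e - 1)"
  let ?N = "real DIM('a)"
  have \<beta>e: "\<beta> e \<ge> 1" using odd by (cases "\<beta> e") auto
  have up: "(y \<bullet> e) * monomial \<beta>' y = monomial \<beta> y" for y
    unfolding \<beta>'_def using e \<beta>e by (rule mono_dec[where b=e])
  have d': "deg \<beta>' + 1 = d" using deg_upd[OF e, of \<beta> "\<beta> e - 1"] \<beta>e d by (simp add: \<beta>'_def)
  \<comment> \<open>This is |y|^2 bump^3, written so that it can be differentiated termwise. Its
    gradient is y times G1, and the gradient of G1 is y times G2.\<close>
  define G where "G y = bump y ^ 3 - bump y ^ 4" for y :: 'a
  define G1 where "G1 y = - 6 * bump y ^ 2 + 8 * bump y ^ 3" for y :: 'a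
  define G2 where "G2 y = 24 * bump y - 48 * bump y ^ 2" for y :: 'a
  have pG: "has_pd b UNIV G (\<lambda>y. (y \<bullet> b) * G1 y)" for b
  proof -
    have "has_pd b UNIV G (\<lambda>y. (- 2 * real (Suc 2) * (y \<bullet> b) * bump y ^ 2) - (- 2 * real (Suc 3) * (y \<bullet> b) * bump y ^ 3))"
      unfolding G_def[abs_def] using has_pd_diff[OF has_pd_bump_power[of 2 b UNIV] has_pd_bump_power[of 3 b UNIV]]
      by (simp add: eval_nat_numeral)
    then show ?thesis by (rule has_pd_cong) (auto simp: G1_def algebra_simps)
  qed
  have pG1: "has_pd b UNIV G1 (\<lambda>y. (y \<bullet> b) * G2 y)" for b
  proof -
    have "has_pd b UNIV (\<lambda>y. (-6) * bump y ^ Suc 1 + 8 * bump y ^ Suc 2)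
      (\<lambda>y. (0 * bump y ^ Suc 1 + (-6) * (- 2 * real (Suc 1) * (y \<bullet> b) * bump y ^ 1)) + (0 * bump y ^ Suc 2 + 8 * (- 2 * real (Suc 2) * (y \<bullet> b) * bump y ^ 2)))"
      by (intro has_pd_add has_pd_mult has_pd_const has_pd_bump_power) auto
    then show ?thesis by (rule has_pd_cong) (auto simp: G1_def G2_def algebra_simps eval_nat_numeral)
  qed
  define m1 where "m1 b y = real (\<beta>' b) * monomial (\<beta>'(b := \<beta>' b - 1)) y" for b y
  define m2 where "m2 b y = real (\<beta>' b) * real (\<beta>' b - 1) * monomial (\<beta>'(b := \<beta>' b - 2)) y" for b y
  have pm: "has_pd b UNIV (monomial \<beta>') (m1 b)" if "b \<in> Basis" for b
    unfolding m1_def[abs_def] by (rule has_pd_mono[OF that])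
  have pm1: "has_pd b UNIV (m1 b) (m2 b)" if "b \<in> Basis" for b
    unfolding m1_def[abs_def] m2_def[abs_def] by (rule has_pd_mono2[OF that])
  let ?p = "\<lambda>y. monomial \<beta>' y * G y"
  let ?p1 = "\<lambda>b y. m1 b y * G y + monomial \<beta>' y * ((y \<bullet> b) * G1 y)"
  let ?p2 = "\<lambda>b y. (m2 b y * G y + m1 b y * ((y \<bullet> b) * G1 y)) + (m1 b y * ((y \<bullet> b) * G1 y) + monomial \<beta>' y * ((b \<bullet> b) * G1 y + (y \<bullet> b) * ((y \<bullet> b) * G2 y)))"
  have cG: "continuous_on UNIV G" "continuous_on UNIV G1" "continuous_on UNIV G2"
    unfolding G_def[abs_def] G1_def[abs_def] G2_def[abs_def] by (intro continuous_intros)+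
  have cm: "continuous_on UNIV (m1 b)" "continuous_on UNIV (m2 b)" for b
    unfolding m1_def[abs_def] m2_def[abs_def] by (intro continuous_intros)+
  have Gs: "G y = (norm y)\<^sup>2 * bump y ^ 3" for y
    using bump_mult_norm[of 3 y] by (simp add: G_def)
  obtain C where C: "C \<ge> 0" "\<And>y. norm y \<le> 1 \<Longrightarrow> \<bar>monomial \<beta>' y\<bar> \<le> C" using bounded_mono by metis
  have weak: "(\<integral>y. U y * ((y \<bullet> e) * (\<Sum>b\<in>Basis. ?p2 b y) + 2 * ?p1 e y + \<mu> * ((y \<bullet> e) * ?p y) / (norm y)\<^sup>2) \<partial>lborel) = 0"
  proof (rule weak_equation)
    show "has_pd b UNIV ?p (?p1 b)" if "b \<in> Basis" for b by (intro has_pd_mult pm pG that)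
    show "has_pd b UNIV (?p1 b) (?p2 b)" if "b \<in> Basis" for b
      by (intro has_pd_add has_pd_mult pm pm1 pG pG1 that has_pd_inner)
    show "continuous_on UNIV ?p" by (intro continuous_intros cG)
    show "continuous_on UNIV (?p1 b)" for b by (intro continuous_intros cG cm)
    show "continuous_on UNIV (?p2 b)" for b by (intro continuous_intros cG cm)
    show "?p y = 0" if "norm y \<ge> 1" for y using bump_eq_0[OF that] by (simp add: G_def)
    show "\<bar>?p y\<bar> \<le> C * (norm y)\<^sup>2" for y
    proof (cases "norm y \<le> 1")
      case True
      have "\<bar>monomial \<beta>' y\<bar> * ((norm y)\<^sup>2 * bump y ^ 3) \<le> C * ((norm y)\<^sup>2 * 1)"
        using C True bump_bounds[of y] by (intro mult_mono) (auto intro: power_le_one)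
      then show ?thesis using bump_bounds[of y] by (simp add: Gs abs_mult)
    next
      case False
      then show ?thesis using bump_eq_0[of y] C(1) by (simp add: G_def)
    qed
  qed
  let ?L = "\<lambda>y. \<Sum>b\<in>Basis. real (\<beta> b) * real (\<beta> b - 1) * monomial (\<beta>(b := \<beta> b - 2)) y"
  \<comment> \<open>The product rule \<Delta>(t q) = t \<Delta>q + 2 dq/dt for q =
    \<open>monomial \<beta>'\<close>. The cases deal with truncated subtraction in the exponent of
    t.\<close>
  have lap: "(y \<bullet> e) * (\<Sum>b\<in>Basis. m2 b y) + 2 * m1 e y = ?L y" for y
  proof -
    have "(y \<bullet> e) * m2 b y + (if b = e then 2 * m1 e y else 0) = real (\<beta> b) * real (\<beta> b - 1) * monomial (\<beta>(b := \<beta> b - 2)) y"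
      if b: "b \<in> Basis" for b
    proof (cases "b = e")
      case False
      have "(y \<bullet> e) * monomial (\<beta>'(b := \<beta>' b - 2)) y = monomial (\<beta>(b := \<beta> b - 2)) y"
        using mono_dec[OF e, of "\<beta>(b := \<beta> b - 2)" y] False \<beta>e by (simp add: \<beta>'_def fun_upd_twist)
      then show ?thesis using False by (simp add: m2_def \<beta>'_def mult_ac)
    next
      case True
      show ?thesis
      proof (cases "\<beta> e \<ge> 2")
        case ge2: True
        then obtain k where k: "\<beta> e = Suc (Suc k)" by (metis add_2_eq_Suc le_Suc_ex)
        then show ?thesis
        proof (cases k)
          case 0
          then show ?thesis using k odd by simp
        next
          case (Suc j)
          have "(y \<bullet> e) * monomial (\<beta>(e := j)) y = monomial (\<beta>(e := Suc j)) y"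
            using mono_Suc[OF e, of y "\<beta>(e := j)"] by simp
          then have "(y \<bullet> e) * m2 e y = real (Suc k) * real k * monomial (\<beta>(e := k)) y"
            using Suc k by (simp add: m2_def \<beta>'_def)
          then show ?thesis using True Suc k by (simp add: m1_def \<beta>'_def algebra_simps)
        qed
      next
        case False
        then have "\<beta> e = 1" using \<beta>e by simp
        then show ?thesis using True by (simp add: m2_def m1_def \<beta>'_def)
      qed
    qed
    then have "?L y = (\<Sum>b\<in>Basis. (y \<bullet> e) * m2 b y + (if b = e then 2 * m1 e y else 0))"
      by (intro sum.cong) auto
    then show ?thesis using e by (simp add: sum.distrib sum_distrib_left)
  qed
  have integrand: "U y * ((y \<bullet> e) * (\<Sum>b\<in>Basis. ?p2 b y) + 2 * ?p1 e y + \<mu> * ((y \<bullet> e) * ?p y) / (norm y)\<^sup>2) =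
      U y * (?L y * bump y ^ 3) - U y * (?L y * bump y ^ 4) + 24 * (U y * (monomial \<beta> y * bump y ^ 1))
      - (72 + 6 * (2 * real d + ?N)) * (U y * (monomial \<beta> y * bump y ^ 2))
      + (48 + 8 * (2 * real d + ?N) + \<mu>) * (U y * (monomial \<beta> y * bump y ^ 3))" for y
  proof (cases "y \<in> H")
    case True
    then have nz: "norm y \<noteq> 0" using H_nz by auto
    have s: "(\<Sum>b\<in>Basis. (y \<bullet> b) * m1 b y) = real (deg \<beta>') * monomial \<beta>' y"
      unfolding m1_def by (rule euler_mono)
    have n2: "(\<Sum>b\<in>Basis. (y \<bullet> b) * (y \<bullet> b)) = (norm y)\<^sup>2"
      by (simp add: power2_norm_eq_inner euclidean_inner[of y y])
    have n2G2: "(norm y)\<^sup>2 * G2 y = 24 * bump y - 72 * bump y ^ 2 + 48 * bump y ^ 3"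
      using bump_mult_norm[of 1 y] bump_mult_norm[of 2 y] by (simp add: G2_def algebra_simps eval_nat_numeral)
    have "(\<Sum>b\<in>Basis. ?p2 b y) = (\<Sum>b\<in>Basis. m2 b y) * G y + 2 * G1 y * (\<Sum>b\<in>Basis. (y \<bullet> b) * m1 b y)
        + monomial \<beta>' y * (?N * G1 y + (\<Sum>b\<in>Basis. (y \<bullet> b) * (y \<bullet> b)) * G2 y)"
    proof -
      have "(\<Sum>b\<in>Basis. ?p2 b y) = (\<Sum>b\<in>Basis. m2 b y * G y + 2 * G1 y * ((y \<bullet> b) * m1 b y) + monomial \<beta>' y * (1 * G1 y + ((y \<bullet> b) * (y \<bullet> b)) * G2 y))"
        by (intro sum.cong) (auto simp: algebra_simps)
      also have "\<dots> = (\<Sum>b\<in>Basis. m2 b y * G y) + (\<Sum>b\<in>Basis. 2 * G1 y * ((y \<bullet> b) * m1 b y)) + monomial \<beta>' y * (\<Sum>b\<in>(Basis::'a set). 1 * G1 y + ((y \<bullet> b) * (y \<bullet> b)) * G2 y)"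
        by (simp only: sum.distrib sum_distrib_left[of "monomial \<beta>' y", symmetric])
      also have "(\<Sum>b\<in>(Basis::'a set). 1 * G1 y + ((y \<bullet> b) * (y \<bullet> b)) * G2 y) = ?N * G1 y + (\<Sum>b\<in>Basis. (y \<bullet> b) * (y \<bullet> b)) * G2 y"
        by (simp add: sum.distrib sum_distrib_right)
      finally show ?thesis by (simp only: sum_distrib_left sum_distrib_right)
    qed
    then have "(y \<bullet> e) * (\<Sum>b\<in>Basis. ?p2 b y) + 2 * ?p1 e y =
        ((y \<bullet> e) * (\<Sum>b\<in>Basis. m2 b y) + 2 * m1 e y) * G y + 2 * G1 y * (real (deg \<beta>') * ((y \<bullet> e) * monomial \<beta>' y))
         + ((y \<bullet> e) * monomial \<beta>' y) * (?N * G1 y + (norm y)\<^sup>2 * G2 y) + 2 * ((y \<bullet> e) * monomial \<beta>' y) * G1 y"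
      unfolding s n2 by (simp add: algebra_simps)
    also have "\<dots> = ?L y * G y + monomial \<beta> y * ((2 * real d + ?N) * G1 y + (24 * bump y - 72 * bump y ^ 2 + 48 * bump y ^ 3))"
      unfolding lap up n2G2 d'[symmetric] by (simp add: algebra_simps)
    finally have 1: "(y \<bullet> e) * (\<Sum>b\<in>Basis. ?p2 b y) + 2 * ?p1 e y = \<dots>" .
    have 2: "\<mu> * ((y \<bullet> e) * ?p y) / (norm y)\<^sup>2 = \<mu> * monomial \<beta> y * bump y ^ 3"
      using nz by (simp add: Gs up[symmetric])
    show ?thesis unfolding 1 2 by (simp add: G_def G1_def algebra_simps)
  next
    case False
    then show ?thesis using U_eq_0 by simp
  qed
  have cL: "continuous_on UNIV ?L" by (intro continuous_intros)
  note im = integrable_moment[OF cL] integrable_moment[OF continuous_on_mono[of UNIV \<beta>]]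
  have "moment 3 ?L - moment 4 ?L + 24 * moment 1 (monomial \<beta>) - (72 + 6 * (2 * real d + ?N)) * moment 2 (monomial \<beta>)
      + (48 + 8 * (2 * real d + ?N) + \<mu>) * moment 3 (monomial \<beta>) = 0"
    using weak unfolding integrand using im(1)[of 3] im(1)[of 4] im(2)[of 1] im(2)[of 2] im(2)[of 3]
    unfolding moment_def by (simp del: One_nat_def power_one_right)
  moreover have "(?N + d + 4) * moment 2 (monomial \<beta>) = 4 * moment 1 (monomial \<beta>)"
    using moment_Suc[OF continuous_on_mono[of UNIV \<beta>], of "deg \<beta>" 1] mono_scale[of \<beta>] d
    by (simp add: eval_nat_numeral algebra_simps)
  moreover have r3: "(?N + d + 6) * moment 3 (monomial \<beta>) = 6 * moment 2 (monomial \<beta>)"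
    using moment_Suc[OF continuous_on_mono[of UNIV \<beta>], of "deg \<beta>" 2] mono_scale[of \<beta>] d
    by (simp add: eval_nat_numeral algebra_simps)
  \<comment> \<open>With Mi the moment of weight i, 24 M1 = 6 (N + d + 4) M2 and 6 M2 = (N + d + 6)
    M3. The terms in M1 and M2 thus add up to -(d + 8) (N + d + 6) M3, and the total coefficient of
    M3 becomes \<mu> - d (d + N - 2).\<close>
  ultimately have "moment 3 ?L - moment 4 ?L + (\<mu> - real d * (real d + ?N - 2)) * moment 3 (monomial \<beta>) = 0"
    by algebra
  moreover have "moment m ?L = (\<Sum>b\<in>Basis. real (\<beta> b) * real (\<beta> b - 1) * moment m (monomial (\<beta>(b := \<beta> b - 2))))" if "m \<ge> 1" for m
    by (subst moment_sum[OF _ that]) (auto intro!: continuous_intros simp: moment_cmult)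
  ultimately show ?thesis by (simp add: sum_subtractf[symmetric] right_diff_distrib)
qed

text \<open>For a homogeneous function the moments of consecutive weights are proportional, so
  vanishing passes to the next weight.\<close>

lemma moment4_eq_0: "moment 3 (monomial \<beta>) = 0 \<Longrightarrow> moment 4 (monomial \<beta>) = 0"
  using moment_Suc[OF continuous_on_mono[of UNIV \<beta>], of "deg \<beta>" 3] mono_scale[of \<beta>]
  by (simp add: eval_nat_numeral)

text \<open>The moment recursion determines all moments of degree \<open>d\<close> from lower ones, unless
  \<open>\<mu> = d (d + n - 1)\<close>. In this exceptional degree \<open>t\<^sup>2\<close> can be traded for \<open>\<bar>y\<bar>\<^sup>2\<close> minus the other
  squares, which leaves the moments linear in \<open>t\<close>.\<close>

lemma moments_eq_0:
  assumes base: "\<And>\<beta>. \<beta> e = 1 \<Longrightarrow> \<mu> = real (deg \<beta>) * (real (deg \<beta>) + real DIM('a) - 2) \<Longrightarrow> moment 3 (monomial \<beta>) = 0"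
    and odd: "odd (\<beta> e)"
  shows "moment 3 (monomial \<beta>) = 0"
  using odd
proof (induction "deg \<beta>" arbitrary: \<beta> rule: less_induct)
  case less
  show ?case
  proof (cases "\<mu> = real (deg \<beta>) * (real (deg \<beta>) + real DIM('a) - 2)")
    case False
    have "real (\<beta> b) * real (\<beta> b - 1) * (moment 3 (monomial (\<beta>(b := \<beta> b - 2))) - moment 4 (monomial (\<beta>(b := \<beta> b - 2)))) = 0"
      if b: "b \<in> Basis" for b
    proof (cases "\<beta> b \<ge> 2")
      case True
      have "deg (\<beta>(b := \<beta> b - 2)) < deg \<beta>" using deg_upd[OF b, of \<beta> "\<beta> b - 2"] True by linarith
      moreover have "odd ((\<beta>(b := \<beta> b - 2)) e)" using less.prems True by auto
      ultimately have "moment 3 (monomial (\<beta>(b := \<beta> b - 2))) = 0" using less.hyps by blast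
      then show ?thesis using moment4_eq_0 by simp
    next
      case False
      then have "\<beta> b = 0 \<or> \<beta> b = 1" by linarith
      then show ?thesis by auto
    qed
    then have "(\<Sum>b\<in>Basis. real (\<beta> b) * real (\<beta> b - 1) *
       (moment 3 (monomial (\<beta>(b := \<beta> b - 2))) - moment 4 (monomial (\<beta>(b := \<beta> b - 2))))) = 0"
      by (intro sum.neutral) blast
    then show ?thesis using moment_mono_recursion[where \<beta>=\<beta>, OF less.prems refl] False by simp
  next
    case True
    have "moment 3 (monomial \<gamma>) = 0" if "deg \<gamma> = deg \<beta>" "odd (\<gamma> e)" for \<gamma>
      using that
    proof (induction "\<gamma> e" arbitrary: \<gamma> rule: less_induct)
      case (less \<gamma>)
      show ?case
      proof (cases "\<gamma> e = 1")
        case True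
        then show ?thesis using base less.prems \<open>\<mu> = _\<close> by auto
      next
        case False
        then have ge: "\<gamma> e \<ge> 3" using less.prems by (cases "\<gamma> e = 0"; cases "\<gamma> e = 2") auto
        \<comment> \<open>|y|^2 \<open>monomial \<delta>\<close> is \<open>monomial \<gamma>\<close>
          plus monomials of the same degree with exponent of t smaller by 2, which the inner
          induction covers. Its moment is a difference of two moments of \<delta>, whose degree is
          lower, so it vanishes by the outer induction.\<close>
        define \<delta> where "\<delta> = \<gamma>(e := \<gamma> e - 2)"
        have d\<delta>: "deg \<delta> + 2 = deg \<gamma>" using deg_upd[OF e, of \<gamma> "\<gamma> e - 2"] ge by (simp add: \<delta>_def)
        have 0: "moment 3 (monomial \<delta>) = 0"
          by (rule \<open>\<And>\<beta>'. deg \<beta>' < deg \<beta> \<Longrightarrow> odd (\<beta>' e) \<Longrightarrow> moment 3 (monomial \<beta>') = 0\<close>)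
            (use d\<delta> less.prems ge in \<open>auto simp: \<delta>_def\<close>)
        define \<zeta> where "\<zeta> b = \<delta>(b := \<delta> b + 2)" for b
        have sq: "(y \<bullet> b)\<^sup>2 * monomial \<delta> y = monomial (\<zeta> b) y" if "b \<in> Basis" for b y
          using mono_Suc[OF that, of y \<delta>] mono_Suc[OF that, of y "\<delta>(b := Suc (\<delta> b))"]
          by (simp add: \<zeta>_def power2_eq_square mult.assoc)
        have "\<zeta> e = \<gamma>"
        proof -
          have "\<gamma> e - 2 + 2 = \<gamma> e" using ge by simp
          then show ?thesis by (simp only: \<zeta>_def \<delta>_def fun_upd_upd fun_upd_same fun_upd_triv)
        qed
        have "(norm y)\<^sup>2 * monomial \<delta> y = (\<Sum>b\<in>Basis. monomial (\<zeta> b) y)" for y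
        proof -
          have "(norm y)\<^sup>2 = (\<Sum>b\<in>Basis. (y \<bullet> b)\<^sup>2)"
            unfolding power2_norm_eq_inner by (subst euclidean_inner) (simp add: power2_eq_square)
          then show ?thesis by (simp add: sum_distrib_right sq)
        qed
        then have "moment 3 (\<lambda>y. (norm y)\<^sup>2 * monomial \<delta> y) = (\<Sum>b\<in>Basis. moment 3 (monomial (\<zeta> b)))"
          by (simp add: moment_sum continuous_on_mono)
        moreover have "moment 3 (\<lambda>y. (norm y)\<^sup>2 * monomial \<delta> y) = moment 3 (monomial \<delta>) - moment 4 (monomial \<delta>)"
        proof -
          have "(norm y)\<^sup>2 * monomial \<delta> y * bump y ^ 3 = monomial \<delta> y * bump y ^ 3 - monomial \<delta> y * bump y ^ 4" for y
          proof -
            have h: "(norm y)\<^sup>2 * bump y ^ 3 = bump y ^ 3 - bump y ^ 4"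
              using bump_mult_norm[of 3 y] by simp
            have "(norm y)\<^sup>2 * monomial \<delta> y * bump y ^ 3 = ((norm y)\<^sup>2 * bump y ^ 3) * monomial \<delta> y" by simp
            also have "\<dots> = (bump y ^ 3 - bump y ^ 4) * monomial \<delta> y" by (simp only: h)
            finally show ?thesis by (simp only: left_diff_distrib right_diff_distrib mult.commute)
          qed
          then show ?thesis unfolding moment_def
            using integrable_moment[OF continuous_on_mono[of UNIV \<delta>], of 3] integrable_moment[OF continuous_on_mono[of UNIV \<delta>], of 4]
            by (simp add: right_diff_distrib)
        qed
        moreover have "moment 3 (monomial (\<zeta> b)) = 0" if "b \<in> Basis - {e}" for b
        proof (rule less.hyps)
          show "\<zeta> b e < \<gamma> e" using that ge by (auto simp: \<zeta>_def \<delta>_def)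
          show "deg (\<zeta> b) = deg \<beta>" using deg_upd[of b \<delta> "\<delta> b + 2"] that d\<delta> less.prems by (simp add: \<zeta>_def)
          show "odd (\<zeta> b e)" using that ge less.prems by (auto simp: \<zeta>_def \<delta>_def)
        qed
        ultimately have "moment 3 (monomial (\<zeta> e)) = 0"
          using e 0 moment4_eq_0[OF 0] by (simp add: sum.remove[of Basis e])
        then show ?thesis using \<open>\<zeta> e = \<gamma>\<close> by simp
      qed
    qed
    then show ?thesis using less.prems by blast
  qed
qed

end

section \<open>Completeness of the moments\<close>

text \<open>The algebra for Stone-Weierstrass. Evenness in t is imposed because t times such a
  polynomial involves only odd moments, the ones known to vanish.\<close>

inductive even_poly :: "'a::euclidean_space \<Rightarrow> ('a \<Rightarrow> real) \<Rightarrow> bool" for e where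
  even_poly_monomial: "even (\<beta> e) \<Longrightarrow> even_poly e (\<lambda>y. c * monomial \<beta> y)"
| even_poly_add: "even_poly e p \<Longrightarrow> even_poly e q \<Longrightarrow> even_poly e (\<lambda>y. p y + q y)"

lemma even_poly_mult:
  assumes "even_poly e p" "even_poly e q"
  shows "even_poly e (\<lambda>y. p y * q y)"
  using assms(1)
proof induction
  case (even_poly_monomial \<beta> c)
  note \<beta> = this
  show ?case using assms(2)
  proof induction
    case (even_poly_monomial \<gamma> d)
    have "even_poly e (\<lambda>y. (c * d) * monomial (\<lambda>b. \<beta> b + \<gamma> b) y)"
      by (rule even_poly.even_poly_monomial) (use \<beta> even_poly_monomial in auto)
    moreover have "(c * d) * monomial (\<lambda>b. \<beta> b + \<gamma> b) y = c * monomial \<beta> y * (d * monomial \<gamma> y)" for y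
      unfolding mono_mult[symmetric] by simp
    ultimately show ?case by simp
  next
    case (even_poly_add p q)
    then show ?case using even_poly.even_poly_add by (simp add: distrib_left)
  qed
next
  case (even_poly_add p q)
  then show ?case using even_poly.even_poly_add by (simp add: distrib_right)
qed

lemma monomial_single: "b \<in> Basis \<Longrightarrow> monomial ((\<lambda>_. 0)(b := k)) y = (y \<bullet> b) ^ k"
  by (simp add: mono_upd)

lemma continuous_on_even_poly: "even_poly e p \<Longrightarrow> continuous_on S p"
  by (induction rule: even_poly.induct) (auto intro!: continuous_intros)

lemma (in half_space) even_poly_dense:
  assumes f: "continuous_on {y. norm y \<le> 1 \<and> y \<bullet> e \<ge> 0} f" and "\<eta> > 0"
  obtains p where "even_poly e p" "\<And>y. norm y \<le> 1 \<Longrightarrow> y \<bullet> e \<ge> 0 \<Longrightarrow> \<bar>f y - p y\<bar> < \<eta>"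
proof -
  let ?T = "{y. norm y \<le> 1 \<and> y \<bullet> e \<ge> 0}"
  interpret function_ring_on "Collect (even_poly e)" ?T
  proof
    have "?T = cball 0 1 \<inter> {y. y \<bullet> e \<ge> 0}" by auto
    moreover have "closed {y. y \<bullet> e \<ge> 0}" by (intro closed_Collect_le continuous_intros)
    ultimately show "compact ?T" by (simp add: compact_Int_closed)
    show "(\<lambda>_. c) \<in> Collect (even_poly e)" for c
      using even_poly_monomial[of "\<lambda>_. 0" e c] by (simp add: monomial_def)
    fix x y assume xy: "x \<in> ?T" "y \<in> ?T" "x \<noteq> y"
    then obtain b where b: "b \<in> Basis" "x \<bullet> b \<noteq> y \<bullet> b" using euclidean_eqI by blast
    \<comment> \<open>The coordinate t is not in the algebra, but t^2 still separates points with t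
      \<ge> 0.\<close>
    let ?k = "if b = e then 2 else 1"
    have "even_poly e (\<lambda>y. 1 * monomial ((\<lambda>_. 0)(b := ?k)) y)"
      by (rule even_poly_monomial) auto
    moreover have "monomial ((\<lambda>_. 0)(b := ?k)) x \<noteq> monomial ((\<lambda>_. 0)(b := ?k)) y"
      using b xy unfolding monomial_single[OF b(1)] by (auto simp: power2_eq_iff)
    ultimately show "\<exists>f\<in>Collect (even_poly e). f x \<noteq> f y" by auto
  qed (auto intro: continuous_on_even_poly even_poly_add even_poly_mult)
  show ?thesis using Stone_Weierstrass_basic[OF assms] that by auto
qed

context half_space_eigen
begin

text \<open>Odd moments vanish against t * p for p uniformly close to |y|^2 U. Hence the integral of
  the nonnegative function t |y|^2 U^2 bump^3 is 0.\<close>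

lemma eigenfunction_eq_0:
  assumes mom: "\<And>\<beta>. odd (\<beta> e) \<Longrightarrow> moment 3 (monomial \<beta>) = 0"
  shows "u = (\<lambda>y. 0)"
proof -
  let ?T = "{y. norm y \<le> 1 \<and> y \<bullet> e \<ge> 0}"
  \<comment> \<open>The approximated function must be continuous on the closed half-ball, which U is
    not at the origin.\<close>
  define V where "V y = (norm y)\<^sup>2 * U y" for y
  have V: "continuous_on ?T V" unfolding V_def[abs_def] using U_small_near_boundary[of 1] by auto
  obtain CU where CU: "CU \<ge> 0" "\<And>y. \<bar>U y\<bar> \<le> CU" using U_bounded by metis
  have te: "\<bar>y \<bullet> e\<bar> \<le> norm y" for y using Basis_le_norm[OF e, of y] .
  have [measurable]: "V \<in> borel_measurable borel" "bump \<in> borel_measurable (borel :: 'a measure)"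
    unfolding V_def by (auto intro: borel_measurable_continuous_onI continuous_on_bump)
  have pmom: "moment 3 (\<lambda>y. (y \<bullet> e) * p y) = 0" if "even_poly e p" for p
    using that
  proof induction
    case (even_poly_monomial \<beta> c)
    have "(y \<bullet> e) * (c * monomial \<beta> y) = c * monomial (\<beta>(e := Suc (\<beta> e))) y" for y
      using mono_Suc[OF e, of y \<beta>] by (simp add: mult_ac)
    then have "(\<lambda>y. (y \<bullet> e) * (c * monomial \<beta> y)) = (\<lambda>y. c * monomial (\<beta>(e := Suc (\<beta> e))) y)" by blast
    then show ?case using mom[of "\<beta>(e := Suc (\<beta> e))"] even_poly_monomial by (simp only: moment_cmult) simp
  next
    case (even_poly_add p q)
    then show ?case
      by (simp add: distrib_left moment_add continuous_on_even_poly continuous_intros)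
  qed
  define Q where "Q y = U y * (((y \<bullet> e) * V y) * bump y ^ 3)" for y
  have Q_nonneg: "Q y \<ge> 0" for y
  proof (cases "y \<in> H")
    case True
    have "Q y = (U y)\<^sup>2 * ((y \<bullet> e) * (norm y)\<^sup>2 * bump y ^ 3)" by (simp add: Q_def V_def power2_eq_square mult_ac)
    then show ?thesis using True bump_bounds[of y] by (simp add: H_def)
  qed (simp add: Q_def U_eq_0)
  have V_bound: "\<bar>V y\<bar> \<le> CU" if "norm y \<le> 1" for y
    using CU that mult_mono[of "(norm y)\<^sup>2" 1 "\<bar>U y\<bar>" CU] by (simp add: V_def abs_mult power_le_one)
  have iQ: "integrable lborel Q"
  proof (rule integrable_compact_support[of _ "cball 0 1" "CU * (1 * CU * 1)"])
    show "Q \<in> borel_measurable borel" unfolding Q_def by measurable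
    show "\<bar>Q y\<bar> \<le> CU * (1 * CU * 1)" for y
    proof (cases "norm y \<le> 1")
      case True
      then show ?thesis unfolding Q_def abs_mult
        using CU V_bound[OF True] te[of y] bump_bounds[of y]
        by (intro mult_mono) (auto intro!: power_le_one mult_nonneg_nonneg simp: power_abs)
    next
      case False
      then show ?thesis using CU(1) bump_eq_0[of y] by (simp add: Q_def)
    qed
  qed (auto simp: Q_def bump_eq_0)
  have "integral\<^sup>L lborel Q = 0"
  proof (rule ccontr)
    assume "integral\<^sup>L lborel Q \<noteq> 0"
    moreover have "integral\<^sup>L lborel Q \<ge> 0" using Q_nonneg by (simp add: integral_nonneg_AE)
    ultimately have pos: "integral\<^sup>L lborel Q > 0" by simp
    \<comment> \<open>With I the integral of Q, accuracy I / B makes the approximation error at most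
      CU vol I / B; the added 1 makes this strictly less than I, contradicting that the error is all
      of I.\<close>
    define B where "B = CU * measure lborel (cball (0::'a) 1) + 1"
    have B: "B > 0" using CU(1) by (simp add: B_def add_nonneg_pos)
    obtain p where p: "even_poly e p"
      "\<And>y. norm y \<le> 1 \<Longrightarrow> y \<bullet> e \<ge> 0 \<Longrightarrow> \<bar>V y - p y\<bar> < integral\<^sup>L lborel Q / B"
      using even_poly_dense[OF V, of "integral\<^sup>L lborel Q / B"] pos B by (metis divide_pos_pos)
    let ?\<eta> = "integral\<^sup>L lborel Q / B"
    let ?P = "\<lambda>y. U y * (((y \<bullet> e) * p y) * bump y ^ 3)"
    have iP: "integrable lborel ?P"
      by (rule integrable_moment) (auto intro!: continuous_intros continuous_on_even_poly[OF p(1)])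
    have bd: "norm (Q y - ?P y) \<le> (CU * ?\<eta>) * indicat_real (cball 0 1) y" for y
    proof (cases "norm y \<le> 1 \<and> y \<in> H")
      case True
      have "\<bar>U y\<bar> * ((\<bar>y \<bullet> e\<bar> * \<bar>V y - p y\<bar>) * \<bar>bump y ^ 3\<bar>) \<le> CU * ((1 * ?\<eta>) * 1)"
        using CU True p(2)[of y] te[of y] bump_bounds[of y] pos B
        by (intro mult_mono) (auto intro!: power_le_one mult_nonneg_nonneg simp: power_abs H_def)
      moreover have "Q y - ?P y = U y * (((y \<bullet> e) * (V y - p y)) * bump y ^ 3)"
        by (simp add: Q_def algebra_simps)
      ultimately show ?thesis using True by (simp add: abs_mult)
    next
      case False
      then have "Q y - ?P y = 0" using U_eq_0[of y] bump_eq_0[of y] by (auto simp: Q_def)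
      then show ?thesis using CU pos B by simp
    qed
    have ib: "integrable lborel (\<lambda>y. (CU * ?\<eta>) * indicat_real (cball (0::'a) 1) y)"
      by (intro integrable_mult_right integrable_real_indicator emeasure_compact_finite) auto
    have "integral\<^sup>L lborel Q = (\<integral>y. Q y - ?P y \<partial>lborel)"
      using pmom[OF p(1)] iQ iP by (simp add: moment_def)
    also have "\<dots> \<le> norm (\<integral>y. Q y - ?P y \<partial>lborel)" by simp
    also have "\<dots> \<le> (\<integral>y. (CU * ?\<eta>) * indicat_real (cball (0::'a) 1) y \<partial>lborel)"
      by (rule Bochner_Integration.integral_norm_bound_integral[OF Bochner_Integration.integrable_diff[OF iQ iP] ib]) (rule bd)
    also have "\<dots> = (CU * measure lborel (cball (0::'a) 1)) * ?\<eta>" by simp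
    also have "\<dots> < B * ?\<eta>" using pos B by (intro mult_strict_right_mono) (auto simp: B_def)
    also have "\<dots> = integral\<^sup>L lborel Q" using B by simp
    finally show False by simp
  qed
  then have "AE y in lborel. Q y = 0" using iQ Q_nonneg integral_nonneg_eq_0_iff_AE[OF iQ] by simp
  then have AEQ: "AE y in lborel. y \<notin> {y \<in> H \<inter> ball 0 1. U y \<noteq> 0}"
  proof eventually_elim
    case (elim y)
    then show ?case using bump_pos[of y] H_nz[of y] by (auto simp: Q_def V_def H_def)
  qed
  \<comment> \<open>Continuity of U on H makes this null set open, hence empty.\<close>
  let ?S = "{y \<in> H \<inter> ball 0 1. U y \<noteq> 0}"
  have "?S = (H \<inter> ball 0 1) \<inter> U -` (- {0})" by auto
  moreover have "open ((H \<inter> ball 0 1) \<inter> U -` (- {0}))"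
    using open_H continuous_on_subset[OF U_continuous, of "H \<inter> ball 0 1"]
    by (intro continuous_open_preimage) auto
  ultimately have "open ?S" by simp
  moreover have "?S \<in> null_sets lborel"
  proof -
    have "?S \<in> sets lborel" using \<open>open ?S\<close> borel_open by (simp only: sets_lborel)
    then show ?thesis using AE_iff_null_sets AEQ by blast
  qed
  ultimately have "?S = {}" using open_not_negligible[of ?S] by (auto simp: negligible_iff_null_sets null_sets_completionI)
  have "U y = 0" for y
  proof (cases "y \<in> H")
    case True
    \<comment> \<open>U is constant along rays, so a point scaled into the unit ball carries the
      same value.\<close>
    let ?r = "1 / (2 * norm y)"
    have r: "?r > 0" using H_nz[OF True] by simp
    then have "?r *\<^sub>R y \<in> H \<inter> ball 0 1" using True H_scale H_nz[OF True] by simp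
    then show ?thesis using \<open>?S = {}\<close> U_scale[OF r, of y] by auto
  qed (rule U_eq_0)
  then have "u y = 0" for y
    using U_M[of y] eig by (cases "y \<in> M") (auto simp: dirichlet_eigenspace_def)
  then show ?thesis by auto
qed

end

text \<open>Functionals that separate the points of V bound its dimension. In the induction one of
  them is spent: on its kernel the others still separate, and a single vector outside the kernel
  restores V. Linearity is asked on V only, since the moments are additive only where the integrals
  exist.\<close>

lemma fun_space_span_functionals:
  fixes \<phi> :: "'i \<Rightarrow> ('a \<Rightarrow> real) \<Rightarrow> real"
  assumes "finite B" "fun_space.subspace V"
    and "\<And>b f g. b \<in> B \<Longrightarrow> f \<in> V \<Longrightarrow> g \<in> V \<Longrightarrow> \<phi> b (\<lambda>x. f x + g x) = \<phi> b f + \<phi> b g"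
    and "\<And>b f c. b \<in> B \<Longrightarrow> f \<in> V \<Longrightarrow> \<phi> b (\<lambda>x. c * f x) = c * \<phi> b f"
    and "\<And>f. f \<in> V \<Longrightarrow> (\<And>b. b \<in> B \<Longrightarrow> \<phi> b f = 0) \<Longrightarrow> f = (\<lambda>x. 0)"
  shows "\<exists>A. finite A \<and> card A \<le> card B \<and> V \<subseteq> fun_space.span A"
  using assms
proof (induction B arbitrary: V rule: finite_induct)
  case empty
  then have "V \<subseteq> {0}" by (auto simp: zero_fun_def)
  then show ?case by (intro exI[of _ "{}"]) (auto simp: fun_space.span_empty)
next
  case (insert b B)
  note add = insert.prems(2) and scale = insert.prems(3) and sub = insert.prems(1)
  have Vadd: "(\<lambda>x. f x + g x) \<in> V" if "f \<in> V" "g \<in> V" for f g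
    using fun_space.subspace_add[OF sub that] by (simp add: plus_fun_def)
  have Vscale: "(\<lambda>x. c * f x) \<in> V" if "f \<in> V" for f c
    using fun_space.subspace_scale[OF sub that] by simp
  let ?W = "{f \<in> V. \<phi> b f = 0}"
  have "fun_space.subspace ?W"
  proof (rule fun_space.subspaceI)
    have z: "0 \<in> V" using sub by (rule fun_space.subspace_0)
    then show "0 \<in> ?W" using scale[of b 0 0] by (simp add: zero_fun_def)
    show "f + g \<in> ?W" if "f \<in> ?W" "g \<in> ?W" for f g
      using that Vadd add[of b f g] by (simp add: plus_fun_def)
    show "(\<lambda>x. c * f x) \<in> ?W" if "f \<in> ?W" for c f
      using that Vscale scale[of b f c] by simp
  qed
  moreover have "f = (\<lambda>x. 0)" if "f \<in> ?W" "\<And>c. c \<in> B \<Longrightarrow> \<phi> c f = 0" for f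
    using that insert.prems(4)[of f] by auto
  ultimately obtain A where A: "finite A" "card A \<le> card B" "?W \<subseteq> fun_space.span A"
    using insert.IH[of ?W] add scale by auto
  show ?case
  proof (cases "V = ?W")
    case True
    then show ?thesis using A insert.hyps by (intro exI[of _ A]) auto
  next
    case False
    then obtain v where v: "v \<in> V" "\<phi> b v \<noteq> 0" by auto
    have "V \<subseteq> fun_space.span (insert v A)"
    proof
      fix f assume f: "f \<in> V"
      define c where "c = \<phi> b f / \<phi> b v"
      let ?w = "\<lambda>x. f x + (- c) * v x"
      have w: "?w \<in> V" by (intro Vadd f Vscale v)
      have "\<phi> b ?w = \<phi> b f + (- c) * \<phi> b v"
        using add[OF insertI1 f Vscale[OF v(1), of "- c"]] scale[OF insertI1 v(1), of "- c"] by (rule trans[OF _ arg_cong])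
      also have "\<dots> = 0" using v(2) by (simp add: c_def)
      finally have "?w \<in> ?W" using w by blast
      then have "?w \<in> fun_space.span (insert v A)"
        using A fun_space.span_mono[of A "insert v A"] by blast
      moreover have "(\<lambda>x. c * v x) \<in> fun_space.span (insert v A)"
        using fun_space.span_scale[OF fun_space.span_base[of v "insert v A"], of c] by simp
      ultimately have "?w + (\<lambda>x. c * v x) \<in> fun_space.span (insert v A)" by (rule fun_space.span_add)
      moreover have "?w + (\<lambda>x. c * v x) = f" by (auto simp: plus_fun_def)
      ultimately show "f \<in> fun_space.span (insert v A)" by simp
    qed
    then show ?thesis
      using A insert.hyps by (intro exI[of _ "insert v A"]) (auto simp: card_insert_if)
  qed
qed

section \<open>Upper bound for the multiplicities\<close>

lemma C2_on_const: "C2_on S (\<lambda>x. c)"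
  unfolding C2_on_def
  by (intro exI[of _ "\<lambda>x. 0"] exI[of _ "\<lambda>x h. 0"]) (auto simp: GDERIV_const)

lemma C2_on_inner: "C2_on S (\<lambda>x. x \<bullet> b)"
  unfolding C2_on_def
  by (intro exI[of _ "\<lambda>x. b"] exI[of _ "\<lambda>x h. 0"])
    (auto simp: gderiv_def intro!: derivative_eq_intros)

lemma C2_on_add:
  assumes "C2_on S f" "C2_on S f'"
  shows "C2_on S (\<lambda>x. f x + f' x)"
proof -
  obtain g H where 1: "\<forall>x\<in>S. (GDERIV f x :> g x) \<and> (g has_derivative H x) (at x)"
      "\<forall>h. continuous_on S (\<lambda>x. H x h)" using assms(1) unfolding C2_on_def by blast
  obtain g' H' where 2: "\<forall>x\<in>S. (GDERIV f' x :> g' x) \<and> (g' has_derivative H' x) (at x)"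
      "\<forall>h. continuous_on S (\<lambda>x. H' x h)" using assms(2) unfolding C2_on_def by blast
  show ?thesis unfolding C2_on_def
  proof (intro exI[of _ "\<lambda>x. g x + g' x"] exI[of _ "\<lambda>x h. H x h + H' x h"] conjI ballI allI)
    show "GDERIV (\<lambda>x. f x + f' x) x :> g x + g' x" if "x \<in> S" for x
      using 1 2 that by (intro GDERIV_add) auto
    show "((\<lambda>x. g x + g' x) has_derivative (\<lambda>h. H x h + H' x h)) (at x)" if "x \<in> S" for x
      using 1 2 that by (intro has_derivative_add) auto
    show "continuous_on S (\<lambda>x. H x h + H' x h)" for h
      using 1 2 by (intro continuous_on_add) auto
  qed
qed

lemma C2_on_mult:
  assumes "C2_on S f" "C2_on S f'"
  shows "C2_on S (\<lambda>x. f x * f' x)"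
proof -
  obtain g H where 1: "\<And>x. x \<in> S \<Longrightarrow> GDERIV f x :> g x" "\<And>x. x \<in> S \<Longrightarrow> (g has_derivative H x) (at x)"
      "\<And>h. continuous_on S (\<lambda>x. H x h)" using assms(1) unfolding C2_on_def by blast
  obtain g' H' where 2: "\<And>x. x \<in> S \<Longrightarrow> GDERIV f' x :> g' x" "\<And>x. x \<in> S \<Longrightarrow> (g' has_derivative H' x) (at x)"
      "\<And>h. continuous_on S (\<lambda>x. H' x h)" using assms(2) unfolding C2_on_def by blast
  have c: "continuous_on S f" "continuous_on S f'" "continuous_on S g" "continuous_on S g'"
    using 1(1,2) 2(1,2) unfolding gderiv_def continuous_on_eq_continuous_within
    by (blast intro: has_derivative_continuous continuous_at_imp_continuous_within)+
  show ?thesis unfolding C2_on_def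
  proof (intro exI[of _ "\<lambda>x. f x *\<^sub>R g' x + f' x *\<^sub>R g x"]
      exI[of _ "\<lambda>x h. (f x *\<^sub>R H' x h + (h \<bullet> g x) *\<^sub>R g' x) + (f' x *\<^sub>R H x h + (h \<bullet> g' x) *\<^sub>R g x)"] conjI ballI allI)
    show "GDERIV (\<lambda>x. f x * f' x) x :> f x *\<^sub>R g' x + f' x *\<^sub>R g x" if "x \<in> S" for x
      using 1 2 that by (intro GDERIV_mult) auto
    show "((\<lambda>x. f x *\<^sub>R g' x + f' x *\<^sub>R g x) has_derivative
        (\<lambda>h. (f x *\<^sub>R H' x h + (h \<bullet> g x) *\<^sub>R g' x) + (f' x *\<^sub>R H x h + (h \<bullet> g' x) *\<^sub>R g x))) (at x)" if "x \<in> S" for x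
      using 1(1,2)[OF that] 2(1,2)[OF that] unfolding gderiv_def
      by (intro has_derivative_add has_derivative_scaleR)
    show "continuous_on S (\<lambda>x. (f x *\<^sub>R H' x h + (h \<bullet> g x) *\<^sub>R g' x) + (f' x *\<^sub>R H x h + (h \<bullet> g' x) *\<^sub>R g x))" for h
      by (intro continuous_intros c 1 2)
  qed
qed

lemma C2_on_sum: "finite I \<Longrightarrow> (\<And>i. i \<in> I \<Longrightarrow> C2_on S (f i)) \<Longrightarrow> C2_on S (\<lambda>x. \<Sum>i\<in>I. f i x)"
  by (induction I rule: finite_induct) (auto intro!: C2_on_const C2_on_add)

lemma C2_on_power: "C2_on S f \<Longrightarrow> C2_on S (\<lambda>x. f x ^ k)"
  by (induction k) (auto intro!: C2_on_const C2_on_mult)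

lemma C2_on_prod: "finite I \<Longrightarrow> (\<And>i. i \<in> I \<Longrightarrow> C2_on S (f i)) \<Longrightarrow> C2_on S (\<lambda>x. \<Prod>i\<in>I. f i x)"
  by (induction I rule: finite_induct) (auto intro!: C2_on_const C2_on_mult)

lemma GDERIV_inverse_norm:
  "x \<noteq> 0 \<Longrightarrow> GDERIV (\<lambda>x. inverse (norm x)) x :> - (inverse (norm x) ^ 3) *\<^sub>R x"
  using GDERIV_inverse[OF GDERIV_norm, of x]
  by (simp add: sgn_div_norm power2_eq_square power3_eq_cube)

lemma C2_on_inverse_norm:
  assumes "0 \<notin> S"
  shows "C2_on S (\<lambda>x. inverse (norm x))"
  unfolding C2_on_def
proof (intro exI[of _ "\<lambda>x. - (inverse (norm x) ^ 3) *\<^sub>R x"]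
    exI[of _ "\<lambda>x h. - (inverse (norm x) ^ 3) *\<^sub>R h + (- (3 * (h \<bullet> (- (inverse (norm x) ^ 3) *\<^sub>R x)) * inverse (norm x) ^ 2)) *\<^sub>R x"] conjI ballI allI)
  fix x assume "x \<in> S"
  then have x: "x \<noteq> 0" using assms by auto
  show "GDERIV (\<lambda>x. inverse (norm x)) x :> - (inverse (norm x) ^ 3) *\<^sub>R x"
    by (rule GDERIV_inverse_norm[OF x])
  have "((\<lambda>x. inverse (norm x) ^ 3) has_derivative (\<lambda>h. 3 * (h \<bullet> (- (inverse (norm x) ^ 3) *\<^sub>R x)) * inverse (norm x) ^ 2)) (at x)"
    using has_derivative_power[OF GDERIV_inverse_norm[OF x, unfolded gderiv_def], of 3] by (simp add: mult_ac)
  from has_derivative_scaleR[OF has_derivative_minus[OF this] has_derivative_ident]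
  show "((\<lambda>x. - (inverse (norm x) ^ 3) *\<^sub>R x) has_derivative
    (\<lambda>h. - (inverse (norm x) ^ 3) *\<^sub>R h + (- (3 * (h \<bullet> (- (inverse (norm x) ^ 3) *\<^sub>R x)) * inverse (norm x) ^ 2)) *\<^sub>R x)) (at x)" .
next
  show "continuous_on S (\<lambda>x. - (inverse (norm x) ^ 3) *\<^sub>R h + (- (3 * (h \<bullet> (- (inverse (norm x) ^ 3) *\<^sub>R x)) * inverse (norm x) ^ 2)) *\<^sub>R x)" for h
    using assms by (intro continuous_intros) auto
qed

lemma C2_on_cong:
  assumes "C2_on S f" "open S" "\<And>x. x \<in> S \<Longrightarrow> f x = f' x"
  shows "C2_on S f'"
proof -
  obtain g H where 1: "\<And>x. x \<in> S \<Longrightarrow> GDERIV f x :> g x" "\<And>x. x \<in> S \<Longrightarrow> (g has_derivative H x) (at x)"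
      "\<And>h. continuous_on S (\<lambda>x. H x h)" using assms(1) unfolding C2_on_def by blast
  have "GDERIV f' x :> g x" if "x \<in> S" for x
    using has_derivative_transform_within_open[OF 1(1)[OF that, unfolded gderiv_def] assms(2) that assms(3)]
    by (simp add: gderiv_def)
  then show ?thesis unfolding C2_on_def using 1 by blast
qed

lemma laplacian_add:
  assumes "C2_on S f" "C2_on S g" "open S" "x \<in> S"
  shows "laplacian (\<lambda>x. f x + g x) x = laplacian f x + laplacian g x"
proof -
  obtain f1 f2 where f: "\<And>b. has_pd b S f (f1 b)" "\<And>b. has_pd b S (f1 b) (f2 b)"
    using assms(1) by (rule C2_on_imp_pd) blast
  obtain g1 g2 where g: "\<And>b. has_pd b S g (g1 b)" "\<And>b. has_pd b S (g1 b) (g2 b)"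
    using assms(2) by (rule C2_on_imp_pd) blast
  show ?thesis
    unfolding laplacian_eq_pd[OF f assms(3,4)] laplacian_eq_pd[OF g assms(3,4)]
      laplacian_eq_pd[OF has_pd_add[OF f(1) g(1)] has_pd_add[OF f(2) g(2)] assms(3,4)]
    by (rule sum.distrib)
qed

lemma laplacian_cmult:
  assumes "C2_on S f" "open S" "x \<in> S"
  shows "laplacian (\<lambda>x. c * f x) x = c * laplacian f x"
proof -
  obtain f1 f2 where f: "\<And>b. has_pd b S f (f1 b)" "\<And>b. has_pd b S (f1 b) (f2 b)"
    using assms(1) by (rule C2_on_imp_pd) blast
  have cm: "has_pd b S (\<lambda>y. c * h y) (\<lambda>y. c * h' y)" if "has_pd b S h h'" for b h h'
    using has_pd_mult[OF has_pd_const that, of c] by simp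
  show ?thesis
    unfolding laplacian_eq_pd[OF f assms(2,3)] laplacian_eq_pd[OF cm[OF f(1)] cm[OF f(2)] assms(2,3)]
    by (simp add: sum_distrib_left)
qed

context half_space
begin

lemma eigenspace_D:
  assumes "u \<in> dirichlet_eigenspace M \<mu>"
  shows "\<And>x. x \<notin> M \<Longrightarrow> u x = 0" "continuous_on (closure M) u" "C2_on H (u \<circ> sgn)"
    "\<And>x. x \<in> M \<Longrightarrow> laplacian (u \<circ> sgn) x + \<mu> * u x = 0"
  using assms by (auto simp: dirichlet_eigenspace_def vimage_M sphere_laplacian_def)

lemma subspace_eigenspace: "fun_space.subspace (dirichlet_eigenspace M \<mu>)"
proof (rule fun_space.subspaceI)
  have M_H: "x \<in> H" if "x \<in> M" for x using that M_subset_H by auto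
  show "0 \<in> dirichlet_eigenspace M \<mu>"
    using C2_on_const[of H 0] laplacian_cmult[OF C2_on_const[of H 0] open_H M_H, of _ 0]
    by (auto simp: dirichlet_eigenspace_def zero_fun_def comp_def vimage_M sphere_laplacian_def)
  fix u assume u: "u \<in> dirichlet_eigenspace M \<mu>"
  note uD = eigenspace_D[OF u]
  show "(\<lambda>x. c * u x) \<in> dirichlet_eigenspace M \<mu>" for c
  proof -
    have C: "C2_on H (\<lambda>x. c * (u \<circ> sgn) x)" by (intro C2_on_mult C2_on_const uD)
    have "laplacian (\<lambda>x. c * (u \<circ> sgn) x) x + \<mu> * (c * u x) = 0" if "x \<in> M" for x
    proof -
      have "laplacian (\<lambda>x. c * (u \<circ> sgn) x) x + \<mu> * (c * u x) = c * (laplacian (u \<circ> sgn) x + \<mu> * u x)"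
        unfolding laplacian_cmult[OF uD(3) open_H M_H[OF that]] by (simp add: algebra_simps)
      then show ?thesis using uD(4)[OF that] by simp
    qed
    then show ?thesis using C uD
      by (auto simp: dirichlet_eigenspace_def comp_def vimage_M sphere_laplacian_def intro!: continuous_intros)
  qed
  fix v assume v: "v \<in> dirichlet_eigenspace M \<mu>"
  note vD = eigenspace_D[OF v]
  have C: "C2_on H (\<lambda>x. (u \<circ> sgn) x + (v \<circ> sgn) x)" by (intro C2_on_add uD vD)
  have "laplacian (\<lambda>x. (u \<circ> sgn) x + (v \<circ> sgn) x) x + \<mu> * (u x + v x) = 0" if "x \<in> M" for x
    unfolding laplacian_add[OF uD(3) vD(3) open_H M_H[OF that]] using uD(4)[OF that] vD(4)[OF that]
    by (simp add: algebra_simps)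
  then show "u + v \<in> dirichlet_eigenspace M \<mu>" using C uD vD
    by (auto simp: dirichlet_eigenspace_def plus_fun_def comp_def vimage_M sphere_laplacian_def intro!: continuous_intros)
qed

text \<open>Exponents off \<open>Basis\<close> do not affect \<open>monomial\<close>. Setting them
  to 0 makes the set finite and lets a monomial determine its index.\<close>

definition multiindices :: "nat \<Rightarrow> ('a \<Rightarrow> nat) set" where
  "multiindices d = {\<gamma>. (\<forall>b. b \<notin> Basis \<longrightarrow> \<gamma> b = 0) \<and> deg \<gamma> = d}"

lemma finite_multiindices: "finite (multiindices d)"
proof (rule finite_subset)
  show "multiindices d \<subseteq> {\<gamma>. \<forall>b. (b \<in> Basis \<longrightarrow> \<gamma> b \<in> {..d}) \<and> (b \<notin> Basis \<longrightarrow> \<gamma> b = 0)}"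
    unfolding multiindices_def deg_def using member_le_sum[of _ Basis] by fastforce
  show "finite {\<gamma>. \<forall>b::'a. (b \<in> Basis \<longrightarrow> \<gamma> b \<in> {..d}) \<and> (b \<notin> Basis \<longrightarrow> \<gamma> b = 0)}"
    by (rule finite_set_of_finite_funs) auto
qed

text \<open>The separating functionals are the moments of weight 3 against the monomials linear in t
  of an exceptional degree. Leaving B open lets B = {} treat all \<mu> that have no such
  degree.\<close>

lemma eigenspace_finite_dim:
  assumes B: "finite B" and sub: "\<And>d. \<mu> = real d * (real d + real DIM('a) - 2) \<Longrightarrow> {\<gamma> \<in> multiindices d. \<gamma> e = 1} \<subseteq> B"
  shows "\<exists>A. finite A \<and> card A \<le> card B \<and> dirichlet_eigenspace M \<mu> \<subseteq> fun_space.span A"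
proof (rule fun_space_span_functionals[OF B subspace_eigenspace])
  define \<phi> where "\<phi> \<beta> u = half_space_eigen.moment u 3 (monomial \<beta>)" for \<beta> and u :: "'a \<Rightarrow> real"
  have hs: "half_space_eigen e u \<mu>" if "u \<in> dirichlet_eigenspace M \<mu>" for u
    using that by unfold_locales
  have \<phi>: "\<phi> \<beta> u = (\<integral>y. u (sgn y) * (monomial \<beta> y * bump y ^ 3) \<partial>lborel)"
     "integrable lborel (\<lambda>y. u (sgn y) * (monomial \<beta> y * bump y ^ 3))"
    if "u \<in> dirichlet_eigenspace M \<mu>" for \<beta> u
    using half_space_eigen.moment_def[OF hs[OF that]] half_space_eigen.integrable_moment[OF hs[OF that]
      continuous_on_mono[of UNIV \<beta>], of 3] half_space_eigen.U_def[OF hs[OF that]]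
    by (simp_all add: \<phi>_def)
  show "\<phi> b (\<lambda>x. f x + g x) = \<phi> b f + \<phi> b g"
    if "f \<in> dirichlet_eigenspace M \<mu>" "g \<in> dirichlet_eigenspace M \<mu>" for b f g
  proof -
    have "(\<lambda>x. f x + g x) \<in> dirichlet_eigenspace M \<mu>"
      using fun_space.subspace_add[OF subspace_eigenspace that] by (simp add: plus_fun_def)
    then show ?thesis using \<phi>[OF that(1)] \<phi>[OF that(2)] \<phi>(1) by (simp add: distrib_right)
  qed
  show "\<phi> b (\<lambda>x. c * f x) = c * \<phi> b f" if "f \<in> dirichlet_eigenspace M \<mu>" for b f c
  proof -
    have "(\<lambda>x. c * f x) \<in> dirichlet_eigenspace M \<mu>"
      using fun_space.subspace_scale[OF subspace_eigenspace that] by simp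
    then show ?thesis using \<phi>[OF that] \<phi>(1) by (simp add: mult.assoc)
  qed
  show "f = (\<lambda>x. 0)" if f: "f \<in> dirichlet_eigenspace M \<mu>" "\<And>b. b \<in> B \<Longrightarrow> \<phi> b f = 0" for f
  proof -
    interpret half_space_eigen e f \<mu> by (rule hs[OF f(1)])
    have base: "moment 3 (monomial \<beta>) = 0"
      if "\<beta> e = 1" "\<mu> = real (deg \<beta>) * (real (deg \<beta>) + real DIM('a) - 2)" for \<beta>
    proof -
      \<comment> \<open>Clearing the exponents off \<open>Basis\<close> gives an index that lies in
        \<open>multiindices\<close> and has the same monomial and degree.\<close>
      let ?\<gamma> = "\<lambda>b. if b \<in> Basis then \<beta> b else 0"
      have "deg ?\<gamma> = deg \<beta>" "monomial ?\<gamma> = monomial \<beta>" by (auto simp: deg_def monomial_def)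
      moreover have "?\<gamma> \<in> B" using sub[OF that(2)] \<open>deg ?\<gamma> = deg \<beta>\<close> that(1) e
        by (auto simp: multiindices_def)
      then have "\<phi> ?\<gamma> f = 0" by (rule f(2))
      ultimately show ?thesis by (simp add: \<phi>_def)
    qed
    show ?thesis by (rule eigenfunction_eq_0) (rule moments_eq_0[OF base])
  qed
qed

end

section \<open>Harmonic polynomials and lower bound\<close>

text \<open>Coefficients of the harmonic polynomial with part \<open>monomial \<beta>\<close> linear in \<open>t\<close> and no part
  constant in \<open>t\<close>. The second argument is the exponent of \<open>t\<close>, on which the equation
  \<open>\<Delta>P = 0\<close> is a recursion.\<close>

fun harmonic_coeff :: "'a::euclidean_space \<Rightarrow> ('a \<Rightarrow> nat) \<Rightarrow> nat \<Rightarrow> ('a \<Rightarrow> nat) \<Rightarrow> real" where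
  "harmonic_coeff e \<beta> 0 \<gamma> = 0"
| "harmonic_coeff e \<beta> (Suc 0) \<gamma> = (if \<gamma> = \<beta> then 1 else 0)"
| "harmonic_coeff e \<beta> (Suc (Suc k)) \<gamma> =
    - (\<Sum>b\<in>Basis - {e}. real ((\<gamma> b + 1) * (\<gamma> b + 2)) * harmonic_coeff e \<beta> k (\<gamma>(e := k, b := \<gamma> b + 2)))
      / real ((k + 1) * (k + 2))"

lemma harmonic_coeff_even: "even k \<Longrightarrow> harmonic_coeff e \<beta> k \<gamma> = 0"
  by (induction e \<beta> k \<gamma> rule: harmonic_coeff.induct) auto

definition pd_coeff :: "'a \<Rightarrow> (('a \<Rightarrow> nat) \<Rightarrow> real) \<Rightarrow> ('a \<Rightarrow> nat) \<Rightarrow> real" where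
  "pd_coeff b c \<delta> = real (\<delta> b + 1) * c (\<delta>(b := \<delta> b + 1))"

lemma has_pd_inverse_norm_power:
  assumes "0 \<notin> S"
  shows "has_pd b S (\<lambda>y. inverse (norm y) ^ m) (\<lambda>y. - real m * (y \<bullet> b) * inverse (norm y) ^ (m + 2))"
  unfolding has_pd_def
proof
  fix y assume "y \<in> S"
  then have y: "y \<noteq> 0" using assms by auto
  have d: "((\<lambda>t. inverse (norm (y + t *\<^sub>R b))) has_real_derivative (b \<bullet> (- (inverse (norm y) ^ 3) *\<^sub>R y))) (at 0)"
    by (rule has_derivative_imp_pd[OF GDERIV_inverse_norm[OF y, unfolded gderiv_def]])
  have "((\<lambda>t. inverse (norm (y + t *\<^sub>R b)) ^ m) has_real_derivative
      real m * ((b \<bullet> (- (inverse (norm y) ^ 3) *\<^sub>R y)) * inverse (norm (y + 0 *\<^sub>R b)) ^ (m - Suc 0))) (at 0)"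
    by (rule DERIV_power[OF d])
  moreover have "real m * ((b \<bullet> (- (inverse (norm y) ^ 3) *\<^sub>R y)) * inverse (norm (y + 0 *\<^sub>R b)) ^ (m - Suc 0))
      = - real m * (y \<bullet> b) * inverse (norm y) ^ (m + 2)"
    by (cases m) (simp_all add: power3_eq_cube inner_commute algebra_simps)
  ultimately show "((\<lambda>t. inverse (norm (y + t *\<^sub>R b)) ^ m) has_real_derivative - real m * (y \<bullet> b) * inverse (norm y) ^ (m + 2)) (at 0)"
    by (rule DERIV_cong)
qed

context half_space
begin

definition hom_poly :: "nat \<Rightarrow> (('a \<Rightarrow> nat) \<Rightarrow> real) \<Rightarrow> 'a \<Rightarrow> real" where
  "hom_poly d c y = (\<Sum>\<gamma>\<in>multiindices d. c \<gamma> * monomial \<gamma> y)"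

lemma continuous_on_hom_poly: "continuous_on S (hom_poly d c)"
  unfolding hom_poly_def[abs_def] by (intro continuous_intros)

lemma hom_poly_scale: "hom_poly d c (r *\<^sub>R y) = r ^ d * hom_poly d c y"
  unfolding hom_poly_def sum_distrib_left
  by (intro sum.cong) (auto simp: mono_scale multiindices_def)

lemma multiindices_0: "multiindices 0 = {\<lambda>_. 0}"
  by (auto simp: multiindices_def deg_def fun_eq_iff)

lemma hom_poly_0: "hom_poly 0 c y = c (\<lambda>_. 0)"
  by (simp add: hom_poly_def multiindices_0 monomial_def)

lemma multiindices_inc:
  assumes "\<delta> \<in> multiindices d" "b \<in> Basis"
  shows "\<delta>(b := \<delta> b + 1) \<in> multiindices (Suc d)"
  using assms deg_upd[OF assms(2), of \<delta> "\<delta> b + 1"] by (auto simp: multiindices_def)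

lemma multiindices_dec:
  assumes "\<gamma> \<in> multiindices (Suc d)" "b \<in> Basis" "\<gamma> b \<noteq> 0"
  shows "\<gamma>(b := \<gamma> b - 1) \<in> multiindices d"
  using assms deg_upd[OF assms(2), of \<gamma> "\<gamma> b - 1"] by (auto simp: multiindices_def)

text \<open>Lowering the exponent of b is a bijection onto the indices of degree d once those with
  exponent 0 are dropped; their terms carry the factor 0.\<close>

lemma hom_poly_pd_coeff:
  assumes b: "b \<in> Basis"
  shows "hom_poly d (pd_coeff b c) y =
    (\<Sum>\<gamma>\<in>multiindices (Suc d). c \<gamma> * (real (\<gamma> b) * monomial (\<gamma>(b := \<gamma> b - 1)) y))"
proof -
  have "(\<Sum>\<gamma>\<in>multiindices (Suc d). c \<gamma> * (real (\<gamma> b) * monomial (\<gamma>(b := \<gamma> b - 1)) y)) =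
      (\<Sum>\<gamma>\<in>{\<gamma> \<in> multiindices (Suc d). \<gamma> b \<noteq> 0}. c \<gamma> * (real (\<gamma> b) * monomial (\<gamma>(b := \<gamma> b - 1)) y))"
    by (rule sum.mono_neutral_right) (auto simp: finite_multiindices)
  also have "\<dots> = (\<Sum>\<delta>\<in>multiindices d. pd_coeff b c \<delta> * monomial \<delta> y)"
    by (rule sum.reindex_bij_witness[of _ "\<lambda>\<delta>. \<delta>(b := \<delta> b + 1)" "\<lambda>\<gamma>. \<gamma>(b := \<gamma> b - 1)"])
      (use b in \<open>auto simp: multiindices_dec[simplified] multiindices_inc[simplified] pd_coeff_def\<close>)
  finally show ?thesis by (simp add: hom_poly_def)
qed

lemma has_pd_hom_poly:
  assumes b: "b \<in> Basis"
  shows "has_pd b S (hom_poly (Suc d) c) (hom_poly d (pd_coeff b c))"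
proof -
  have "has_pd b S (\<lambda>y. \<Sum>\<gamma>\<in>multiindices (Suc d). c \<gamma> * monomial \<gamma> y)
      (\<lambda>y. \<Sum>\<gamma>\<in>multiindices (Suc d). 0 * monomial \<gamma> y + c \<gamma> * (real (\<gamma> b) * monomial (\<gamma>(b := \<gamma> b - 1)) y))"
    by (intro has_pd_sum has_pd_mult has_pd_const has_pd_mono b)
  moreover have "hom_poly d (pd_coeff b c) =
      (\<lambda>y. \<Sum>\<gamma>\<in>multiindices (Suc d). 0 * monomial \<gamma> y + c \<gamma> * (real (\<gamma> b) * monomial (\<gamma>(b := \<gamma> b - 1)) y))"
    by (rule ext) (simp only: hom_poly_pd_coeff[OF b] mult_zero_left add_0)
  ultimately show ?thesis by (simp only: hom_poly_def[of "Suc d", abs_def])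
qed

lemma euler_hom_poly:
  "(\<Sum>b\<in>Basis. (y \<bullet> b) * hom_poly d (pd_coeff b c) y) = real (Suc d) * hom_poly (Suc d) c y"
proof -
  have "(\<Sum>b\<in>Basis. (y \<bullet> b) * hom_poly d (pd_coeff b c) y) =
      (\<Sum>b\<in>Basis. \<Sum>\<gamma>\<in>multiindices (Suc d). c \<gamma> * ((y \<bullet> b) * (real (\<gamma> b) * monomial (\<gamma>(b := \<gamma> b - 1)) y)))"
    by (intro sum.cong) (auto simp: hom_poly_pd_coeff sum_distrib_left mult_ac intro!: sum.cong)
  also have "\<dots> = (\<Sum>\<gamma>\<in>multiindices (Suc d). c \<gamma> * (\<Sum>b\<in>Basis. (y \<bullet> b) * (real (\<gamma> b) * monomial (\<gamma>(b := \<gamma> b - 1)) y)))"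
    by (subst sum.swap) (simp only: sum_distrib_left)
  also have "\<dots> = (\<Sum>\<gamma>\<in>multiindices (Suc d). real (Suc d) * (c \<gamma> * monomial \<gamma> y))"
    unfolding euler_mono by (intro sum.cong) (auto simp: multiindices_def)
  finally show ?thesis by (simp only: hom_poly_def sum_distrib_left)
qed

text \<open>A function that vanishes on an open set has vanishing derivatives there. Differentiating
  along the exponents of \<gamma> leaves a positive multiple of the coefficient of \<gamma>.\<close>

lemma hom_poly_eq_0_imp:
  assumes "\<And>y. y \<in> H \<Longrightarrow> hom_poly d c y = 0" "\<gamma> \<in> multiindices d"
  shows "c \<gamma> = 0"
  using assms
proof (induction d arbitrary: c \<gamma>)
  case 0
  have "e \<in> H" using e by (simp add: H_def)
  then show ?case using 0 by (simp add: multiindices_0 hom_poly_0)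
next
  case (Suc d)
  have "deg \<gamma> \<noteq> 0" using Suc.prems by (simp add: multiindices_def)
  then obtain b where b: "b \<in> Basis" "\<gamma> b \<noteq> 0" unfolding deg_def by (meson sum.neutral)
  have "has_pd b H (hom_poly (Suc d) c) (\<lambda>y. 0)"
    by (rule has_pd_cong[OF has_pd_const[of _ _ 0] open_H]) (use Suc.prems in auto)
  then have "hom_poly d (pd_coeff b c) y = 0" if "y \<in> H" for y
    using has_pd_unique[OF has_pd_hom_poly[OF b(1)] _ that] by simp
  from Suc.IH[OF this multiindices_dec[OF Suc.prems(2) b]]
  have "pd_coeff b c (\<gamma>(b := \<gamma> b - 1)) = 0" .
  then show ?case using b(2) by (simp add: pd_coeff_def)
qed

definition restr :: "('a \<Rightarrow> real) \<Rightarrow> 'a \<Rightarrow> real" where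
  "restr f y = (if y \<in> M then f y else 0)"

lemma restr_hom_poly_sgn:
  assumes "y \<in> H"
  shows "restr (hom_poly d c) (sgn y) = inverse (norm y) ^ d * hom_poly d c y"
proof -
  have "sgn y \<in> M" using assms vimage_M by blast
  then show ?thesis by (simp add: restr_def sgn_div_norm hom_poly_scale)
qed

text \<open>For P homogeneous of degree K the radially constant extension is |y|^-K P. At |x| = 1
  its Laplacian is - K N P + K (K + 2) P - 2 K (x . grad P) + \<Delta>P, which by Euler's identity
  and \<Delta>P = 0 equals - K (K + N - 2) P. Oddness in t makes P vanish on the equator, so
  restriction by 0 stays continuous.\<close>

lemma harmonic_in_eigenspace:
  assumes odd: "\<And>\<gamma>. even (\<gamma> e) \<Longrightarrow> c \<gamma> = 0"
    and harm: "\<And>\<delta>. (\<Sum>b\<in>Basis. pd_coeff b (pd_coeff b c) \<delta>) = 0"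
    and \<mu>: "\<mu> = real (Suc d) * (real (Suc d) + real DIM('a) - 2)"
  shows "restr (hom_poly (Suc d) c) \<in> dirichlet_eigenspace M \<mu>"
proof -
  let ?P = "hom_poly (Suc d) c" and ?K = "real (Suc d)"
  let ?\<rho> = "\<lambda>m y. inverse (norm (y::'a)) ^ m"
  let ?f = "\<lambda>y. ?\<rho> (Suc d) y * ?P y"
  have H0: "0 \<notin> H" by (simp add: H_def)
  have eq: "(restr ?P \<circ> sgn) y = ?f y" if "y \<in> H" for y
    using restr_hom_poly_sgn[OF that] by simp
  have "continuous_on (closure M) (restr ?P)"
  proof -
    have "M \<subseteq> {y. norm y = 1 \<and> y \<bullet> e \<ge> 0}" by (auto simp: M_def)
    moreover have "closed {y. norm y = 1 \<and> y \<bullet> e \<ge> 0}"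
      by (intro closed_Collect_conj closed_Collect_eq closed_Collect_le continuous_intros)
    ultimately have cl: "closure M \<subseteq> {y. norm y = 1 \<and> y \<bullet> e \<ge> 0}" by (rule closure_minimal)
    have "?P y = restr ?P y" if "y \<in> closure M" for y
    proof (cases "y \<in> M")
      case False
      then have "y \<bullet> e = 0" using that cl by (force simp: M_def)
      have "c \<gamma> * monomial \<gamma> y = 0" for \<gamma>
      proof (cases "even (\<gamma> e)")
        case False
        then have "\<gamma> e \<noteq> 0" by (metis even_zero)
        then have "monomial \<gamma> y = 0" using \<open>y \<bullet> e = 0\<close> mono_split[OF e, of \<gamma> y] by simp
        then show ?thesis by simp
      qed (use odd in simp)
      then have "?P y = 0" unfolding hom_poly_def by (intro sum.neutral) blast
      then show ?thesis using False by (simp add: restr_def)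
    qed (simp add: restr_def)
    then show ?thesis using continuous_on_cong[OF refl] continuous_on_hom_poly by blast
  qed
  moreover have "C2_on H (restr ?P \<circ> sgn)"
  proof (rule C2_on_cong[OF _ open_H])
    show "C2_on H ?f"
      unfolding hom_poly_def monomial_def
      by (intro C2_on_mult C2_on_power C2_on_inverse_norm[OF H0] C2_on_sum C2_on_prod C2_on_const C2_on_inner)
        (auto simp: finite_multiindices)
  qed (use eq in auto)
  moreover have "sphere_laplacian (restr ?P) x + \<mu> * restr ?P x = 0" if x: "x \<in> M" for x
  proof -
    have xH: "x \<in> H" and nx: "norm x = 1" using x M_subset_H by (auto simp: M_def)
    define P1 where "P1 b = hom_poly d (pd_coeff b c)" for b
    \<comment> \<open>For d = 0 the first derivatives are constant; \<open>d - 1\<close> would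
      truncate to 0, so this case is set to 0 by hand.\<close>
    define P2 where "P2 b y = (if d = 0 then 0 else hom_poly (d - 1) (pd_coeff b (pd_coeff b c)) y)" for b y
    have p1: "has_pd b H ?P (P1 b)" if "b \<in> Basis" for b
      unfolding P1_def by (rule has_pd_hom_poly[OF that])
    have p2: "has_pd b H (P1 b) (P2 b)" if "b \<in> Basis" for b
    proof (cases d)
      case 0
      then show ?thesis by (simp add: P1_def P2_def[abs_def] hom_poly_0[abs_def] has_pd_const)
    next
      case (Suc k)
      then show ?thesis using has_pd_hom_poly[OF that, of H k] by (simp add: P1_def P2_def[abs_def])
    qed
    have sum2: "(\<Sum>b\<in>Basis. P2 b x) = 0"
    proof (cases d)
      case (Suc k)
      have "(\<Sum>b\<in>Basis. P2 b x) = (\<Sum>\<gamma>\<in>multiindices k. (\<Sum>b\<in>Basis. pd_coeff b (pd_coeff b c) \<gamma>) * monomial \<gamma> x)"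
        using Suc by (simp add: P2_def hom_poly_def sum_distrib_right) (rule sum.swap)
      then show ?thesis using harm by simp
    qed (simp add: P2_def)
    note \<rho> = has_pd_inverse_norm_power[OF H0]
    let ?f1 = "\<lambda>b y. (- ?K * (y \<bullet> b) * ?\<rho> (Suc d + 2) y) * ?P y + ?\<rho> (Suc d) y * P1 b y"
    let ?f2 = "\<lambda>b y. (((0 * (y \<bullet> b) + - ?K * (b \<bullet> b)) * ?\<rho> (Suc d + 2) y
          + - ?K * (y \<bullet> b) * (- real (Suc d + 2) * (y \<bullet> b) * ?\<rho> (Suc d + 2 + 2) y)) * ?P y
          + (- ?K * (y \<bullet> b) * ?\<rho> (Suc d + 2) y) * P1 b y)
        + ((- ?K * (y \<bullet> b) * ?\<rho> (Suc d + 2) y) * P1 b y + ?\<rho> (Suc d) y * P2 b y)"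
    have f1: "has_pd b H ?f (?f1 b)" if "b \<in> Basis" for b
      by (intro has_pd_mult \<rho> p1 that)
    have f2: "has_pd b H (?f1 b) (?f2 b)" if "b \<in> Basis" for b
      by (intro has_pd_add has_pd_mult has_pd_const has_pd_inner \<rho> p1 p2 that)
    have F1: "has_pd b H (restr ?P \<circ> sgn) (?f1 b)" if "b \<in> Basis" for b
      by (rule has_pd_cong[OF f1[OF that] open_H]) (use eq in auto)
    have "sphere_laplacian (restr ?P) x = (\<Sum>b\<in>Basis. ?f2 b x)"
      unfolding sphere_laplacian_def by (rule laplacian_eq_pd[OF F1 f2 open_H xH])
    also have "\<dots> = (\<Sum>b\<in>Basis. - ?K * ?P x + ?K * real (Suc d + 2) * ?P x * ((x \<bullet> b) * (x \<bullet> b))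
        - 2 * ?K * ((x \<bullet> b) * P1 b x) + P2 b x)"
      by (intro sum.cong) (auto simp: nx algebra_simps)
    also have "\<dots> = real DIM('a) * (- ?K * ?P x) + ?K * real (Suc d + 2) * ?P x * (\<Sum>b\<in>Basis. (x \<bullet> b) * (x \<bullet> b))
        - 2 * ?K * (\<Sum>b\<in>Basis. (x \<bullet> b) * P1 b x) + (\<Sum>b\<in>Basis. P2 b x)"
      by (simp only: sum.distrib sum_subtractf sum_distrib_left sum_constant)
    also have "(\<Sum>b\<in>Basis. (x \<bullet> b) * (x \<bullet> b)) = 1"
      using euclidean_inner[of x x] nx by (simp add: norm_eq_1)
    also have "(\<Sum>b\<in>Basis. (x \<bullet> b) * P1 b x) = ?K * ?P x" unfolding P1_def by (rule euler_hom_poly)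
    finally have "sphere_laplacian (restr ?P) x = - \<mu> * ?P x"
      unfolding sum2 \<mu> by (simp add: algebra_simps)
    then show ?thesis using x by (simp add: restr_def[of _ x])
  qed
  moreover have "restr ?P x = 0" if "x \<notin> M" for x using that by (simp add: restr_def)
  ultimately show ?thesis by (auto simp: dirichlet_eigenspace_def vimage_M)
qed

text \<open>The recursion fixes the coefficient two steps higher in t exactly so that the second
  derivative along e cancels all the others.\<close>

lemma harmonic_coeff_harmonic:
  "(\<Sum>b\<in>Basis. pd_coeff b (pd_coeff b (\<lambda>\<gamma>. harmonic_coeff e \<beta> (\<gamma> e) \<gamma>)) \<delta>) = 0"
proof -
  let ?c = "\<lambda>\<gamma>. harmonic_coeff e \<beta> (\<gamma> e) \<gamma>"
  have 2: "pd_coeff b (pd_coeff b c) \<delta> = real ((\<delta> b + 1) * (\<delta> b + 2)) * c (\<delta>(b := \<delta> b + 2))" for b c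
    by (simp add: pd_coeff_def algebra_simps)
  define s where "s = (\<Sum>b\<in>Basis - {e}. real ((\<delta> b + 1) * (\<delta> b + 2)) * harmonic_coeff e \<beta> (\<delta> e) (\<delta>(b := \<delta> b + 2)))"
  have "(\<Sum>b\<in>Basis - {e}. pd_coeff b (pd_coeff b ?c) \<delta>) = s"
    unfolding s_def 2 by (intro sum.cong) auto
  moreover have "pd_coeff e (pd_coeff e ?c) \<delta> = - s"
  proof -
    have "(\<Sum>b\<in>Basis - {e}. real (((\<delta>(e := \<delta> e + 2)) b + 1) * ((\<delta>(e := \<delta> e + 2)) b + 2)) *
        harmonic_coeff e \<beta> (\<delta> e) ((\<delta>(e := \<delta> e + 2))(e := \<delta> e, b := (\<delta>(e := \<delta> e + 2)) b + 2))) = s"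
      unfolding s_def by (intro sum.cong) auto
    then have c2: "?c (\<delta>(e := \<delta> e + 2)) = - s / real ((\<delta> e + 1) * (\<delta> e + 2))" by simp
    have cancel: "a * (- s / a) = - s" if "a \<noteq> 0" for a :: real using that by simp
    have "pd_coeff e (pd_coeff e ?c) \<delta> = real ((\<delta> e + 1) * (\<delta> e + 2)) * (- s / real ((\<delta> e + 1) * (\<delta> e + 2)))"
      unfolding 2 c2 ..
    also have "\<dots> = - s" by (rule cancel) (simp del: of_nat_mult)
    finally show ?thesis .
  qed
  ultimately show ?thesis using e by (simp add: sum.remove[of Basis e])
qed

definition harmonic :: "nat \<Rightarrow> ('a \<Rightarrow> nat) \<Rightarrow> 'a \<Rightarrow> real" where
  "harmonic d \<beta> = restr (hom_poly d (\<lambda>\<gamma>. harmonic_coeff e \<beta> (\<gamma> e) \<gamma>))"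

text \<open>These indices serve twice: for the functionals of the upper bound and for the harmonic
  polynomials of the lower bound.\<close>

definition lin_multiindices :: "nat \<Rightarrow> ('a \<Rightarrow> nat) set" where
  "lin_multiindices d = {\<gamma> \<in> multiindices d. \<gamma> e = 1}"

lemma finite_lin_multiindices: "finite (lin_multiindices d)"
  unfolding lin_multiindices_def using finite_multiindices by auto

lemma lin_multiindices_0: "lin_multiindices 0 = {}"
  by (auto simp: lin_multiindices_def multiindices_0)

text \<open>Among indices linear in t, the harmonic polynomial of \<beta> has coefficient 1 at
  \<beta> and 0 elsewhere. The coefficient at \<gamma> of a linear combination is therefore
  \<open>a \<gamma>\<close>, and it vanishes with the polynomial on H.\<close>

lemma harmonic_independent:
  assumes "\<And>x. (\<Sum>\<beta>\<in>lin_multiindices d. a \<beta> * harmonic d \<beta> x) = 0" "\<gamma> \<in> lin_multiindices d"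
  shows "a \<gamma> = 0"
proof -
  define c where "c \<delta> = (\<Sum>\<beta>\<in>lin_multiindices d. a \<beta> * harmonic_coeff e \<beta> (\<delta> e) \<delta>)" for \<delta>
  have c: "hom_poly d c y = (\<Sum>\<beta>\<in>lin_multiindices d. a \<beta> * hom_poly d (\<lambda>\<gamma>. harmonic_coeff e \<beta> (\<gamma> e) \<gamma>) y)" for y
    unfolding hom_poly_def c_def sum_distrib_left sum_distrib_right
    by (subst sum.swap) (simp add: mult.assoc)
  have "hom_poly d c y = 0" if y: "y \<in> H" for y
  proof -
    have "0 = (\<Sum>\<beta>\<in>lin_multiindices d. a \<beta> * harmonic d \<beta> (sgn y))" using assms(1) by simp
    also have "\<dots> = inverse (norm y) ^ d * hom_poly d c y"
      unfolding harmonic_def restr_hom_poly_sgn[OF y] c sum_distrib_left by (simp add: mult_ac)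
    finally show ?thesis using H_nz[OF y] by simp
  qed
  then have "c \<gamma> = 0"
    by (rule hom_poly_eq_0_imp) (use assms(2) in \<open>simp_all add: lin_multiindices_def\<close>)
  moreover have "c \<gamma> = (\<Sum>\<beta>\<in>lin_multiindices d. if \<beta> = \<gamma> then a \<beta> else 0)"
    unfolding c_def by (intro sum.cong) (use assms(2) in \<open>auto simp: lin_multiindices_def\<close>)
  ultimately show ?thesis using assms(2) finite_lin_multiindices by simp
qed

text \<open>For a given \<mu> at most one degree is exceptional, so
  \<open>lin_multiindices d\<close> alone is a sufficient set of functionals.\<close>

lemma eigenvalue_inj:
  assumes "real d * (real d + real DIM('a) - 2) = real d' * (real d' + real DIM('a) - 2)" "DIM('a) \<ge> 2"
  shows "d = d'"
proof -
  have sm: "strict_mono (\<lambda>d::nat. real d * (real d + real DIM('a) - 2))"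
    unfolding strict_mono_Suc_iff using assms(2) by (auto simp: algebra_simps intro: add_pos_nonneg)
  show ?thesis using strict_mono_eq[OF sm, of d d'] assms(1) by simp
qed

text \<open>Moments bound the dimension from above, harmonic polynomials from below. The degree d =
  0 is included: it has no index linear in t, so \<mu> = 0 gets dimension 0.\<close>

lemma dim_eigenspace:
  assumes \<mu>: "\<mu> = real d * (real d + real DIM('a) - 2)" and N: "DIM('a) \<ge> 2"
  shows "\<exists>A. finite A \<and> dirichlet_eigenspace M \<mu> \<subseteq> fun_space.span A"
    and "fun_space.dim (dirichlet_eigenspace M \<mu>) = card (lin_multiindices d)"
proof -
  let ?V = "dirichlet_eigenspace M \<mu>" and ?B = "lin_multiindices d"
  have "\<exists>A. finite A \<and> card A \<le> card ?B \<and> ?V \<subseteq> fun_space.span A"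
    by (rule eigenspace_finite_dim[OF finite_lin_multiindices])
      (use eigenvalue_inj[OF _ N] \<mu> in \<open>auto simp: lin_multiindices_def\<close>)
  then obtain A where A: "finite A" "card A \<le> card ?B" "?V \<subseteq> fun_space.span A" by blast
  then show "\<exists>A. finite A \<and> ?V \<subseteq> fun_space.span A" by blast
  have "fun_space.dim ?V \<le> card ?B" using fun_space.dim_le_card[OF A(3,1)] A(2) by simp
  moreover have "card ?B \<le> fun_space.dim ?V"
  proof (cases d)
    case 0
    then show ?thesis by (simp add: lin_multiindices_0)
  next
    case (Suc k)
    have sub: "harmonic d ` ?B \<subseteq> ?V"
      unfolding harmonic_def Suc
      by (intro image_subsetI harmonic_in_eigenspace harmonic_coeff_harmonic harmonic_coeff_even)
        (use \<mu> Suc in auto)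
    have inj: "inj_on (harmonic d) ?B"
    proof (rule inj_onI, rule ccontr)
      fix \<beta> \<beta>' assume \<beta>: "\<beta> \<in> ?B" "\<beta>' \<in> ?B" "harmonic d \<beta> = harmonic d \<beta>'" "\<beta> \<noteq> \<beta>'"
      \<comment> \<open>If two indices gave the same function, the coefficients 1 and -1 would form
        a nontrivial relation.\<close>
      define a where "a \<gamma> = (if \<gamma> = \<beta> then 1 else 0) + (if \<gamma> = \<beta>' then - 1 else 0 :: real)" for \<gamma>
      have "(\<Sum>\<gamma>\<in>?B. a \<gamma> * harmonic d \<gamma> x) = 0" for x
      proof -
        have "(\<Sum>\<gamma>\<in>?B. a \<gamma> * harmonic d \<gamma> x) =
            (\<Sum>\<gamma>\<in>?B. if \<gamma> = \<beta> then harmonic d \<gamma> x else 0) + (\<Sum>\<gamma>\<in>?B. if \<gamma> = \<beta>' then - harmonic d \<gamma> x else 0)"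
          unfolding sum.distrib[symmetric] by (intro sum.cong) (auto simp: a_def)
        then show ?thesis using \<beta> finite_lin_multiindices by simp
      qed
      from harmonic_independent[OF this \<beta>(1)] show False using \<beta>(4) by (simp add: a_def)
    qed
    have ind: "fun_space.independent (harmonic d ` ?B)"
    proof
      assume "fun_space.dependent (harmonic d ` ?B)"
      then obtain a where a: "\<exists>v\<in>harmonic d ` ?B. a v \<noteq> 0" "(\<Sum>v\<in>harmonic d ` ?B. (\<lambda>x. a v * v x)) = 0"
        using fun_space.dependent_finite[of "harmonic d ` ?B"] finite_lin_multiindices by auto
      have sumf: "(\<Sum>v\<in>S. f v) x = (\<Sum>v\<in>S. f v x)" for f :: "('a \<Rightarrow> real) \<Rightarrow> 'a \<Rightarrow> real" and S x
        by (induction S rule: infinite_finite_induct) (auto simp: zero_fun_def plus_fun_def)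
      have "(\<Sum>\<beta>\<in>?B. a (harmonic d \<beta>) * harmonic d \<beta> x) = 0" for x
      proof -
        have "(\<Sum>v\<in>harmonic d ` ?B. a v * v x) = 0"
          using fun_cong[OF a(2), of x] by (simp only: sumf zero_fun_def)
        then show ?thesis by (simp add: sum.reindex[OF inj])
      qed
      from harmonic_independent[OF this] show False using a(1) by auto
    qed
    obtain B' where B': "B' \<subseteq> ?V" "fun_space.independent B'" "?V \<subseteq> fun_space.span B'" "card B' = fun_space.dim ?V"
      using fun_space.basis_exists by blast
    have "finite B'" using fun_space.independent_span_bound[OF A(1) B'(2)] B'(1) A(3) by blast
    then have "card (harmonic d ` ?B) \<le> card B'"
      using fun_space.independent_span_bound[OF _ ind] sub B'(3) by blast
    then show ?thesis using B'(4) card_image[OF inj] by simp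
  qed
  ultimately show "fun_space.dim ?V = card ?B" by simp
qed

lemma dim_eigenspace_0:
  assumes "\<And>d. \<mu> \<noteq> real d * (real d + real DIM('a) - 2)"
  shows "\<exists>A. finite A \<and> dirichlet_eigenspace M \<mu> \<subseteq> fun_space.span A"
    and "fun_space.dim (dirichlet_eigenspace M \<mu>) = 0"
proof -
  have "\<exists>A. finite A \<and> card A \<le> card ({} :: ('a \<Rightarrow> nat) set) \<and> dirichlet_eigenspace M \<mu> \<subseteq> fun_space.span A"
    by (rule eigenspace_finite_dim) (use assms in auto)
  then obtain A where A: "finite A" "card A = 0" "dirichlet_eigenspace M \<mu> \<subseteq> fun_space.span A" by auto
  then show "\<exists>A. finite A \<and> dirichlet_eigenspace M \<mu> \<subseteq> fun_space.span A" by blast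
  show "fun_space.dim (dirichlet_eigenspace M \<mu>) = 0"
    using fun_space.dim_le_card[OF A(3,1)] A(2) by simp
qed

text \<open>Stars and bars: with the exponent of t fixed at 1, the remaining exponents are a list of
  length N - 1 with sum K - 1.\<close>

lemma card_lin_multiindices:
  assumes "DIM('a) \<ge> 2" "K \<ge> 1"
  shows "card (lin_multiindices K) = chain_mult (DIM('a) - 1) K"
proof -
  let ?n = "DIM('a) - 1"
  obtain bs where bs: "set bs = Basis - {e}" "distinct bs"
    using finite_distinct_list[of "Basis - {e}"] by auto
  have len: "length bs = ?n" using distinct_card[OF bs(2)] bs(1) e by simp
  have deg: "deg \<gamma> = \<gamma> e + sum_list (map \<gamma> bs)" for \<gamma>
    unfolding deg_def using e bs by (simp add: sum.remove[of Basis e] sum_list_distinct_conv_sum_set)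
  have "bij_betw (\<lambda>\<gamma>. map \<gamma> bs) (lin_multiindices K) {l. length l = ?n \<and> sum_list l = K - 1}"
  proof (rule bij_betw_imageI)
    show "inj_on (\<lambda>\<gamma>. map \<gamma> bs) (lin_multiindices K)"
    proof (rule inj_onI, rule ext)
      fix \<gamma> \<delta> b assume *: "\<gamma> \<in> lin_multiindices K" "\<delta> \<in> lin_multiindices K" "map \<gamma> bs = map \<delta> bs"
      then have "\<forall>b\<in>Basis - {e}. \<gamma> b = \<delta> b" using bs(1) by (simp add: map_eq_conv)
      then show "\<gamma> b = \<delta> b" using * by (cases "b \<in> Basis"; cases "b = e") (auto simp: lin_multiindices_def multiindices_def)
    qed
    show "(\<lambda>\<gamma>. map \<gamma> bs) ` lin_multiindices K = {l. length l = ?n \<and> sum_list l = K - 1}"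
    proof (intro equalityI image_subsetI subsetI)
      fix \<gamma> assume "\<gamma> \<in> lin_multiindices K"
      then show "map \<gamma> bs \<in> {l. length l = ?n \<and> sum_list l = K - 1}"
        using deg[of \<gamma>] len by (auto simp: lin_multiindices_def multiindices_def)
    next
      fix l :: "nat list" assume l: "l \<in> {l. length l = ?n \<and> sum_list l = K - 1}"
      define \<gamma> where "\<gamma> b = (if b = e then 1 else case map_of (zip bs l) b of None \<Rightarrow> 0 | Some k \<Rightarrow> k)" for b
      have "map \<gamma> bs = l"
      proof (rule nth_equalityI)
        show "length (map \<gamma> bs) = length l" using l len by simp
        fix i assume i: "i < length (map \<gamma> bs)"
        then have "bs ! i \<noteq> e" using bs(1) nth_mem[of i bs] by auto
        then show "map \<gamma> bs ! i = l ! i"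
          using i l len bs(2) by (simp add: \<gamma>_def map_of_zip_nth)
      qed
      moreover have "\<gamma> b = 0" if "b \<notin> Basis" for b
      proof -
        have "b \<notin> set bs" "b \<noteq> e" using that bs(1) e by auto
        then have "map_of (zip bs l) b = None" using l len by (simp add: map_of_zip_is_None)
        then show ?thesis using \<open>b \<noteq> e\<close> by (simp add: \<gamma>_def)
      qed
      then have "\<gamma> \<in> lin_multiindices K"
        using deg[of \<gamma>] l assms(2) \<open>map \<gamma> bs = l\<close> by (auto simp: lin_multiindices_def multiindices_def \<gamma>_def)
      ultimately show "l \<in> (\<lambda>\<gamma>. map \<gamma> bs) ` lin_multiindices K" by blast
    qed
  qed
  then have "card (lin_multiindices K) = card {l. length l = ?n \<and> sum_list l = K - 1}"
    by (rule bij_betw_same_card)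
  also have "\<dots> = (K - 1 + ?n - 1) choose (K - 1)" by (rule card_length_sum_list)
  also have "\<dots> = chain_mult ?n K"
  proof -
    define m where "m = DIM('a) - 2"
    define j where "j = K - 1"
    have mj: "?n = Suc m" "K = Suc j" using assms by (simp_all add: m_def j_def)
    show ?thesis
      using binomial_symmetric[of j "j + m"] unfolding mj chain_mult_def by (simp add: add.commute)
  qed
  finally show ?thesis .
qed

end

section \<open>The eigenvalues and their asymptotics\<close>

lemma k_plus_Suc: "k_plus n (Suc K) = k_plus n K + chain_mult n (Suc K)"
  by (simp add: k_plus_def)

lemma k_plus_0: "k_plus n 0 = 0"
  by (simp add: k_plus_def)

lemma chain_mult_pos: "n \<ge> 1 \<Longrightarrow> K \<ge> 1 \<Longrightarrow> chain_mult n K > 0"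
  by (simp add: chain_mult_def)

lemma strict_mono_k_plus: "n \<ge> 1 \<Longrightarrow> strict_mono (k_plus n)"
  unfolding strict_mono_Suc_iff k_plus_Suc using chain_mult_pos by simp

text \<open>The hockey-stick identity, with Pascal's rule as induction step.\<close>

lemma k_plus_eq_binomial:
  assumes "n \<ge> 1"
  shows "k_plus n K = (n + K - 1) choose n"
proof (induction K)
  case 0
  then show ?case using assms by (simp add: k_plus_0)
next
  case (Suc K)
  obtain m where m: "n = Suc m" using assms by (cases n) auto
  show ?case using Suc unfolding k_plus_Suc chain_mult_def m by simp
qed

definition chain_level :: "nat \<Rightarrow> nat \<Rightarrow> real" where
  "chain_level n K = real K * (real K + real n - 1)"

lemma strict_mono_chain_level:
  assumes "n \<ge> 1"
  shows "strict_mono (chain_level n)"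
  unfolding strict_mono_Suc_iff chain_level_def using assms by (auto simp: algebra_simps intro: add_pos_nonneg)

lemma fact_k_plus:
  assumes "n \<ge> 1" "K \<ge> 1"
  shows "fact n * real (k_plus n K) = (\<Prod>j<n. real K + real j)"
proof -
  have "real (k_plus n K) = real (n + K - 1) gchoose n"
    unfolding k_plus_eq_binomial[OF assms(1)] by (rule binomial_gbinomial)
  also have "\<dots> = pochhammer (real (n + K - 1) - real n + 1) n / fact n"
    by (rule gbinomial_pochhammer')
  also have "real (n + K - 1) - real n + 1 = real K" using assms by (simp add: of_nat_diff)
  finally show ?thesis by (simp add: pochhammer_prod lessThan_atLeast0)
qed

definition chain_shift :: "nat \<Rightarrow> nat \<Rightarrow> real" where
  "chain_shift n j = real j * (real n - 1 - real j)"

lemma chain_shift_nonneg: "j < n \<Longrightarrow> chain_shift n j \<ge> 0"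
  by (simp add: chain_shift_def)

lemma sum_chain_shift: "(\<Sum>j<n. chain_shift n j) = real n * ((real n - 1) * (real n - 2) / 6)"
proof -
  \<comment> \<open>The number of terms is decoupled from the parameter n - 1 of the summand, since
    the induction may vary only the former.\<close>
  have gen: "(\<Sum>j<k. real j * (x - real j)) = (real k - 1) * real k * (3 * x - 2 * real k + 1) / 6" for k x
    by (induction k) (auto simp: field_simps)
  have "(\<Sum>j<n. chain_shift n j) = (real n - 1) * real n * (3 * (real n - 1) - 2 * real n + 1) / 6"
    unfolding chain_shift_def by (rule gen)
  also have "3 * (real n - 1) - 2 * real n + 1 = real n - 2" by simp
  finally show ?thesis by simp
qed

text \<open>Pairing the factors \<open>K + j\<close> and \<open>K + n - 1 - j\<close>.\<close>

lemma weyl_term_eq: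
  assumes n: "n \<ge> 1" and K: "K \<ge> 1"
  shows "fact n powr (2 / real n) * real (k_plus n K) powr (2 / real n) =
    (\<Prod>j<n. chain_level n K + chain_shift n j) powr (1 / real n)"
proof -
  let ?P = "\<Prod>j<n. real K + real j"
  have P: "?P > 0" using K by (intro prod_pos) auto
  have "fact n powr (2 / real n) * real (k_plus n K) powr (2 / real n) = ?P powr (2 / real n)"
    by (simp add: fact_k_plus[OF n K, symmetric] powr_mult)
  also have "\<dots> = (?P powr 2) powr (1 / real n)" by (simp add: powr_powr)
  also have "?P powr 2 = ?P * ?P" using P by (simp add: power2_eq_square)
  also have "\<dots> = ?P * (\<Prod>j<n. real K + real (n - Suc j))"
    using prod.nat_diff_reindex[of "\<lambda>j. real K + real j" n] by simp
  also have "\<dots> = (\<Prod>j<n. (real K + real j) * (real K + real (n - Suc j)))" by (rule prod.distrib[symmetric])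
  also have "\<dots> = (\<Prod>j<n. chain_level n K + chain_shift n j)"
    by (intro prod.cong) (auto simp: chain_level_def chain_shift_def of_nat_diff algebra_simps)
  finally show ?thesis .
qed

lemma powr_inverse_eq_exp_mean_ln:
  assumes "\<And>j. j < n \<Longrightarrow> x j > (0::real)"
  shows "(\<Prod>j<n. x j) powr (1 / real n) = exp ((\<Sum>j<n. ln (x j)) / real n)"
proof -
  define P where "P = (\<Prod>j<n. x j)"
  have "P > 0" unfolding P_def using assms by (intro prod_pos) auto
  moreover have "ln P = (\<Sum>j<n. ln (x j))" unfolding P_def using assms by (intro ln_prod) force+
  ultimately show ?thesis unfolding P_def[symmetric] by (simp add: powr_def)
qed

text \<open>The logarithm lies below its tangent at the arithmetic mean A, and the linear terms
  cancel in the sum.\<close>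

lemma geometric_mean_le:
  assumes n: "n \<ge> 1" and x: "\<And>j. j < n \<Longrightarrow> x j > (0::real)"
  shows "(\<Prod>j<n. x j) powr (1 / real n) \<le> (\<Sum>j<n. x j) / real n"
proof -
  define A where "A = (\<Sum>j<n. x j) / real n"
  have A: "A > 0" unfolding A_def using n x by (intro divide_pos_pos sum_pos) (auto simp: lessThan_empty_iff)
  have "ln (x j) \<le> ln A + (x j / A - 1)" if "j < n" for j
    using ln_le_minus_one[of "x j / A"] x[OF that] A by (simp add: ln_div)
  then have "(\<Sum>j<n. ln (x j)) \<le> (\<Sum>j<n. ln A + (x j / A - 1))" by (intro sum_mono) auto
  also have "\<dots> = real n * ln A + ((\<Sum>j<n. x j) / A - real n)"
    by (simp add: sum.distrib sum_subtractf sum_divide_distrib)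
  also have "(\<Sum>j<n. x j) / A = real n" using A n unfolding A_def by (auto simp: field_simps)
  finally have "(\<Sum>j<n. ln (x j)) / real n \<le> ln A" using n by (simp add: field_simps)
  then have "exp ((\<Sum>j<n. ln (x j)) / real n) \<le> A" using A by (metis exp_le_cancel_iff exp_ln)
  then show ?thesis using powr_inverse_eq_exp_mean_ln[of n x] x by (simp add: A_def)
qed

text \<open>A converse with error of order 1/L when c is fixed and L large. It combines ln (1 + x)
  \<ge> x - x^2 at x = c j / L, where c j \<le> L gives x \<le> 1, with exp x \<ge> 1 + x.\<close>

lemma geometric_mean_ge:
  assumes n: "n \<ge> 1" and c: "\<And>j. j < n \<Longrightarrow> c j \<ge> 0" "\<And>j. j < n \<Longrightarrow> c j \<le> L" and L: "L > (0::real)"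
  shows "(\<Prod>j<n. L + c j) powr (1 / real n) \<ge> L + (\<Sum>j<n. c j) / real n - (\<Sum>j<n. (c j)\<^sup>2) / real n / L"
proof -
  define a where "a = (\<Sum>j<n. c j) / real n"
  define D where "D = (\<Sum>j<n. (c j)\<^sup>2) / real n"
  have "ln L + (c j / L - (c j / L)\<^sup>2) \<le> ln (L + c j)" if "j < n" for j
  proof -
    have "c j / L - (c j / L)\<^sup>2 \<le> ln (1 + c j / L)"
      using c[OF that] L by (intro ln_one_plus_pos_lower_bound) auto
    also have "1 + c j / L = (L + c j) / L" using L by (simp add: field_simps)
    also have "ln ((L + c j) / L) = ln (L + c j) - ln L" using L c(1)[OF that] by (simp add: ln_div add_pos_nonneg)
    finally show ?thesis by simp
  qed
  then have "(\<Sum>j<n. ln L + (c j / L - (c j / L)\<^sup>2)) \<le> (\<Sum>j<n. ln (L + c j))" by (intro sum_mono) auto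
  moreover have "(\<Sum>j<n. ln L + (c j / L - (c j / L)\<^sup>2)) = real n * (ln L + (a / L - D / L\<^sup>2))"
    using n by (simp add: sum.distrib sum_subtractf a_def D_def sum_divide_distrib[symmetric] power_divide field_simps)
  ultimately have "ln L + (a / L - D / L\<^sup>2) \<le> (\<Sum>j<n. ln (L + c j)) / real n"
    using n by (simp add: field_simps)
  then have "exp (ln L + (a / L - D / L\<^sup>2)) \<le> exp ((\<Sum>j<n. ln (L + c j)) / real n)" by simp
  moreover have "exp (ln L + (a / L - D / L\<^sup>2)) = L * exp (a / L - D / L\<^sup>2)" using L by (simp add: exp_add)
  moreover have "L * (1 + (a / L - D / L\<^sup>2)) \<le> L * exp (a / L - D / L\<^sup>2)"
    using L by (intro mult_left_mono exp_ge_add_one_self) auto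
  moreover have "L * (1 + (a / L - D / L\<^sup>2)) = L + a - D / L"
    using L by (simp add: field_simps power2_eq_square)
  moreover have "(\<Prod>j<n. L + c j) powr (1 / real n) = exp ((\<Sum>j<n. ln (L + c j)) / real n)"
    by (rule powr_inverse_eq_exp_mean_ln) (use c L in \<open>auto intro: add_pos_nonneg\<close>)
  ultimately show ?thesis unfolding a_def[symmetric] D_def[symmetric] by linarith
qed

lemma chain_level_ge: "n \<ge> 1 \<Longrightarrow> chain_level n K \<ge> real K"
proof (cases K)
  case (Suc k)
  assume "n \<ge> 1"
  then have "real K * 1 \<le> real K * (real K + real n - 1)" using Suc by (intro mult_left_mono) auto
  then show ?thesis by (simp add: chain_level_def)
qed (simp add: chain_level_def)

lemma chain_level_lower_bound:
  assumes n: "n \<ge> 1" and K: "K \<ge> 1"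
  shows "fact n powr (2 / real n) * real (k_plus n K) powr (2 / real n) - (real n - 1) * (real n - 2) / 6 \<le> chain_level n K"
proof -
  have L: "chain_level n K > 0" using chain_level_ge[OF n, of K] K by simp
  have "(\<Prod>j<n. chain_level n K + chain_shift n j) powr (1 / real n) \<le> (\<Sum>j<n. chain_level n K + chain_shift n j) / real n"
    using n L chain_shift_nonneg by (intro geometric_mean_le) (auto intro: add_pos_nonneg)
  also have "\<dots> = chain_level n K + (real n - 1) * (real n - 2) / 6"
    using n by (simp add: sum.distrib sum_chain_shift add_divide_distrib)
  finally show ?thesis unfolding weyl_term_eq[OF n K] by simp
qed

lemma chain_level_asymptotics:
  assumes n: "n \<ge> 1"
  shows "(\<lambda>K. chain_level n K - fact n powr (2 / real n) * real (k_plus n K) powr (2 / real n))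
    \<longlonglongrightarrow> - ((real n - 1) * (real n - 2) / 6)"
proof -
  let ?a = "(real n - 1) * (real n - 2) / 6"
  define D where "D = (\<Sum>j<n. (chain_shift n j)\<^sup>2) / real n"
  have top: "filterlim (chain_level n) at_top sequentially"
    by (rule filterlim_at_top_mono[OF filterlim_real_sequentially]) (use chain_level_ge[OF n] in auto)
  show ?thesis
  proof (rule tendsto_sandwich)
    show "\<forall>\<^sub>F K in sequentially. - ?a \<le> chain_level n K - fact n powr (2 / real n) * real (k_plus n K) powr (2 / real n)"
      using eventually_ge_at_top[of 1]
    proof eventually_elim
      case (elim K)
      then show ?case using chain_level_lower_bound[OF n elim] by linarith
    qed
    \<comment> \<open>One condition bounds all shifts at once: they are nonnegative, so each is at
      most their sum.\<close>
    have "\<forall>\<^sub>F K in sequentially. (\<Sum>j<n. chain_shift n j) \<le> chain_level n K"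
      using top by (simp add: filterlim_at_top)
    then show "\<forall>\<^sub>F K in sequentially. chain_level n K - fact n powr (2 / real n) * real (k_plus n K) powr (2 / real n) \<le> - ?a + D / chain_level n K"
      using eventually_ge_at_top[of 1]
    proof eventually_elim
      case (elim K)
      have L: "chain_level n K > 0" using chain_level_ge[OF n, of K] elim by simp
      have "chain_shift n j \<le> chain_level n K" if "j < n" for j
        using member_le_sum[of j "{..<n}" "chain_shift n"] chain_shift_nonneg that elim by auto
      then have "chain_level n K + (\<Sum>j<n. chain_shift n j) / real n - D / chain_level n K \<le>
          (\<Prod>j<n. chain_level n K + chain_shift n j) powr (1 / real n)"
        unfolding D_def using n L chain_shift_nonneg by (intro geometric_mean_ge) auto
      moreover have "(\<Sum>j<n. chain_shift n j) / real n = ?a" using n by (simp add: sum_chain_shift)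
      ultimately show ?case unfolding weyl_term_eq[OF n elim(2)] by linarith
    qed
    have "(\<lambda>K. D / chain_level n K) \<longlonglongrightarrow> 0"
      by (rule tendsto_divide_0[OF tendsto_const filterlim_at_top_imp_at_infinity[OF top]])
    then have "(\<lambda>K. - ?a + D / chain_level n K) \<longlonglongrightarrow> - ?a + 0" by (intro tendsto_intros)
    then show "(\<lambda>K. - ?a + D / chain_level n K) \<longlonglongrightarrow> - ?a" by simp
  qed (rule tendsto_const)
qed

section \<open>Identification of the spectrum\<close>

lemma down_closed_nat_eq:
  assumes "finite A" "A \<subseteq> {1..}" "\<And>j k. k \<in> A \<Longrightarrow> 1 \<le> j \<Longrightarrow> j \<le> k \<Longrightarrow> j \<in> A"
  shows "A = {1..card A}"
proof (cases "A = {}")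
  case False
  have "A = {1..Max A}"
  proof (intro equalityI subsetI)
    fix j assume "j \<in> {1..Max A}"
    then show "j \<in> A" using assms(3)[OF Max_in[OF assms(1) False]] by simp
  qed (use assms(1,2) in auto)
  then show ?thesis by (metis card_atLeastAtMost diff_Suc_1)
qed simp

lemma obtain_chain:
  assumes "n \<ge> 1" "k \<ge> 1"
  obtains K where "K \<ge> 1" "k_plus n (K - 1) < k" "k \<le> k_plus n K"
proof -
  have ex: "k \<le> k_plus n k" using strict_mono_imp_increasing[OF strict_mono_k_plus[OF assms(1)]] by simp
  define K where "K = (LEAST K. k \<le> k_plus n K)"
  have K: "k \<le> k_plus n K" unfolding K_def by (rule LeastI[of _ k]) (rule ex)
  then have K1: "K \<ge> 1" using assms(2) by (cases K) (auto simp: k_plus_0)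
  then have "\<not> k \<le> k_plus n (K - 1)" unfolding K_def by (intro not_less_Least) auto
  then show ?thesis using that K K1 by simp
qed

text \<open>The value of \<open>SOME\<close> in \<open>dirichlet_eigenvalue\<close> is pinned down by the dimensions of the
  eigenspaces.\<close>

lemma dirichlet_eigenvalue_eq:
  fixes M :: "'a::euclidean_space set"
  assumes n: "n \<ge> 1"
    and fin: "\<And>\<mu>. \<exists>B. finite B \<and> dirichlet_eigenspace M \<mu> \<subseteq> fun_space.span B"
    and dim: "\<And>K. K \<ge> 1 \<Longrightarrow> fun_space.dim (dirichlet_eigenspace M (chain_level n K)) = chain_mult n K"
    and dim0: "\<And>\<mu>. (\<And>K. K \<ge> 1 \<Longrightarrow> \<mu> \<noteq> chain_level n K) \<Longrightarrow> fun_space.dim (dirichlet_eigenspace M \<mu>) = 0"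
    and K: "K \<ge> 1" "k_plus n (K - 1) < k" "k \<le> k_plus n K"
  shows "dirichlet_eigenvalue M k = chain_level n K"
proof -
  note sm = strict_mono_k_plus[OF n] and sl = strict_mono_chain_level[OF n]
  have uniq: "K = K'" if "k_plus n (K - 1) < k" "k \<le> k_plus n K" "k_plus n (K' - 1) < k" "k \<le> k_plus n K'" for K K' k
  proof -
    have "\<not> K < K'" if "k \<le> k_plus n K" "k_plus n (K' - 1) < k" for K K'
    proof
      assume "K < K'"
      then have "K \<le> K' - 1" by simp
      then have "k_plus n K \<le> k_plus n (K' - 1)" using sm by (simp add: strict_mono_less_eq)
      then show False using that by simp
    qed
    then show ?thesis using that by (meson linorder_neqE_nat)
  qed
  \<comment> \<open>An explicit spectrum is exhibited so that the chosen sequence is known to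
    satisfy \<open>dirichlet_spectrum\<close>; only then can its values be determined.\<close>
  define lam0 where "lam0 k = chain_level n (THE K. K \<ge> 1 \<and> k_plus n (K - 1) < k \<and> k \<le> k_plus n K)" for k
  have lam0: "lam0 k = chain_level n K" if "K \<ge> 1" "k_plus n (K - 1) < k" "k \<le> k_plus n K" for k K
  proof -
    have "(THE K. K \<ge> 1 \<and> k_plus n (K - 1) < k \<and> k \<le> k_plus n K) = K"
      by (rule the_equality) (use that uniq in auto)
    then show ?thesis by (simp add: lam0_def)
  qed
  have fiber: "{k. 1 \<le> k \<and> lam0 k = chain_level n K} = {k_plus n (K - 1)<..k_plus n K}" if "K \<ge> 1" for K
  proof (intro equalityI subsetI)
    fix k assume k: "k \<in> {k. 1 \<le> k \<and> lam0 k = chain_level n K}"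
    then obtain K' where K': "K' \<ge> 1" "k_plus n (K' - 1) < k" "k \<le> k_plus n K'"
      using obtain_chain[OF n, of k] by auto
    then have "chain_level n K' = chain_level n K" using lam0 k by simp
    then have "K' = K" using sl by (simp add: strict_mono_eq)
    then show "k \<in> {k_plus n (K - 1)<..k_plus n K}" using K' by simp
  qed (use lam0[OF that] in auto)
  have "dirichlet_spectrum M lam0"
    unfolding dirichlet_spectrum_def
  proof (intro conjI allI impI)
    fix j k :: nat assume jk: "1 \<le> j \<and> j \<le> k"
    obtain J where J: "J \<ge> 1" "k_plus n (J - 1) < j" "j \<le> k_plus n J" using obtain_chain[OF n, of j] jk by auto
    obtain L where L: "L \<ge> 1" "k_plus n (L - 1) < k" "k \<le> k_plus n L" using obtain_chain[OF n, of k] jk by auto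
    have "k_plus n (J - 1) < k_plus n L" using J L jk by linarith
    then have "J - 1 < L" using sm by (simp add: strict_mono_less)
    then have "J \<le> L" using J(1) by simp
    then show "lam0 j \<le> lam0 k" unfolding lam0[OF J] lam0[OF L] using sl by (simp add: strict_mono_less_eq)
  next
    fix \<mu>
    show "\<exists>B. finite B \<and> dirichlet_eigenspace M \<mu> \<subseteq> fun_space.span B" by (rule fin)
    have "finite {k. 1 \<le> k \<and> lam0 k = \<mu>} \<and> card {k. 1 \<le> k \<and> lam0 k = \<mu>} = fun_space.dim (dirichlet_eigenspace M \<mu>)"
    proof (cases "\<exists>K\<ge>1. \<mu> = chain_level n K")
      case True
      then obtain K where K: "K \<ge> 1" "\<mu> = chain_level n K" by auto
      then show ?thesis unfolding K(2) fiber[OF K(1)] dim[OF K(1)] using k_plus_Suc[of n "K - 1"] by simp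
    next
      case False
      have "lam0 k \<noteq> \<mu>" if "k \<ge> 1" for k using obtain_chain[OF n that] lam0 False by metis
      then have em: "{k. 1 \<le> k \<and> lam0 k = \<mu>} = {}" by auto
      show ?thesis unfolding em using dim0[of \<mu>] False by simp
    qed
    then show "finite {k. 1 \<le> k \<and> lam0 k = \<mu>}" "card {k. 1 \<le> k \<and> lam0 k = \<mu>} = fun_space.dim (dirichlet_eigenspace M \<mu>)" by auto
  qed
  then have spec: "dirichlet_spectrum M (dirichlet_eigenvalue M)"
    unfolding dirichlet_eigenvalue_def by (rule someI[of "dirichlet_spectrum M"])
  define lam where "lam = dirichlet_eigenvalue M"
  have mono: "lam j \<le> lam k" if "1 \<le> j" "j \<le> k" for j k
    using spec that by (simp add: dirichlet_spectrum_def lam_def)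
  have fin_fib: "finite {k. 1 \<le> k \<and> lam k = \<mu>}"
    and card_fib: "card {k. 1 \<le> k \<and> lam k = \<mu>} = fun_space.dim (dirichlet_eigenspace M \<mu>)" for \<mu>
    using spec by (simp_all add: dirichlet_spectrum_def lam_def)
  \<comment> \<open>The fibre of a value of lam is nonempty, so its eigenspace has positive
    dimension and the value must be a level.\<close>
  have lev: "\<exists>i\<ge>1. lam k = chain_level n i" if "k \<ge> 1" for k
  proof (rule ccontr)
    assume "\<not> ?thesis"
    then have "card {j. 1 \<le> j \<and> lam j = lam k} = 0" unfolding card_fib by (intro dim0) auto
    then show False using fin_fib[of "lam k"] that by auto
  qed
  \<comment> \<open>By monotonicity these indices form an initial segment, and its length is the sum
    of the multiplicities of the levels up to K. The empty segment for K = 0 is needed for the first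
    chain.\<close>
  have below: "{k. 1 \<le> k \<and> lam k \<le> chain_level n K} = {1..k_plus n K}" for K
  proof -
    let ?A = "{k. 1 \<le> k \<and> lam k \<le> chain_level n K}"
    have A: "?A = (\<Union>i\<in>{1..K}. {k. 1 \<le> k \<and> lam k = chain_level n i})"
    proof (intro equalityI subsetI)
      fix k assume k: "k \<in> ?A"
      then obtain i where "i \<ge> 1" "lam k = chain_level n i" using lev by auto
      then show "k \<in> (\<Union>i\<in>{1..K}. {k. 1 \<le> k \<and> lam k = chain_level n i})"
        using k sl by (auto simp: strict_mono_less_eq)
    qed (use sl in \<open>auto simp: strict_mono_less_eq\<close>)
    have "card ?A = (\<Sum>i\<in>{1..K}. card {k. 1 \<le> k \<and> lam k = chain_level n i})"
      unfolding A using fin_fib sl by (intro card_UN_disjoint) (auto simp: strict_mono_eq)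
    also have "\<dots> = k_plus n K" unfolding card_fib k_plus_def by (intro sum.cong) (auto simp: dim)
    finally have cardA: "card ?A = k_plus n K" .
    have "finite ?A" unfolding A using fin_fib by auto
    then have "?A = {1..card ?A}"
    proof (rule down_closed_nat_eq)
      fix j k assume "k \<in> ?A" "1 \<le> j" "j \<le> k"
      then show "j \<in> ?A" using mono[of j k] by simp
    qed auto
    then show ?thesis unfolding cardA .
  qed
  have k1: "1 \<le> k" using K(2) by simp
  have below': "lam k \<le> chain_level n K \<longleftrightarrow> k \<le> k_plus n K" for K
    using eqset_imp_iff[OF below[of K], of k] k1 by simp
  have "lam k \<le> chain_level n K" "\<not> lam k \<le> chain_level n (K - 1)"
    unfolding below' using K by simp_all
  moreover obtain i where i: "lam k = chain_level n i" using lev[OF k1] by auto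
  ultimately have "i \<le> K" "\<not> i \<le> K - 1" using sl by (auto simp: strict_mono_less_eq)
  then have "i = K" by simp
  then show ?thesis using i by (simp add: lam_def)
qed

section \<open>Volume and Weyl constant of the hemisphere\<close>

context half_space
begin

text \<open>The cone over M is the open half of the unit ball together with 0. Reflection in the
  origin exchanges the two halves, and the hyperplane between them is a null set.\<close>

lemma sphere_volume_M: "sphere_volume M = real DIM('a) * (unit_ball_vol (real DIM('a)) / 2)"
proof -
  let ?A = "cball 0 1 \<inter> H" and ?A' = "cball 0 1 \<inter> {y. y \<bullet> e < 0}" and ?Z = "{y. e \<bullet> y = 0}"
  have "{t *\<^sub>R x |t x. 0 \<le> t \<and> t \<le> 1 \<and> x \<in> M} = insert 0 ?A"
  proof (intro equalityI subsetI)
    fix y assume "y \<in> {t *\<^sub>R x |t x. 0 \<le> t \<and> t \<le> 1 \<and> x \<in> M}"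
    then obtain t x where "y = t *\<^sub>R x" "0 \<le> t" "t \<le> 1" "x \<in> M" by auto
    then show "y \<in> insert 0 ?A" by (cases "t = 0") (auto simp: M_def H_def)
  next
    fix y assume y: "y \<in> insert 0 ?A"
    show "y \<in> {t *\<^sub>R x |t x. 0 \<le> t \<and> t \<le> 1 \<and> x \<in> M}"
    proof (cases "y = 0")
      case True
      have "e \<in> M" using e by (simp add: M_def)
      then show ?thesis using True by (intro CollectI exI[of _ 0] exI[of _ e]) auto
    next
      case False
      then have "y = norm y *\<^sub>R sgn y" "norm y \<le> 1" "sgn y \<in> M"
        using y vimage_M by (auto simp: sgn_div_norm)
      then show ?thesis by (intro CollectI exI[of _ "norm y"] exI[of _ "sgn y"]) auto
    qed
  qed
  moreover have A: "?A \<in> lmeasurable" "?A' \<in> lmeasurable"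
  proof -
    have "open {y. y \<bullet> e < 0}" by (intro open_Collect_less continuous_intros)
    then show "?A \<in> lmeasurable" "?A' \<in> lmeasurable"
      using open_H by (auto intro!: fmeasurable_Int_fmeasurable borel_open lmeasurable_cball)
  qed
  have "measure lebesgue (insert 0 ?A) = measure lebesgue ?A"
    by (rule measure_negligible_symdiff) (use A in \<open>auto simp: fmeasurableD intro: negligible_subset[of "{0}"]\<close>)
  moreover have "measure lebesgue ?A' = measure lebesgue ?A"
  proof -
    have "?A' = (\<lambda>y. (- 1) *\<^sub>R y + 0) ` ?A"
      by (auto simp: H_def image_iff intro!: bexI[of _ "- _"])
    then show ?thesis using measure_lebesgue_affine[of "- 1" 0 ?A] by simp
  qed
  moreover have "measure lebesgue (cball (0::'a) 1) = measure lebesgue (?A \<union> ?A')"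
  proof (rule measure_negligible_symdiff)
    have "e \<noteq> 0" using e by auto
    then have "negligible ?Z" using negligible_hyperplane[of e 0] by simp
    then show "negligible (?A \<union> ?A' - cball 0 1 \<union> (cball 0 1 - (?A \<union> ?A')))"
      by (rule negligible_subset) (auto simp: H_def inner_commute)
  qed (use A in auto)
  moreover have "measure lebesgue (?A \<union> ?A') = measure lebesgue ?A + measure lebesgue ?A'"
    using A by (intro measure_Union) (auto simp: H_def fmeasurableD dest: fmeasurableD2)
  moreover have "measure lebesgue (cball (0::'a) 1) = unit_ball_vol (real DIM('a))"
    using content_cball[of 1 "0::'a"] by simp
  ultimately show ?thesis unfolding sphere_volume_def by simp
qed

end

text \<open>With z = (n + 1) / 2 the two ball volumes contain Gamma (z + 1/2) and Gamma (z + 1) = z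
  Gamma z, and n + 1 = 2 z cancels the extra z. Legendre's duplication formula evaluates the
  remaining product; it is applied to complex arguments and brought back to the reals.\<close>

lemma unit_ball_vol_mult_hemisphere_volume:
  "unit_ball_vol (real n) * (real (n + 1) * (unit_ball_vol (real (n + 1)) / 2)) = (2 * pi) ^ n / fact n"
proof -
  define z where "z = (real n + 1) / 2"
  have z: "z > 0" by (simp add: z_def)
  have nonpos: "complex_of_real x \<notin> \<int>\<^sub>\<le>\<^sub>0" if "x > 0" for x
    using that by (auto elim!: nonpos_Ints_cases simp: complex_eq_iff)
  have "complex_of_real (Gamma z * Gamma (z + 1 / 2)) = Gamma (complex_of_real z) * Gamma (complex_of_real z + 1 / 2)"
    by (simp flip: Gamma_complex_of_real)
  also have "\<dots> = exp ((1 - 2 * complex_of_real z) * of_real (ln 2)) * of_real (sqrt pi) * Gamma (2 * complex_of_real z)"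
    using nonpos[of z] nonpos[of "z + 1 / 2"] z by (intro Gamma_legendre_duplication) auto
  also have "\<dots> = complex_of_real (exp ((1 - 2 * z) * ln 2) * sqrt pi * Gamma (2 * z))"
    by (simp flip: Gamma_complex_of_real exp_of_real)
  finally have "Gamma z * Gamma (z + 1 / 2) = exp ((1 - 2 * z) * ln 2) * sqrt pi * Gamma (2 * z)"
    by (simp only: of_real_eq_iff)
  also have "2 * z = real n + 1" by (simp add: z_def)
  also have "Gamma (real n + 1) = fact n" by (simp add: Gamma_fact add.commute)
  also have "exp ((1 - (real n + 1)) * ln 2) = 1 / 2 ^ n"
    by (simp add: exp_minus exp_of_nat_mult divide_inverse power_inverse)
  finally have G: "Gamma z * Gamma (z + 1 / 2) = sqrt pi * fact n / 2 ^ n" by simp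
  have Gpos: "Gamma z > 0" "Gamma (z + 1 / 2) > 0" using z by (auto intro!: Gamma_real_pos)
  have "Gamma (z + 1) = z * Gamma z" using z by (intro Gamma_plus1) (auto simp: nonpos_Ints_def)
  moreover have "unit_ball_vol (real (n + 1)) = pi powr z / Gamma (z + 1)"
    by (simp add: unit_ball_vol_def z_def add.commute)
  moreover have "real (n + 1) = 2 * z" by (simp add: z_def)
  ultimately have "real (n + 1) * (unit_ball_vol (real (n + 1)) / 2) = 2 * z * (pi powr z / (z * Gamma z) / 2)"
    by metis
  also have "\<dots> = pi powr z / Gamma z" using z by simp
  finally have "real (n + 1) * (unit_ball_vol (real (n + 1)) / 2) = pi powr z / Gamma z" .
  moreover have "unit_ball_vol (real n) = pi powr (real n / 2) / Gamma (z + 1 / 2)"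
    by (simp add: unit_ball_vol_def z_def add_divide_distrib add.assoc)
  ultimately have "unit_ball_vol (real n) * (real (n + 1) * (unit_ball_vol (real (n + 1)) / 2))
      = pi powr (real n / 2 + z) / (Gamma z * Gamma (z + 1 / 2))"
    by (simp add: powr_add)
  also have "real n / 2 + z = real n + 1 / 2" by (simp add: z_def field_simps)
  also have "pi powr (real n + 1 / 2) = pi ^ n * sqrt pi"
    by (simp add: powr_add powr_realpow powr_half_sqrt)
  finally show ?thesis unfolding G by (simp add: power_mult_distrib)
qed

lemma weyl_constant_hemisphere:
  assumes "n \<ge> 1"
  shows "weyl_constant n (real (n + 1) * (unit_ball_vol (real (n + 1)) / 2)) = fact n powr (2 / real n)"
proof -
  have "((2 * pi) ^ n / fact n) powr (2 / real n) = ((2 * pi) powr real n) powr (2 / real n) / fact n powr (2 / real n)"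
    by (simp add: powr_divide powr_realpow)
  also have "((2 * pi) powr real n) powr (2 / real n) = (2 * pi)\<^sup>2"
    using assms by (simp add: powr_powr)
  finally show ?thesis
    unfolding weyl_constant_def unit_ball_vol_mult_hemisphere_volume by (simp add: power_mult_distrib)
qed

theorem theorem2:
  fixes S :: "((real^'n) \<times> real) set" and n :: nat and lam :: "nat \<Rightarrow> real" and C :: real
  assumes n: "n = CARD('n)" "n \<ge> 2"
    and S: "S = hemisphere"
    and lam: "lam = dirichlet_eigenvalue S"
    and C: "C = weyl_constant n (sphere_volume S)"
  shows "(\<forall>k\<ge>1. lam k \<ge> C * real k powr (2 / real n) - (real n - 1) * (real n - 2) / 6) \<and>
         (\<lambda>K. lam (k_plus n K) - C * real (k_plus n K) powr (2 / real n))
            \<longlonglongrightarrow> - ((real n - 1) * (real n - 2) / 6) \<and>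
         (n = 2 \<longrightarrow> (\<forall>K\<ge>1. lam (k_plus n K) - C * real (k_plus n K) = 0))"
proof -
  define e :: "(real^'n) \<times> real" where "e = (0, 1)"
  interpret half_space e
    by unfold_locales (simp add: e_def Basis_prod_def)
  have N: "DIM((real^'n) \<times> real) = n + 1" using n by simp
  have SM: "S = M" unfolding S hemisphere_def M_def by (simp add: e_def inner_prod_def)
  have level: "real K * (real K + real DIM((real^'n) \<times> real) - 2) = chain_level n K" for K
    unfolding N by (simp add: chain_level_def)
  have n1: "n \<ge> 1" using n by simp
  have lam_eq: "lam k = chain_level n K" if "K \<ge> 1" "k_plus n (K - 1) < k" "k \<le> k_plus n K" for k K
    unfolding lam SM
  proof (rule dirichlet_eigenvalue_eq[OF n1 _ _ _ that])
    show "\<exists>B. finite B \<and> dirichlet_eigenspace M \<mu> \<subseteq> fun_space.span B" for \<mu>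
    proof (cases "\<exists>K. \<mu> = chain_level n K")
      case True
      then show ?thesis using dim_eigenspace(1) N n unfolding level[symmetric] by auto
    next
      case False
      then show ?thesis using dim_eigenspace_0(1)[of \<mu>] unfolding level by auto
    qed
    show "fun_space.dim (dirichlet_eigenspace M (chain_level n K)) = chain_mult n K" if "K \<ge> 1" for K
    proof -
      have "fun_space.dim (dirichlet_eigenspace M (chain_level n K)) = card (lin_multiindices K)"
        by (rule dim_eigenspace(2)) (use level N n in auto)
      then show ?thesis using card_lin_multiindices[OF _ that] N n by simp
    qed
    show "fun_space.dim (dirichlet_eigenspace M \<mu>) = 0" if "\<And>K. K \<ge> 1 \<Longrightarrow> \<mu> \<noteq> chain_level n K" for \<mu>
    \<comment> \<open>The number 0 is K (K + n - 1) for K = 0 but is not an eigenvalue. It is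
      handled as degree 0, which has no index linear in t.\<close>
    proof (cases "\<mu> = chain_level n 0")
      case True
      have "fun_space.dim (dirichlet_eigenspace M \<mu>) = card (lin_multiindices 0)"
        by (rule dim_eigenspace(2)) (use True level[of 0] N n in auto)
      then show ?thesis by (simp add: lin_multiindices_0)
    next
      case False
      have "\<mu> \<noteq> chain_level n K" for K using that[of K] False by (cases K) auto
      then show ?thesis using dim_eigenspace_0(2)[of \<mu>] unfolding level by blast
    qed
  qed
  have Ceq: "C = fact n powr (2 / real n)"
    unfolding C SM sphere_volume_M N by (rule weyl_constant_hemisphere[OF n1])
  have lam_top: "lam (k_plus n K) = chain_level n K" if "K \<ge> 1" for K
    using strict_mono_k_plus[OF n1] that by (intro lam_eq) (auto simp: strict_mono_less)
  have "lam k \<ge> C * real k powr (2 / real n) - (real n - 1) * (real n - 2) / 6" if k: "k \<ge> 1" for k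
  proof -
    obtain K where K: "K \<ge> 1" "k_plus n (K - 1) < k" "k \<le> k_plus n K" by (rule obtain_chain[OF n1 k])
    \<comment> \<open>Along a chain the eigenvalue is constant while the Weyl term increases with k,
      so the last index is the extreme case.\<close>
    have "C * real k powr (2 / real n) \<le> C * real (k_plus n K) powr (2 / real n)"
      unfolding Ceq using K(3) by (intro mult_left_mono powr_mono2) auto
    then show ?thesis
      using chain_level_lower_bound[OF n1 K(1)] unfolding lam_eq[OF K] Ceq by linarith
  qed
  moreover have "(\<lambda>K. lam (k_plus n K) - C * real (k_plus n K) powr (2 / real n))
      \<longlonglongrightarrow> - ((real n - 1) * (real n - 2) / 6)"
  proof (rule Lim_transform_eventually[OF chain_level_asymptotics[OF n1]])
    show "\<forall>\<^sub>F K in sequentially. chain_level n K - fact n powr (2 / real n) * real (k_plus n K) powr (2 / real n)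
        = lam (k_plus n K) - C * real (k_plus n K) powr (2 / real n)"
      using eventually_ge_at_top[of 1] by eventually_elim (simp add: lam_top Ceq)
  qed
  moreover have "lam (k_plus n K) - C * real (k_plus n K) = 0" if "n = 2" "K \<ge> 1" for K
  proof -
    \<comment> \<open>For n = 2 the power 2/n is 1, and C k at the end of a chain is the eigenvalue
      K (K + 1) itself.\<close>
    have "fact 2 * real (k_plus 2 K) = real K * (real K + 1)"
      using fact_k_plus[of 2 K] that by (simp add: numeral_2_eq_2 lessThan_Suc)
    then show ?thesis using that lam_top[of K] by (simp add: Ceq chain_level_def)
  qed
  ultimately show ?thesis by blast
qed

end
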